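(* Let $\mathcal C$ be the set of functions $f:[0,b]\times\mathcal S\to\mathbb R$ which are differentiable in the first variable with bounded and Lipschitz continuous derivative, i.e. there are constants $G',L'<\infty$ (which may depend on $f$) such that $|f_x(x,j)|\le G'$ and $|f_x(x,j)-f_x(y,j)|\le L'|x-y|$ for all $x,y\in[0,b]$, $j\in\mathcal S$. Then, for every $f\in\mathcal C$ and every $\delta>0$, there exists a matrix exponential random variable $Z$ with mean $\Delta$ and $\mathrm{Var}(Z)$ sufficiently small such that a QBD-RAP can be constructed from $Z$ (that is, points $t_1,\dots,t_p$ and a representation $(\boldsymbol\alpha,\mathbf S)$ of $Z$ as in the context can be chosen) whose generator $\mathbf B$ and closing operator $\mathbf V$ satisfy $$\|\mathbf B\mathbf Vf-Bf\|_\infty=\sup_{x\in[0,b],\,i\in\mathcal S}\big|\mathbf B\mathbf Vf(x,i)-Bf(x,i)\big|<\delta ,$$ where $B$ is the generator of the fluid queue. Further, $\mathcal C$ is a core for $B$.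
   Context: Fluid queue: $\mathcal S$ is a finite set, $\mathbf T=[T_{ij}]$ is the generator matrix of a continuous-time Markov chain on $\mathcal S$, $c_i\in\mathbb R\setminus\{0\}$ for $i\in\mathcal S$, $\mathcal P=\{i:c_i>0\}$, $\mathcal N=\{i:c_i<0\}$, $0<b<\infty$. $\mathcal L$ is the Banach space of bounded real functions on $[0,b]\times\mathcal S$ with the supremum norm. The operator $B$ (generator of the fluid queue with regulated boundaries) is $$Bf(x,i)=\sum_{j\in\mathcal S}T_{ij}f(x,j)+c_if_x(x,i),$$ except that $Bf(0,i)=\sum_jT_{ij}f(0,j)$ for $i\in\mathcal N$ and $Bf(b,i)=\sum_jT_{ij}f(b,j)$ for $i\in\mathcal P$. Its domain $\mathrm{Dom}(B)$ is the set of $f\in\mathcal L$ such that each $f(\cdot,i)$ is continuously differentiable on $(0,b)$ with $f_x(\cdot,i)$ extending continuously to $[0,b]$ (i.e. $f(\cdot,i)\in C^1[0,b]$). A subset $\mathcal C\subset\mathrm{Dom}(B)$ is a core for $B$ if for each $g\in\mathrm{Dom}(B)$ and $\eta>0$ there is $h\in\mathcal C$ with $\|g-h\|_\infty<\eta$ and $\|Bg-Bh\|_\infty<\eta$. Write $\mathbf T_{++},\mathbf T_{+-},\mathbf T_{-+},\mathbf T_{--}$ for the sub-matrices of $\mathbf T$ with rows/columns in $\mathcal P$ ($+$) or $\mathcal N$ ($-$), $\mathbf C_+=\mathrm{diag}(|c_i|,i\in\mathcal P)$, $\mathbf C_-=\mathrm{diag}(|c_i|,i\in\mathcal N)$. Grid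 (fixed): $K\ge1$ is an integer, $\Delta=b/K$, $y_k=(k-1)\Delta$ for $k=1,\dots,K+1$. For $k=1,\dots,K$, $\mathcal D_{k,i}=[y_k,y_{k+1})$ if $i\in\mathcal P$ and $\mathcal D_{k,i}=(y_k,y_{k+1}]$ if $i\in\mathcal N$. Matrix exponential variable: $Z\ge0$ has mean $\Delta$, no atom at $0$, and $\mathbb P(Z>x)=\boldsymbol\alpha e^{\mathbf Sx}\mathbf 1$ with density $\boldsymbol\alpha e^{\mathbf Sx}\mathbf s$, $x\ge0$, where $\mathbf S$ is a real $p\times p$ matrix, $\boldsymbol\alpha$ a $1\times p$ row vector, $\mathbf 1$ the vector of ones and $\mathbf s=-\mathbf S\mathbf 1$; the representation is minimal ($p$ as small as possible). Put $\varepsilon=\mathrm{Var}(Z)^{1/3}<1$. The representation is chosen such that for some points $0=t_1<2\varepsilon<t_2<\dots<t_p<\Delta-\varepsilon$ one has $\boldsymbol\alpha=\mathbf e_1^{\mathsf T}$ and $\mathbf e_n^{\mathsf T}e^{\mathbf Sx}\mathbf 1=\mathbb P(Z-t_n\ge x\mid Z>t_n)$ for $x\ge0$, $n=1,\dots,p$ (these functions of $x$ being linearly independent). Put $t_{p+1}=\Delta$ and $$\mathbf D=\int_0^{\Delta-\varepsilon}e^{\mathbf Sy}\mathbf s\,\frac{\boldsymbol\alpha e^{\mathbf Sy}}{\boldsymbol\alpha e^{\mathbf Sy}\mathbf 1}\,dy+\int_{\Delta-\varepsilon}^\infty e^{\mathbf Sy}\mathbf s\,\frac{\boldsymbol\alpha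 e^{\mathbf S(\Delta-\varepsilon)}}{\boldsymbol\alpha e^{\mathbf S(\Delta-\varepsilon)}\mathbf 1}\,dy .$$ QBD-RAP generator: $\mathbf B$ is the block matrix with blocks $\mathbf B(k,l)$, $k,l\in\{0,\dots,K+1\}$, where level $0$ has index set $\mathcal N$, level $K+1$ has index set $\mathcal P$, and levels $1,\dots,K$ have index set $\mathcal S\times\{1,\dots,p\}$ with phases in $\mathcal P$ listed before those in $\mathcal N$. Its nonzero blocks are $\mathbf B(0,0)=\mathbf T_{--}$; $\mathbf B(0,1)=[\mathbf T_{-+}\otimes\boldsymbol\alpha\;\;\mathbf 0]$; $\mathbf B(1,0)=\begin{bmatrix}\mathbf 0\\ \mathbf C_-\otimes\mathbf s\end{bmatrix}$; $\mathbf B(k,k)=\begin{bmatrix}\mathbf C_+\otimes\mathbf S+\mathbf T_{++}\otimes\mathbf I&\mathbf T_{+-}\otimes\mathbf D\\ \mathbf T_{-+}\otimes\mathbf D&\mathbf C_-\otimes\mathbf S+\mathbf T_{--}\otimes\mathbf I\end{bmatrix}$ for $1\le k\le K$; $\mathbf B(k,k+1)=\begin{bmatrix}\mathbf C_+\otimes(\mathbf s\boldsymbol\alpha)&\mathbf 0\\ \mathbf 0&\mathbf 0\end{bmatrix}$ for $1\le k\le K-1$; $\mathbf B(k,k-1)=\begin{bmatrix}\mathbf 0&\mathbf 0\\ \mathbf 0&\mathbf C_-\otimes(\mathbf s\boldsymbol\alpha)\end{bmatrix}$ for $2\le k\le K$; $\mathbf B(K,K+1)=\begin{bmatrix}\mathbf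 C_+\otimes\mathbf s\\ \mathbf 0\end{bmatrix}$; $\mathbf B(K+1,K)=[\mathbf 0\;\;\mathbf T_{+-}\otimes\boldsymbol\alpha]$; $\mathbf B(K+1,K+1)=\mathbf T_{++}$. $\mathbf e_{k,i,n}$ denotes the unit column vector with its $1$ at level $k$, phase $i$, index $n$ (with $n=1$ only when $k\in\{0,K+1\}$). Closing operator: for $1\le\ell\le K$, with $z_{\ell,j}(x)=y_{\ell+1}-x$ if $j\in\mathcal P$ and $z_{\ell,j}(x)=x-y_\ell$ if $j\in\mathcal N$, let $\mathbf v_{\ell,j}(x)=\big(e^{\mathbf Sz_{\ell,j}(x)}+e^{\mathbf S(2\Delta-z_{\ell,j}(x))}\big)[\mathbf I-e^{2\Delta\mathbf S}]^{-1}\mathbf s$ and $\mathbf V_{\ell,j}f=\int_{\mathcal D_{\ell,j}}\mathbf v_{\ell,j}(x)f(x,j)\,dx\in\mathbb R^p$; also $\mathbf V_{0,j}f=f(0,j)$ for $j\in\mathcal N$ and $\mathbf V_{K+1,j}f=f(b,j)$ for $j\in\mathcal P$. $\mathbf Vf$ is the column vector of all $\mathbf V_{\ell,j}f$, ordered as the index set of $\mathbf B$. Notation $\mathbf B\mathbf Vf(x,i)$: $\mathbf B\mathbf Vf(0,i)=\mathbf e_{0,i,1}^{\mathsf T}\mathbf B\mathbf Vf$ for $i\in\mathcal N$; $\mathbf B\mathbf Vf(b,i)=\mathbf e_{K+1,i,1}^{\mathsf T}\mathbf B\mathbf Vf$ for $i\in\mathcal P$; for $1\le k\le K$, $1\le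 n\le p$, $\mathbf B\mathbf Vf(x,i)=\mathbf e_{k,i,n}^{\mathsf T}\mathbf B\mathbf Vf$ when $x\in[y_k+t_n,y_k+t_{n+1})$ and $i\in\mathcal P$, or when $x\in(y_{k+1}-t_{n+1},y_{k+1}-t_n]$ and $i\in\mathcal N$. *)

theory Defs
  imports
    "HOL-Probability.Probability"
    "Jordan_Normal_Form.Gauss_Jordan_Elimination"
begin

text \<open>
  Phases are the elements of a finite type \<open>'s\<close>. A function on \<open>[0, b] \<times> \<S>\<close> is an
  \<open>f :: real \<Rightarrow> 's \<Rightarrow> real\<close> of which only the values on \<open>{0..b}\<close> matter.
  The order \<open>p\<close> of a matrix exponential representation is existentially quantified in the
  theorem, so matrices of that size are of type \<open>real mat\<close> (explicit dimensions). Rows and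
  columns are counted from 0: the mathematical index \<open>n = 1, ..., p\<close> is \<open>n - 1\<close> here, and
  \<open>t n\<close> stands for the point \<open>t\<^sub>n\<^sub>+\<^sub>1\<close> (in particular \<open>t p = \<Delta>\<close>).
\<close>

section \<open>The fluid queue\<close>

definition generator_matrix :: "('s::finite \<Rightarrow> 's \<Rightarrow> real) \<Rightarrow> bool" where
  "generator_matrix T \<longleftrightarrow> (\<forall>i j. i \<noteq> j \<longrightarrow> 0 \<le> T i j) \<and> (\<forall>i. (\<Sum>j\<in>UNIV. T i j) = 0)"

definition sup_norm :: "real \<Rightarrow> (real \<Rightarrow> 's::finite \<Rightarrow> real) \<Rightarrow> real" where
  "sup_norm b g = (SUP (x, i)\<in>{0..b} \<times> UNIV. \<bar>g x i\<bar>)"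

text \<open>The partial derivative in the first variable, one-sided at 0 and at \<open>b\<close>.\<close>

definition dx :: "real \<Rightarrow> (real \<Rightarrow> 's \<Rightarrow> real) \<Rightarrow> real \<Rightarrow> 's \<Rightarrow> real" where
  "dx b f x i = vector_derivative (\<lambda>y. f y i) (at x within {0..b})"

definition fluid_gen ::
  "real \<Rightarrow> ('s::finite \<Rightarrow> 's \<Rightarrow> real) \<Rightarrow> ('s \<Rightarrow> real) \<Rightarrow> (real \<Rightarrow> 's \<Rightarrow> real) \<Rightarrow> real \<Rightarrow> 's \<Rightarrow> real"
where
  "fluid_gen b T c f x i =
     (if x = 0 \<and> c i < 0 \<or> x = b \<and> c i > 0 then \<Sum>j\<in>UNIV. T i j * f x j
      else (\<Sum>j\<in>UNIV. T i j * f x j) + c i * dx b f x i)"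

definition fluid_dom :: "real \<Rightarrow> (real \<Rightarrow> 's::finite \<Rightarrow> real) set" where
  "fluid_dom b = {f. (\<exists>G. \<forall>x\<in>{0..b}. \<forall>i. \<bar>f x i\<bar> \<le> G) \<and>
     (\<forall>i. (\<lambda>x. f x i) differentiable_on {0..b} \<and> continuous_on {0..b} (\<lambda>x. dx b f x i))}"

definition fluid_core ::
  "real \<Rightarrow> ('s::finite \<Rightarrow> 's \<Rightarrow> real) \<Rightarrow> ('s \<Rightarrow> real) \<Rightarrow> (real \<Rightarrow> 's \<Rightarrow> real) set \<Rightarrow> bool"
where
  "fluid_core b T c C \<longleftrightarrow> C \<subseteq> fluid_dom b \<and>
     (\<forall>g\<in>fluid_dom b. \<forall>\<eta>>0. \<exists>h\<in>C.
        sup_norm b (\<lambda>x i. g x i - h x i) < \<eta> \<and>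
        sup_norm b (\<lambda>x i. fluid_gen b T c g x i - fluid_gen b T c h x i) < \<eta>)"

definition lipschitz_C1 :: "real \<Rightarrow> (real \<Rightarrow> 's::finite \<Rightarrow> real) set" where
  "lipschitz_C1 b = {f. (\<forall>j. (\<lambda>x. f x j) differentiable_on {0..b}) \<and>
     (\<exists>G L. \<forall>j. \<forall>x\<in>{0..b}. \<forall>y\<in>{0..b}.
        \<bar>dx b f x j\<bar> \<le> G \<and> \<bar>dx b f x j - dx b f y j\<bar> \<le> L * \<bar>x - y\<bar>)}"

section \<open>Matrix exponential variables\<close>

definition mat_exp :: "real mat \<Rightarrow> real mat" where
  "mat_exp A = Matrix.mat (dim_row A) (dim_row A) (\<lambda>(i, j). \<Sum>k. (A ^\<^sub>m k) $$ (i, j) / fact k)"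

definition ones :: "nat \<Rightarrow> real mat" where
  "ones p = Matrix.mat p 1 (\<lambda>_. 1)"

definition exit_rates :: "real mat \<Rightarrow> real mat" where
  "exit_rates S = - (S * ones (dim_row S))"

definition ME_representation ::
  "'w measure \<Rightarrow> ('w \<Rightarrow> real) \<Rightarrow> nat \<Rightarrow> real mat \<Rightarrow> real mat \<Rightarrow> bool"
where
  "ME_representation M Z p \<alpha> S \<longleftrightarrow>
     \<alpha> \<in> carrier_mat 1 p \<and> S \<in> carrier_mat p p \<and>
     (\<forall>x\<ge>0. \<P>(\<omega> in M. Z \<omega> > x) = (\<alpha> * mat_exp (x \<cdot>\<^sub>m S) * ones p) $$ (0, 0)) \<and>
     distributed M lborel Z
       (\<lambda>x. if 0 \<le> x then ennreal ((\<alpha> * mat_exp (x \<cdot>\<^sub>m S) * exit_rates S) $$ (0, 0)) else 0)"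

definition minimal_ME_representation ::
  "'w measure \<Rightarrow> ('w \<Rightarrow> real) \<Rightarrow> nat \<Rightarrow> real mat \<Rightarrow> real mat \<Rightarrow> bool"
where
  "minimal_ME_representation M Z p \<alpha> S \<longleftrightarrow> ME_representation M Z p \<alpha> S \<and>
     (\<forall>p' \<alpha>' S'. ME_representation M Z p' \<alpha>' S' \<longrightarrow> p \<le> p')"

definition eps :: "'w measure \<Rightarrow> ('w \<Rightarrow> real) \<Rightarrow> real" where
  "eps M Z = root 3 (prob_space.variance M Z)"

text \<open>
  The data from which a QBD-RAP with cell width \<open>\<Delta>\<close> is built: the variable \<open>Z\<close>, the points \<open>t\<close>
  and the representation \<open>(\<alpha>, S)\<close>. Square integrability is listed because the Bochner
  integrals in mean and variance are 0 by convention if they do not exist.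
\<close>

definition qbd_rap_data ::
  "'w measure \<Rightarrow> ('w \<Rightarrow> real) \<Rightarrow> real \<Rightarrow> nat \<Rightarrow> (nat \<Rightarrow> real) \<Rightarrow> real mat \<Rightarrow> real mat \<Rightarrow> bool"
where
  "qbd_rap_data M Z \<Delta> p t \<alpha> S \<longleftrightarrow>
     prob_space M \<and> Z \<in> borel_measurable M \<and> (\<forall>\<omega>\<in>space M. 0 \<le> Z \<omega>) \<and>
     \<P>(\<omega> in M. Z \<omega> = 0) = 0 \<and>
     integrable M (\<lambda>\<omega>. (Z \<omega>)\<^sup>2) \<and>
     prob_space.expectation M Z = \<Delta> \<and>
     eps M Z < 1 \<and>
     minimal_ME_representation M Z p \<alpha> S \<and>
     2 \<le> p \<and> t 0 = 0 \<and> 0 < 2 * eps M Z \<and> 2 * eps M Z < t 1 \<and>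
     (\<forall>n\<in>{1..<p - 1}. t n < t (Suc n)) \<and> t (p - 1) < \<Delta> - eps M Z \<and> t p = \<Delta> \<and>
     \<alpha> = Matrix.mat 1 p (\<lambda>(_, m). if m = 0 then 1 else 0) \<and>
     (\<forall>n<p. \<forall>x\<ge>0. (mat_exp (x \<cdot>\<^sub>m S) * ones p) $$ (n, 0) =
        \<P>(\<omega> in M. Z \<omega> - t n \<ge> x \<bar> Z \<omega> > t n)) \<and>
     (\<forall>a :: nat \<Rightarrow> real. (\<forall>x\<ge>0. (\<Sum>n<p. a n * (mat_exp (x \<cdot>\<^sub>m S) * ones p) $$ (n, 0)) = 0) \<longrightarrow>
        (\<forall>n<p. a n = 0))"

text \<open>Below, \<open>\<epsilon>\<close> is \<open>eps M Z\<close>.\<close>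

definition jump_mat :: "real \<Rightarrow> real \<Rightarrow> nat \<Rightarrow> real mat \<Rightarrow> real mat \<Rightarrow> real mat" where
  "jump_mat \<Delta> \<epsilon> p \<alpha> S = Matrix.mat p p (\<lambda>(n, m).
     (LBINT y:{0..\<Delta> - \<epsilon>}. (mat_exp (y \<cdot>\<^sub>m S) * exit_rates S) $$ (n, 0) *
        ((\<alpha> * mat_exp (y \<cdot>\<^sub>m S)) $$ (0, m) / (\<alpha> * mat_exp (y \<cdot>\<^sub>m S) * ones p) $$ (0, 0))) +
     (LBINT y:{\<Delta> - \<epsilon>..}. (mat_exp (y \<cdot>\<^sub>m S) * exit_rates S) $$ (n, 0) *
        ((\<alpha> * mat_exp ((\<Delta> - \<epsilon>) \<cdot>\<^sub>m S)) $$ (0, m) /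
         (\<alpha> * mat_exp ((\<Delta> - \<epsilon>) \<cdot>\<^sub>m S) * ones p) $$ (0, 0))))"

section \<open>The QBD-RAP generator\<close>

text \<open>
  Matrices with rows and columns labelled by pairs (phase, index) are functions on these labels,
  so that no enumeration of the phases is needed. The label of a phase \<open>i\<close> of level 0 or
  \<open>K + 1\<close> is \<open>(i, 0)\<close>.
\<close>

type_synonym 's block = "'s \<times> nat \<Rightarrow> 's \<times> nat \<Rightarrow> real"

definition kron :: "('s \<Rightarrow> 's \<Rightarrow> real) \<Rightarrow> real mat \<Rightarrow> 's block" (infixl "\<otimes>\<^sub>K" 75) where
  "(A \<otimes>\<^sub>K X) = (\<lambda>(i, n) (j, m). A i j * X $$ (n, m))"

definition block_add :: "'s block \<Rightarrow> 's block \<Rightarrow> 's block" (infixl "\<oplus>\<^sub>K" 65) where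
  "(X \<oplus>\<^sub>K Y) = (\<lambda>r s. X r s + Y r s)"

definition zero_block :: "'s block" ("\<zero>\<^sub>K") where
  "\<zero>\<^sub>K = (\<lambda>r s. 0)"

text \<open>
  \<open>phase_block c X\<^sub>+\<^sub>+ X\<^sub>+\<^sub>- X\<^sub>-\<^sub>+ X\<^sub>-\<^sub>-\<close> reads each entry from the block selected by the
  signs of the two phases; this also restricts \<open>T\<close> and \<open>rate_diag c\<close> to their sub-matrices.
\<close>

definition phase_block ::
  "('s \<Rightarrow> real) \<Rightarrow> 's block \<Rightarrow> 's block \<Rightarrow> 's block \<Rightarrow> 's block \<Rightarrow> 's block"
where
  "phase_block c Xpp Xpn Xnp Xnn = (\<lambda>r s.
     if c (fst r) > 0 then (if c (fst s) > 0 then Xpp r s else Xpn r s)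
     else (if c (fst s) > 0 then Xnp r s else Xnn r s))"

definition rate_diag :: "('s \<Rightarrow> real) \<Rightarrow> 's \<Rightarrow> 's \<Rightarrow> real" where
  "rate_diag c i j = (if i = j then \<bar>c i\<bar> else 0)"

definition qbd_block ::
  "nat \<Rightarrow> ('s::finite \<Rightarrow> 's \<Rightarrow> real) \<Rightarrow> ('s \<Rightarrow> real) \<Rightarrow> nat \<Rightarrow> real mat \<Rightarrow> real mat \<Rightarrow> real mat
    \<Rightarrow> nat \<Rightarrow> nat \<Rightarrow> 's block"
where
  "qbd_block K T c p \<alpha> S D k l =
     (let C = rate_diag c; s = exit_rates S in
      if k = 0 \<and> l = 0 then T \<otimes>\<^sub>K 1\<^sub>m 1
      else if k = 0 \<and> l = 1 then phase_block c \<zero>\<^sub>K \<zero>\<^sub>K (T \<otimes>\<^sub>K \<alpha>) \<zero>\<^sub>K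
      else if k = 1 \<and> l = 0 then phase_block c \<zero>\<^sub>K \<zero>\<^sub>K \<zero>\<^sub>K (C \<otimes>\<^sub>K s)
      else if 1 \<le> k \<and> k \<le> K \<and> l = k then
        phase_block c
          (C \<otimes>\<^sub>K S \<oplus>\<^sub>K T \<otimes>\<^sub>K 1\<^sub>m p) (T \<otimes>\<^sub>K D)
          (T \<otimes>\<^sub>K D) (C \<otimes>\<^sub>K S \<oplus>\<^sub>K T \<otimes>\<^sub>K 1\<^sub>m p)
      else if 1 \<le> k \<and> k < K \<and> l = k + 1 then phase_block c (C \<otimes>\<^sub>K (s * \<alpha>)) \<zero>\<^sub>K \<zero>\<^sub>K \<zero>\<^sub>K
      else if 2 \<le> k \<and> k \<le> K \<and> k = l + 1 then phase_block c \<zero>\<^sub>K \<zero>\<^sub>K \<zero>\<^sub>K (C \<otimes>\<^sub>K (s * \<alpha>))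
      else if k = K \<and> l = K + 1 then phase_block c (C \<otimes>\<^sub>K s) \<zero>\<^sub>K \<zero>\<^sub>K \<zero>\<^sub>K
      else if k = K + 1 \<and> l = K then phase_block c \<zero>\<^sub>K (T \<otimes>\<^sub>K \<alpha>) \<zero>\<^sub>K \<zero>\<^sub>K
      else if k = K + 1 \<and> l = K + 1 then T \<otimes>\<^sub>K 1\<^sub>m 1
      else \<zero>\<^sub>K)"

definition qbd_index :: "nat \<Rightarrow> ('s::finite \<Rightarrow> real) \<Rightarrow> nat \<Rightarrow> (nat \<times> 's \<times> nat) set" where
  "qbd_index K c p =
     {0} \<times> {i. c i < 0} \<times> {0} \<union> {1..K} \<times> UNIV \<times> {..<p} \<union> {K + 1} \<times> {i. c i > 0} \<times> {0}"

section \<open>The closing operator\<close>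

definition grid :: "real \<Rightarrow> nat \<Rightarrow> nat \<Rightarrow> real" where
  "grid b K k = (real k - 1) * (b / real K)"

definition cell :: "real \<Rightarrow> nat \<Rightarrow> ('s \<Rightarrow> real) \<Rightarrow> nat \<Rightarrow> 's \<Rightarrow> real set" where
  "cell b K c k i =
     (if c i > 0 then {grid b K k..<grid b K (k + 1)} else {grid b K k<..grid b K (k + 1)})"

definition closing_vec ::
  "real \<Rightarrow> nat \<Rightarrow> ('s \<Rightarrow> real) \<Rightarrow> nat \<Rightarrow> real mat \<Rightarrow> nat \<Rightarrow> 's \<Rightarrow> real \<Rightarrow> real mat"
where
  "closing_vec b K c p S l j x =
     (let \<Delta> = b / real K; z = (if c j > 0 then grid b K (l + 1) - x else x - grid b K l) in
      (mat_exp (z \<cdot>\<^sub>m S) + mat_exp ((2 * \<Delta> - z) \<cdot>\<^sub>m S)) *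
      the (mat_inverse (1\<^sub>m p - mat_exp ((2 * \<Delta>) \<cdot>\<^sub>m S))) * exit_rates S)"

definition closing_op ::
  "real \<Rightarrow> nat \<Rightarrow> ('s \<Rightarrow> real) \<Rightarrow> nat \<Rightarrow> real mat \<Rightarrow> (real \<Rightarrow> 's \<Rightarrow> real) \<Rightarrow> nat \<times> 's \<times> nat \<Rightarrow> real"
where
  "closing_op b K c p S f = (\<lambda>(l, j, m).
     if l = 0 then f 0 j
     else if l = K + 1 then f b j
     else LBINT x:cell b K c l j. closing_vec b K c p S l j x $$ (m, 0) * f x j)"

definition qbd_row ::
  "real \<Rightarrow> nat \<Rightarrow> ('s::finite \<Rightarrow> 's \<Rightarrow> real) \<Rightarrow> ('s \<Rightarrow> real) \<Rightarrow> nat \<Rightarrow> real mat \<Rightarrow> real mat \<Rightarrow> real mat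
    \<Rightarrow> (real \<Rightarrow> 's \<Rightarrow> real) \<Rightarrow> nat \<Rightarrow> 's \<Rightarrow> nat \<Rightarrow> real"
where
  "qbd_row b K T c p \<alpha> S D f k i n =
     (\<Sum>(l, j, m)\<in>qbd_index K c p.
        qbd_block K T c p \<alpha> S D k l (i, n) (j, m) * closing_op b K c p S f (l, j, m))"

definition piece ::
  "real \<Rightarrow> nat \<Rightarrow> ('s \<Rightarrow> real) \<Rightarrow> (nat \<Rightarrow> real) \<Rightarrow> nat \<Rightarrow> 's \<Rightarrow> nat \<Rightarrow> real set"
where
  "piece b K c t k i n =
     (if c i > 0 then {grid b K k + t n..<grid b K k + t (n + 1)}
      else {grid b K (k + 1) - t (n + 1)<..grid b K (k + 1) - t n})"

definition qbd_apply ::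
  "real \<Rightarrow> nat \<Rightarrow> ('s::finite \<Rightarrow> 's \<Rightarrow> real) \<Rightarrow> ('s \<Rightarrow> real) \<Rightarrow> nat \<Rightarrow> (nat \<Rightarrow> real)
    \<Rightarrow> real mat \<Rightarrow> real mat \<Rightarrow> real mat \<Rightarrow> (real \<Rightarrow> 's \<Rightarrow> real) \<Rightarrow> real \<Rightarrow> 's \<Rightarrow> real"
where
  "qbd_apply b K T c p t \<alpha> S D f x i =
     (if x = 0 \<and> c i < 0 then qbd_row b K T c p \<alpha> S D f 0 i 0
      else if x = b \<and> c i > 0 then qbd_row b K T c p \<alpha> S D f (K + 1) i 0
      else THE r. \<exists>k\<in>{1..K}. \<exists>n<p. x \<in> piece b K c t k i n \<and> r = qbd_row b K T c p \<alpha> S D f k i n)"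

end

theory Submission
  imports Defs "Jordan_Normal_Form.Jordan_Normal_Form" "HOL-Real_Asymp.Real_Asymp"
begin

text \<open>
  The vector \<open>v(z)\<close> of the closing operator folds a residual lifetime into a cell: its \<open>n\<close>-th entry
  is the density of \<open>Z - t\<^sub>n\<close> given \<open>Z > t\<^sub>n\<close>, reflected back and forth until it lives on
  \<open>[0, \<Delta>]\<close>, as a function of the distance \<open>z\<close> from the end at which the fluid leaves the cell.
  Hence every entry of \<open>V f\<close> is a weighted average of \<open>f\<close>, and if \<open>Z\<close> is concentrated at \<open>\<Delta>\<close>
  it is close to the value of \<open>f\<close> at the point that the fluid has reached after covering the
  distance \<open>t\<^sub>n\<close> in the cell (\<open>folded_average\<close>). For this reason each row of \<open>B V f\<close> reproduces
  the generator at that point.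

  \<^item> Without a change of the sign of the rate, the generator \<open>T\<close> acts on the averages directly.
  \<^item> At a change of sign, \<open>D\<close> replaces the elapsed lifetime by the remaining one. Distances are
    then measured from the other end of the cell, so that the position of the fluid is kept (\<open>jump_average\<close>).
  \<^item> Since \<open>S\<close> differentiates \<open>v\<close>, an integration by parts turns \<open>S V f\<close> into an average of the
    derivative of \<open>f\<close> and a boundary term. The boundary term and the block of the neighbouring cell
    combine to an exit rate times the difference of two approximations of \<open>f\<close> at the common end of
    the cells (\<open>drift_average\<close>).

  Two things can go wrong in the last item. The integration by parts gives the reflected part of the
  folded density the wrong sign. For \<open>n > 1\<close> that part is negligible, but for \<open>t\<^sub>1 = 0\<close> its mass
  is about the probability of \<open>Z > \<Delta>\<close>; so this probability has to be small, although \<open>Z\<close> has mean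
  \<open>\<Delta>\<close>. An Erlang variable, for which it tends to one half, would not do. A mixture does: with high
  probability \<open>Z\<close> is an Erlang variable of mean slightly below \<open>\<Delta>\<close>, and with the small probability
  \<open>w\<close> one of twice that mean. Also, the exit rates must not outweigh the small difference that they
  multiply. The density of the mixture increases on \<open>[0, \<Delta> - \<epsilon> / 2]\<close>, and as the variance is
  \<open>\<epsilon>\<^sup>3\<close>, Chebyshev's inequality bounds it by 8 on \<open>[0, \<Delta> - \<epsilon>]\<close> (\<open>f_le_8\<close>).

  Both Erlang laws have the same rate \<open>\<theta>\<close>, so the survival function of the mixture is
  \<open>exp (- \<theta> x)\<close> times a polynomial of degree \<open>p - 1\<close>. The functions \<open>exp (- \<theta> x) r(x)\<close>
  with \<open>r\<close> of degree below \<open>p\<close> form a translation-invariant space of dimension \<open>p\<close>, and the values at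
  any \<open>p\<close> distinct nodes \<open>t\<^sub>1, \<dots>, t\<^sub>p\<close> are coordinates on it. In these coordinates \<open>S\<close> is
  differentiation and its exponential is translation (\<open>mat_exp_value_col\<close>). This yields the
  representation for every choice of the nodes, whose mesh width therefore tends to 0 with growing
  \<open>p\<close> if they are spread evenly. The representation is minimal: the \<open>p\<close> translates of the survival
  function are linearly independent, while a representation of order \<open>r\<close> puts all translates into a
  space of dimension \<open>r\<close>.

  That the functions with Lipschitz derivative form a core follows from the theorem of Weierstrass:
  approximate the derivative uniformly by a polynomial and integrate (\<open>lipschitz_C1_core\<close>).
\<close>

section \<open>Averages against a residual lifetime folded into a cell\<close>

lemma integral_shift_window:
  fixes g :: "real \<Rightarrow> real"
  shows "integral {0..d} (\<lambda>z. g (z + t)) = integral {t..t + d} g"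
  using integral_shift_real_ivl[of t t "t + d" g] by simp

lemma integral_reflect_window:
  fixes g :: "real \<Rightarrow> real"
  shows "integral {0..d} (\<lambda>z. g (a - z)) = integral {a - d..a} g"
proof -
  have "integral {0..d} (\<lambda>z. g (a - z)) = integral {-d..0} (\<lambda>z. g (z + a))"
    using Henstock_Kurzweil_Integration.integral_reflect_real[of d 0 "\<lambda>z. g (a - z)"]
    by (simp add: algebra_simps)
  also have "\<dots> = integral {a - d..a} g"
    using integral_shift_real_ivl[of "a - d" a a g] by simp
  finally show ?thesis .
qed

lemma abs_integral_le_integral:
  fixes g h :: "real \<Rightarrow> real"
  assumes "continuous_on {a..b} g" "continuous_on {a..b} h" "\<And>z. z \<in> {a..b} \<Longrightarrow> \<bar>g z\<bar> \<le> h z"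
  shows "\<bar>integral {a..b} g\<bar> \<le> integral {a..b} h"
  using integral_norm_bound_integral[of g "{a..b}" h] assms by (simp add: integrable_continuous_real)

lemma lipschitz_cont:
  fixes \<phi> :: "real \<Rightarrow> real"
  assumes L: "\<And>x y. x \<in> A \<Longrightarrow> y \<in> A \<Longrightarrow> \<bar>\<phi> x - \<phi> y\<bar> \<le> L * \<bar>x - y\<bar>"
  shows "continuous_on A \<phi>"
proof (rule lipschitz_on_continuous_on[of "\<bar>L\<bar>"], rule lipschitz_onI)
  fix x y assume "x \<in> A" "y \<in> A"
  from L[OF this] show "dist (\<phi> x) (\<phi> y) \<le> \<bar>L\<bar> * dist x y"
    unfolding dist_real_def by (rule order_trans) (simp add: mult_right_mono)
qed simp

lemma tail_integral:
  fixes F f :: "real \<Rightarrow> real"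
  assumes f: "continuous_on UNIV f" "\<And>x. a \<le> x \<Longrightarrow> 0 \<le> f x"
    and F: "\<And>x. (F has_real_derivative - f x) (at x)" "(F \<longlongrightarrow> 0) at_top"
  shows "0 \<le> F a" "(\<integral>\<^sup>+x. ennreal (f x) * indicator {a..} x \<partial>lborel) = ennreal (F a)"
    "(LBINT x:{a..}. f x) = F a"
proof -
  have meas: "f \<in> borel_measurable borel" by (rule borel_measurable_continuous_onI[OF f(1)])
  have "((\<lambda>x. - F x) has_real_derivative f x) (at x)" for x
    using DERIV_minus[OF F(1)] by simp
  moreover have "((\<lambda>x. - F x) \<longlongrightarrow> 0) at_top" using tendsto_minus[OF F(2)] by simp
  ultimately show nn: "(\<integral>\<^sup>+x. ennreal (f x) * indicator {a..} x \<partial>lborel) = ennreal (F a)"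
    using meas f(2) nn_integral_FTC_atLeast[of f a "\<lambda>x. - F x" 0] by simp
  show F0: "0 \<le> F a"
  proof (rule tendsto_le[OF _ tendsto_const F(2)])
    show "\<forall>\<^sub>F x in at_top. F x \<le> F a"
      using eventually_ge_at_top[of a]
    proof eventually_elim
      case (elim x)
      show ?case
      proof (rule DERIV_nonpos_imp_nonincreasing[OF elim])
        fix y assume "a \<le> y" "y \<le> x"
        then show "\<exists>z. (F has_real_derivative z) (at y) \<and> z \<le> 0" using F(1) f(2) by fastforce
      qed
    qed
  qed simp
  have "(\<integral>\<^sup>+x. ennreal (indicator {a..} x * f x) \<partial>lborel) = ennreal (F a)"
    using nn by (subst nn_integral_cong[of _ _ "\<lambda>x. ennreal (f x) * indicator {a..} x"]) (auto split: split_indicator)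
  then have "has_bochner_integral lborel (\<lambda>x. indicator {a..} x * f x) (F a)"
    using meas f(2) F0 by (intro has_bochner_integral_nn_integral) (auto split: split_indicator)
  then show "(LBINT x:{a..}. f x) = F a" by (auto simp: set_lebesgue_integral_def has_bochner_integral_iff)
qed

text \<open>
  Here \<open>F\<close> and \<open>f\<close> are survival function and density of a lifetime, and \<open>U\<close> is the periodisation
  \<open>f(x) + f(x + 2 \<Delta>) + f(x + 4 \<Delta>) + \<dots>\<close>. The functional equation with decay at infinity
  characterises it and is what the inverse of \<open>I - exp (2 \<Delta> S)\<close> provides. The variance enters as
  \<open>\<epsilon>\<^sup>3\<close>, and \<open>\<kappa>\<close> bounds the probability of exceeding \<open>\<Delta>\<close>.
\<close>

locale folded_law =
  fixes \<Delta> \<epsilon> \<kappa> :: real and F f U :: "real \<Rightarrow> real"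
  assumes cell_pos: "0 < \<Delta>" and eps_pos: "0 < \<epsilon>" and eps_le: "\<epsilon> \<le> 1 / 2" "2 * \<epsilon> < \<Delta>"
    and F_deriv: "(F has_real_derivative - f x) (at x)"
    and f_cont: "continuous_on UNIV f"
    and U_cont: "continuous_on UNIV U"
    and f_nonneg: "0 \<le> x \<Longrightarrow> 0 \<le> f x"
    and U_period: "U x = f x + U (x + 2 * \<Delta>)"
    and F_lim: "(F \<longlongrightarrow> 0) at_top"
    and U_lim: "(U \<longlongrightarrow> 0) at_top"
    and F_0: "F 0 = 1"
    and second_moment: "0 \<le> T \<Longrightarrow> integral {0..T} (\<lambda>z. f z * (z - \<Delta>)\<^sup>2) \<le> \<epsilon> ^ 3"
    and F_cell: "F \<Delta> \<le> \<kappa>"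
    and f_mono: "mono_on {0..\<Delta> - \<epsilon> / 2} f"
begin

text \<open>
  The first summand collects the even passages of the reflected path through the cell, the second the
  odd ones. Up to the factor \<open>F t\<close> this is the folded density of the residual lifetime after \<open>t\<close>.
\<close>

definition folded :: "real \<Rightarrow> real \<Rightarrow> real" where
  "folded t z = U (z + t) + U (2 * \<Delta> - z + t)"

lemma F_cont: "continuous_on UNIV F"
  by (rule DERIV_continuous_on) (rule has_field_derivative_at_within[OF F_deriv])

lemma f_cont_on [continuous_intros]:
  "continuous_on A g \<Longrightarrow> continuous_on A (\<lambda>x. f (g x))"
  using continuous_on_compose2[OF f_cont] by blast

lemma U_cont_on [continuous_intros]:
  "continuous_on A g \<Longrightarrow> continuous_on A (\<lambda>x. U (g x))"
  using continuous_on_compose2[OF U_cont] by blast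

lemma F_cont_on [continuous_intros]:
  "continuous_on A g \<Longrightarrow> continuous_on A (\<lambda>x. F (g x))"
  using continuous_on_compose2[OF F_cont] by blast

lemma folded_cont_on [continuous_intros]:
  "continuous_on A g \<Longrightarrow> continuous_on A h \<Longrightarrow> continuous_on A (\<lambda>x. folded (g x) (h x))"
  unfolding folded_def by (intro continuous_intros)

lemma integral_f: "a \<le> b \<Longrightarrow> integral {a..b} f = F a - F b"
proof (rule integral_unique)
  assume "a \<le> b"
  have "((\<lambda>x. - (- f x)) has_integral - (F b - F a)) {a..b}"
    by (intro has_integral_neg fundamental_theorem_of_calculus \<open>a \<le> b\<close>)
       (auto intro!: has_field_derivative_at_within F_deriv
         simp flip: has_real_derivative_iff_has_vector_derivative)
  then show "(f has_integral F a - F b) {a..b}" by simp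
qed

lemma along_periods:
  assumes "(g \<longlongrightarrow> (0::real)) at_top"
  shows "(\<lambda>N. g (t + 2 * \<Delta> * real N)) \<longlonglongrightarrow> 0"
proof -
  have "filterlim (\<lambda>N. t + 2 * \<Delta> * real N) at_top sequentially"
    using cell_pos by real_asymp
  then show ?thesis by (rule filterlim_compose[OF assms])
qed

text \<open>
  By the functional equation, \<open>U\<close> decreases along the progression \<open>x + 2 \<Delta> N\<close>, and its limit is 0.
\<close>

lemma U_nonneg: assumes "0 \<le> x" shows "0 \<le> U x"
proof -
  have "U (x + 2 * \<Delta> * real N) \<le> U x" for N
  proof (induction N)
    case (Suc N)
    have "0 \<le> f (x + 2 * \<Delta> * real N)" using assms cell_pos by (intro f_nonneg) simp
    then have "U (x + 2 * \<Delta> * real (Suc N)) \<le> U (x + 2 * \<Delta> * real N)"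
      using U_period[of "x + 2 * \<Delta> * real N"] by (simp add: algebra_simps)
    with Suc show ?case by simp
  qed simp
  then show ?thesis
    using along_periods[OF U_lim, of x] by (intro LIMSEQ_le_const2) auto
qed

lemma F_antimono: "0 \<le> x \<Longrightarrow> x \<le> y \<Longrightarrow> F y \<le> F x"
proof -
  assume "0 \<le> x" "x \<le> y"
  then have "0 \<le> integral {x..y} f" by (intro integral_nonneg integrable_continuous_real continuous_intros) (auto intro: f_nonneg)
  then show ?thesis using integral_f[OF \<open>x \<le> y\<close>] by simp
qed

lemma F_nonneg: assumes "0 \<le> x" shows "0 \<le> F x"
proof -
  have "F (x + 2 * \<Delta> * real N) \<le> F x" for N using assms cell_pos by (intro F_antimono) auto
  then show ?thesis
    using along_periods[OF F_lim, of x] by (intro LIMSEQ_le_const2) auto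
qed

lemma F_le_1: "0 \<le> x \<Longrightarrow> F x \<le> 1"
  using F_antimono[of 0 x] F_0 by simp

lemma U_window_tends:
  "((\<lambda>s. integral {s..s + 2 * \<Delta>} U) \<longlongrightarrow> 0) at_top"
proof (rule tendstoI)
  fix e :: real assume "0 < e"
  then have "\<forall>\<^sub>F s in at_top. \<bar>U s\<bar> < e / (4 * \<Delta>)"
    using tendstoD[OF U_lim, of "e / (4 * \<Delta>)"] cell_pos by (simp add: dist_real_def)
  then obtain s0 where s0: "\<And>s. s \<ge> s0 \<Longrightarrow> \<bar>U s\<bar> < e / (4 * \<Delta>)"
    by (auto simp: eventually_at_top_linorder)
  have "\<bar>integral {s..s + 2 * \<Delta>} U\<bar> < e" if "s \<ge> s0" for s
  proof -
    have "norm (integral {s..s + 2 * \<Delta>} U) \<le> e / (4 * \<Delta>) * (s + 2 * \<Delta> - s)"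
      using that cell_pos
      by (intro integral_bound continuous_intros) (auto intro!: less_imp_le[OF s0])
    also have "\<dots> < e" using cell_pos \<open>0 < e\<close> by simp
    finally show ?thesis by simp
  qed
  then show "\<forall>\<^sub>F s in at_top. dist (integral {s..s + 2 * \<Delta>} U) 0 < e"
    by (auto simp: eventually_at_top_linorder dist_real_def)
qed

text \<open>
  The difference of the two sides has period \<open>2 \<Delta>\<close> in \<open>t\<close>, by the functional equation, and tends to
  0 at infinity.
\<close>

lemma U_window: "integral {t..t + 2 * \<Delta>} U = F t"
proof -
  define d where "d t = integral {t..t + 2 * \<Delta>} U - F t" for t
  have step: "d t = d (t + 2 * \<Delta>)" for t
  proof -
    have "integral {t..t + 2 * \<Delta>} U = integral {t..t + 2 * \<Delta>} (\<lambda>x. f x + U (x + 2 * \<Delta>))"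
      by (rule integral_cong) (rule U_period)
    also have "\<dots> = integral {t..t + 2 * \<Delta>} f + integral {t..t + 2 * \<Delta>} (\<lambda>x. U (x + 2 * \<Delta>))"
      by (intro Henstock_Kurzweil_Integration.integral_add integrable_continuous_real continuous_intros)
    also have "integral {t..t + 2 * \<Delta>} (\<lambda>x. U (x + 2 * \<Delta>))
        = integral {t + 2 * \<Delta>..t + 2 * \<Delta> + 2 * \<Delta>} U"
      using integral_shift_real_ivl[of "t + 2 * \<Delta>" "2 * \<Delta>" "t + 2 * \<Delta> + 2 * \<Delta>" U] by (simp add: add.commute)
    finally show ?thesis using cell_pos by (simp add: d_def integral_f)
  qed
  have "d t = d (t + 2 * \<Delta> * real N)" for N
  proof (induction N)
    case (Suc N) then show ?case using step[of "t + 2 * \<Delta> * real N"] by (simp add: algebra_simps)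
  qed simp
  moreover have "(\<lambda>N. d (t + 2 * \<Delta> * real N)) \<longlonglongrightarrow> 0"
    unfolding d_def using tendsto_diff[OF along_periods[OF U_window_tends, of t] along_periods[OF F_lim, of t]]
    by simp
  ultimately have "d t = 0" using LIMSEQ_const_iff by auto
  then show ?thesis by (simp add: d_def)
qed

lemma folded_nonneg: "0 \<le> t \<Longrightarrow> z \<in> {0..\<Delta>} \<Longrightarrow> 0 \<le> folded t z"
  unfolding folded_def using cell_pos by (intro add_nonneg_nonneg U_nonneg) auto

text \<open>
  Unfolds one reflection: the outward and the return passage through a cell form one window of
  length \<open>2 \<Delta>\<close>.
\<close>

lemma integral_pair_window:
  fixes g :: "real \<Rightarrow> real"
  assumes "continuous_on UNIV g"
  shows "integral {0..\<Delta>} (\<lambda>z. g (z + t) + g (2 * \<Delta> - z + t)) = integral {t..t + 2 * \<Delta>} g"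
proof -
  have c: "continuous_on A (\<lambda>z. g (h z))" if "continuous_on A h" for A h
    using continuous_on_compose2[OF assms that] by auto
  have "integral {0..\<Delta>} (\<lambda>z. g (z + t) + g (2 * \<Delta> - z + t))
      = integral {0..\<Delta>} (\<lambda>z. g (z + t)) + integral {0..\<Delta>} (\<lambda>z. g (2 * \<Delta> + t - z))"
  proof -
    have "(\<lambda>z. g (z + t)) integrable_on {0..\<Delta>}" "(\<lambda>z. g (2 * \<Delta> + t - z)) integrable_on {0..\<Delta>}"
      by (intro integrable_continuous_real c continuous_intros)+
    from Henstock_Kurzweil_Integration.integral_add[OF this] show ?thesis by (simp add: algebra_simps)
  qed
  also have "\<dots> = integral {t..t + \<Delta>} g + integral {t + \<Delta>..t + 2 * \<Delta>} g"
    using integral_shift_window[of \<Delta> g t] integral_reflect_window[of \<Delta> g "2 * \<Delta> + t"]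
    by (simp add: algebra_simps)
  also have "\<dots> = integral {t..t + 2 * \<Delta>} g"
    using cell_pos by (intro Henstock_Kurzweil_Integration.integral_combine integrable_continuous_real continuous_on_subset[OF assms]) auto
  finally show ?thesis .
qed

lemma folded_mass: "integral {0..\<Delta>} (folded t) = F t"
  using integral_pair_window[OF U_cont, of t] U_window unfolding folded_def by simp

text \<open>
  Instead of the Cauchy-Schwarz inequality it suffices to integrate
  \<open>\<bar>y\<bar> \<le> (\<epsilon> + y\<^sup>2 / \<epsilon>) / 2\<close>; this gives \<open>(\<epsilon> + \<epsilon>\<^sup>2) / 2\<close>.
\<close>

lemma abs_moment:
  assumes "0 \<le> t" "t \<le> T"
  shows "integral {t..T} (\<lambda>z. f z * \<bar>z - \<Delta>\<bar>) \<le> \<epsilon>"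
proof -
  have pt: "\<bar>y\<bar> \<le> (\<epsilon> + y\<^sup>2 / \<epsilon>) / 2" for y
  proof -
    have "0 \<le> (\<bar>y\<bar> - \<epsilon>)\<^sup>2" by simp
    then have "2 * \<bar>y\<bar> * \<epsilon> \<le> \<epsilon>\<^sup>2 + y\<^sup>2" by (simp add: power2_diff algebra_simps)
    then show ?thesis using eps_pos by (simp add: field_simps power2_eq_square)
  qed
  have "integral {t..T} (\<lambda>z. f z * \<bar>z - \<Delta>\<bar>) \<le> integral {0..T} (\<lambda>z. f z * \<bar>z - \<Delta>\<bar>)"
    using assms f_nonneg
    by (intro integral_subset_le integrable_continuous_real continuous_intros) (auto intro!: mult_nonneg_nonneg)
  also have "\<dots> \<le> integral {0..T} (\<lambda>z. (\<epsilon> / 2) * f z + (1 / (2 * \<epsilon>)) * (f z * (z - \<Delta>)\<^sup>2))"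
  proof (intro integral_le integrable_continuous_real continuous_intros)
    fix z assume "z \<in> {0..T}"
    then have "f z * \<bar>z - \<Delta>\<bar> \<le> f z * ((\<epsilon> + (z - \<Delta>)\<^sup>2 / \<epsilon>) / 2)"
      by (intro mult_left_mono pt f_nonneg) auto
    then show "f z * \<bar>z - \<Delta>\<bar> \<le> (\<epsilon> / 2) * f z + (1 / (2 * \<epsilon>)) * (f z * (z - \<Delta>)\<^sup>2)"
      using eps_pos by (simp add: field_simps)
  qed
  also have "\<dots> = (\<epsilon> / 2) * integral {0..T} f
      + (1 / (2 * \<epsilon>)) * integral {0..T} (\<lambda>z. f z * (z - \<Delta>)\<^sup>2)"
    using eps_pos by (subst Henstock_Kurzweil_Integration.integral_add)
       (auto intro!: integrable_continuous_real continuous_intros)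
  also have "\<dots> \<le> (\<epsilon> / 2) * 1 + (1 / (2 * \<epsilon>)) * \<epsilon> ^ 3"
    using assms eps_pos F_nonneg[of T] F_0
    by (intro add_mono mult_left_mono second_moment) (auto simp: integral_f)
  also have "\<dots> = \<epsilon> * (1 + \<epsilon>) / 2" using eps_pos by (simp add: field_simps power3_eq_cube)
  also have "\<dots> \<le> \<epsilon>" using eps_pos eps_le mult_left_mono[of \<epsilon> 1 \<epsilon>] by (simp add: algebra_simps)
  finally show ?thesis .
qed

text \<open>
  Folding is a contraction that fixes \<open>\<Delta> - t\<close>, so it cannot increase the mean distance from that
  point. The periods are unfolded one by one, and the part of \<open>U\<close> that is still folded after \<open>N\<close>
  periods has mass \<open>F (t + 2 \<Delta> N)\<close>, which vanishes in the limit.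
\<close>

lemma folded_abs_moment:
  assumes t: "0 \<le> t" "t \<le> \<Delta>"
  shows "integral {0..\<Delta>} (\<lambda>z. folded t z * \<bar>z - (\<Delta> - t)\<bar>) \<le> \<epsilon>"
proof -
  let ?J = "\<lambda>s. integral {0..\<Delta>} (\<lambda>z. folded s z * \<bar>z - (\<Delta> - t)\<bar>)"
  let ?m = "\<lambda>z. f z * \<bar>z - \<Delta>\<bar>"
  have step: "?J s \<le> integral {s..s + 2 * \<Delta>} ?m + ?J (s + 2 * \<Delta>)" if s: "s = t + 2 * \<Delta> * real N" for s N
  proof -
    have "s \<ge> t" and s_cases: "s = t \<or> s \<ge> t + 2 * \<Delta>"
      using cell_pos s by (cases N; simp add: algebra_simps)+
    have near: "\<bar>z - (\<Delta> - t)\<bar> \<le> \<bar>z + s - \<Delta>\<bar>"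
        and far: "\<bar>z - (\<Delta> - t)\<bar> \<le> \<bar>2 * \<Delta> - z + s - \<Delta>\<bar>" if "z \<in> {0..\<Delta>}" for z
      using that t s_cases cell_pos by auto
    have "?J s \<le> integral {0..\<Delta>} (\<lambda>z. (?m (z + s) + ?m (2 * \<Delta> - z + s))
        + folded (s + 2 * \<Delta>) z * \<bar>z - (\<Delta> - t)\<bar>)"
    proof (intro integral_le integrable_continuous_real continuous_intros)
      fix z assume z: "z \<in> {0..\<Delta>}"
      have "folded s z = f (z + s) + f (2 * \<Delta> - z + s) + folded (s + 2 * \<Delta>) z"
        unfolding folded_def using U_period[of "z + s"] U_period[of "2 * \<Delta> - z + s"]
        by (simp add: algebra_simps)
      moreover have "f (z + s) * \<bar>z - (\<Delta> - t)\<bar> \<le> f (z + s) * \<bar>z + s - \<Delta>\<bar>"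
        using z t \<open>s \<ge> t\<close> by (intro mult_left_mono near f_nonneg) auto
      moreover have "f (2 * \<Delta> - z + s) * \<bar>z - (\<Delta> - t)\<bar> \<le> f (2 * \<Delta> - z + s) * \<bar>2 * \<Delta> - z + s - \<Delta>\<bar>"
        using z t \<open>s \<ge> t\<close> by (intro mult_left_mono far f_nonneg) auto
      ultimately show "folded s z * \<bar>z - (\<Delta> - t)\<bar> \<le> (?m (z + s) + ?m (2 * \<Delta> - z + s))
        + folded (s + 2 * \<Delta>) z * \<bar>z - (\<Delta> - t)\<bar>" by (simp add: distrib_right)
    qed
    also have "\<dots> = integral {0..\<Delta>} (\<lambda>z. ?m (z + s) + ?m (2 * \<Delta> - z + s)) + ?J (s + 2 * \<Delta>)"
      by (intro Henstock_Kurzweil_Integration.integral_add integrable_continuous_real continuous_intros)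
    also have "integral {0..\<Delta>} (\<lambda>z. ?m (z + s) + ?m (2 * \<Delta> - z + s)) = integral {s..s + 2 * \<Delta>} ?m"
      by (intro integral_pair_window continuous_intros)
    finally show ?thesis .
  qed
  have "?J t \<le> integral {t..t + 2 * \<Delta> * real N} ?m + ?J (t + 2 * \<Delta> * real N)" for N
  proof (induction N)
    case (Suc N)
    let ?s = "t + 2 * \<Delta> * real N"
    have s': "?s + 2 * \<Delta> = t + 2 * \<Delta> * real (Suc N)" by (simp add: algebra_simps)
    have "integral {t..?s} ?m + integral {?s..?s + 2 * \<Delta>} ?m = integral {t..?s + 2 * \<Delta>} ?m"
      using cell_pos by (intro Henstock_Kurzweil_Integration.integral_combine integrable_continuous_real continuous_intros) auto
    with step[of ?s N] Suc show ?case unfolding s' by simp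
  qed simp
  moreover have "?J s \<le> \<Delta> * F s" if "s \<ge> 0" for s
  proof -
    have "?J s \<le> integral {0..\<Delta>} (\<lambda>z. folded s z * \<Delta>)"
      using t that cell_pos
      by (intro integral_le integrable_continuous_real continuous_intros mult_left_mono folded_nonneg) auto
    then show ?thesis by (simp add: folded_mass mult.commute)
  qed
  ultimately have "?J t \<le> \<epsilon> + \<Delta> * F (t + 2 * \<Delta> * real N)" for N
  proof -
    assume tel: "\<And>N. ?J t \<le> integral {t..t + 2 * \<Delta> * real N} ?m + ?J (t + 2 * \<Delta> * real N)"
      and rest: "\<And>s. s \<ge> 0 \<Longrightarrow> ?J s \<le> \<Delta> * F s"
    have "0 \<le> 2 * \<Delta> * real N" using cell_pos by simp
    then show ?thesis
      using tel[of N] rest[of "t + 2 * \<Delta> * real N"] abs_moment[of t "t + 2 * \<Delta> * real N"] t by linarith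
  qed
  moreover have "(\<lambda>N. \<epsilon> + \<Delta> * F (t + 2 * \<Delta> * real N)) \<longlonglongrightarrow> \<epsilon> + \<Delta> * 0"
    by (intro tendsto_intros along_periods F_lim)
  ultimately show ?thesis using LIMSEQ_le_const[of _ "\<epsilon> + \<Delta> * 0" "?J t"] by auto
qed

lemma folded_average:
  assumes t: "0 \<le> t" "t \<le> \<Delta>" and "0 \<le> L"
    and L: "\<And>x y. x \<in> {0..\<Delta>} \<Longrightarrow> y \<in> {0..\<Delta>} \<Longrightarrow> \<bar>\<phi> x - \<phi> y\<bar> \<le> L * \<bar>x - y\<bar>"
  shows "\<bar>integral {0..\<Delta>} (\<lambda>z. folded t z * \<phi> z) - F t * \<phi> (\<Delta> - t)\<bar> \<le> L * \<epsilon>"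
proof -
  note [continuous_intros] = lipschitz_cont[OF L]
  have eq: "integral {0..\<Delta>} (\<lambda>z. folded t z * \<phi> z) - F t * \<phi> (\<Delta> - t)
      = integral {0..\<Delta>} (\<lambda>z. folded t z * \<phi> z - folded t z * \<phi> (\<Delta> - t))"
    by (subst Henstock_Kurzweil_Integration.integral_diff)
       (auto intro!: integrable_continuous_real continuous_intros simp: folded_mass)
  have "\<bar>integral {0..\<Delta>} (\<lambda>z. folded t z * \<phi> z) - F t * \<phi> (\<Delta> - t)\<bar>
      \<le> integral {0..\<Delta>} (\<lambda>z. L * (folded t z * \<bar>z - (\<Delta> - t)\<bar>))"
    unfolding eq
  proof (intro abs_integral_le_integral continuous_intros)
    fix z assume z: "z \<in> {0..\<Delta>}"
    have "\<bar>folded t z * (\<phi> z - \<phi> (\<Delta> - t))\<bar> \<le> folded t z * (L * \<bar>z - (\<Delta> - t)\<bar>)"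
      unfolding abs_mult using z t folded_nonneg[OF t(1) z] by (simp add: mult_left_mono L)
    then show "\<bar>folded t z * \<phi> z - folded t z * \<phi> (\<Delta> - t)\<bar> \<le> L * (folded t z * \<bar>z - (\<Delta> - t)\<bar>)"
      by (simp add: algebra_simps)
  qed
  also have "\<dots> \<le> L * \<epsilon>"
    using folded_abs_moment[OF t] \<open>0 \<le> L\<close> by (simp add: mult_left_mono)
  finally show ?thesis .
qed

text \<open>
  The reflected half of \<open>folded t\<close> belongs to residual lifetimes beyond \<open>\<Delta>\<close>.
\<close>

lemma reflected_mass:
  assumes "0 \<le> t" shows "integral {0..\<Delta>} (\<lambda>z. U (2 * \<Delta> - z + t)) \<le> \<kappa>"
proof -
  have "integral {0..\<Delta>} (\<lambda>z. U (2 * \<Delta> - z + t)) = integral {t + \<Delta>..t + 2 * \<Delta>} U"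
    using integral_reflect_window[of \<Delta> U "2 * \<Delta> + t"] by (simp add: algebra_simps)
  also have "\<dots> \<le> integral {t + \<Delta>..t + \<Delta> + 2 * \<Delta>} U"
    using assms cell_pos
    by (intro integral_subset_le integrable_continuous_real continuous_intros) (auto intro!: U_nonneg)
  also have "\<dots> \<le> \<kappa>"
    using F_antimono[of \<Delta> "t + \<Delta>"] F_cell assms cell_pos unfolding U_window by simp
  finally show ?thesis .
qed

text \<open>
  The weights of \<open>folded_average\<close>, but with the sign of the reflected half reversed; the price is
  twice the mass of that half.
\<close>

lemma folded_signed_average:
  assumes t: "0 \<le> t" "t \<le> \<Delta>" and "0 \<le> L"
    and L: "\<And>x y. x \<in> {0..\<Delta>} \<Longrightarrow> y \<in> {0..\<Delta>} \<Longrightarrow> \<bar>\<phi> x - \<phi> y\<bar> \<le> L * \<bar>x - y\<bar>"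
    and G: "\<And>x. x \<in> {0..\<Delta>} \<Longrightarrow> \<bar>\<phi> x\<bar> \<le> G"
  shows "\<bar>integral {0..\<Delta>} (\<lambda>z. (U (z + t) - U (2 * \<Delta> - z + t)) * \<phi> z) - F t * \<phi> (\<Delta> - t)\<bar>
    \<le> L * \<epsilon> + 2 * G * \<kappa>"
proof -
  note [continuous_intros] = lipschitz_cont[OF L]
  let ?R = "\<lambda>z. U (2 * \<Delta> - z + t)"
  have "0 \<le> G" using G[of 0] cell_pos by (smt (verit) atLeastAtMost_iff)
  have "integral {0..\<Delta>} (\<lambda>z. (U (z + t) - ?R z) * \<phi> z)
      = integral {0..\<Delta>} (\<lambda>z. folded t z * \<phi> z) - integral {0..\<Delta>} (\<lambda>z. 2 * ?R z * \<phi> z)"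
    by (subst Henstock_Kurzweil_Integration.integral_diff[symmetric])
       (auto intro!: integrable_continuous_real continuous_intros simp: folded_def algebra_simps)
  moreover have "\<bar>integral {0..\<Delta>} (\<lambda>z. 2 * ?R z * \<phi> z)\<bar> \<le> integral {0..\<Delta>} (\<lambda>z. (2 * G) * ?R z)"
  proof (intro abs_integral_le_integral continuous_intros)
    fix z assume z: "z \<in> {0..\<Delta>}"
    have "0 \<le> ?R z" using t z by (intro U_nonneg) auto
    then show "\<bar>2 * ?R z * \<phi> z\<bar> \<le> (2 * G) * ?R z"
      using mult_left_mono[OF G[OF z], of "2 * ?R z"] by (simp add: abs_mult mult_ac)
  qed
  moreover have "integral {0..\<Delta>} (\<lambda>z. (2 * G) * ?R z) \<le> 2 * G * \<kappa>"
    using reflected_mass[OF t(1)] \<open>0 \<le> G\<close> by (simp add: mult_left_mono)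
  ultimately show ?thesis using folded_average[OF t \<open>0 \<le> L\<close> L] by linarith
qed

text \<open>
  Both bounds are Chebyshev's inequality at distance \<open>d\<close> below \<open>\<Delta>\<close>. With \<open>d = \<epsilon>\<close> the lost
  probability is at most \<open>\<epsilon>\<close>. With \<open>d = \<epsilon> / 2\<close> it is at most \<open>4 \<epsilon>\<close>, and monotonicity
  spreads the value \<open>f t\<close> over an interval of length \<open>\<epsilon> / 2\<close>, whence \<open>f t \<le> 8\<close>.
\<close>

lemma F_half: "0 \<le> t \<Longrightarrow> t \<le> \<Delta> - \<epsilon> \<Longrightarrow> 1 / 2 \<le> F t"
  and f_le_8: "0 \<le> t \<Longrightarrow> t \<le> \<Delta> - \<epsilon> \<Longrightarrow> f t \<le> 8"
proof -
  have cheb: "(1 - F (\<Delta> - d)) * d\<^sup>2 \<le> \<epsilon> ^ 3" if "0 < d" "d \<le> \<epsilon>" for d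
  proof -
    have "(1 - F (\<Delta> - d)) * d\<^sup>2 = integral {0..\<Delta> - d} (\<lambda>z. f z * d\<^sup>2)"
      using that eps_le by (simp add: integral_f F_0)
    also have "\<dots> \<le> integral {0..\<Delta> - d} (\<lambda>z. f z * (z - \<Delta>)\<^sup>2)"
    proof (intro integral_le integrable_continuous_real continuous_intros mult_left_mono)
      fix z assume z: "z \<in> {0..\<Delta> - d}"
      then have "d\<^sup>2 \<le> (\<Delta> - z)\<^sup>2" using that by (intro power_mono) auto
      then show "d\<^sup>2 \<le> (z - \<Delta>)\<^sup>2" by (simp add: power2_commute)
    qed (auto intro: f_nonneg)
    also have "\<dots> \<le> \<epsilon> ^ 3" using that eps_le by (intro second_moment) auto
    finally show ?thesis .
  qed
  assume t: "0 \<le> t" "t \<le> \<Delta> - \<epsilon>"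
  have "1 - F (\<Delta> - \<epsilon>) \<le> \<epsilon>"
    using cheb[of \<epsilon>] eps_pos by (simp add: power2_eq_square power3_eq_cube)
  then show "1 / 2 \<le> F t" using F_antimono[OF t] eps_le by linarith
  have "f t * (\<epsilon> / 2) = integral {t..t + \<epsilon> / 2} (\<lambda>z. f t)" using eps_pos by simp
  also have "\<dots> \<le> integral {t..t + \<epsilon> / 2} f"
    using t eps_pos by (intro integral_le integrable_continuous_real continuous_intros mono_onD[OF f_mono]) auto
  also have "\<dots> \<le> integral {0..\<Delta> - \<epsilon> / 2} f"
    using t eps_pos by (intro integral_subset_le integrable_continuous_real continuous_intros) (auto intro: f_nonneg)
  also have "\<dots> = 1 - F (\<Delta> - \<epsilon> / 2)" using t eps_pos by (simp add: integral_f F_0)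
  also have "\<dots> \<le> 4 * \<epsilon>"
  proof -
    have "(1 - F (\<Delta> - \<epsilon> / 2)) * \<epsilon>\<^sup>2 \<le> (4 * \<epsilon>) * \<epsilon>\<^sup>2"
      using cheb[of "\<epsilon> / 2"] eps_pos by (simp add: power2_eq_square power3_eq_cube)
    then show ?thesis using eps_pos by (subst (asm) mult_le_cancel_right_pos) auto
  qed
  finally show "f t \<le> 8" using eps_pos by (simp add: field_simps)
qed

lemma divide_by_F:
  assumes "0 \<le> t" "t \<le> \<Delta> - \<epsilon>" "\<bar>x - F t * y\<bar> \<le> e"
  shows "\<bar>x / F t - y\<bar> \<le> 2 * e"
proof -
  have F: "1 / 2 \<le> F t" by (rule F_half[OF assms(1,2)])
  have "0 \<le> e" using assms(3) by linarith
  have "\<bar>x / F t - y\<bar> = \<bar>(x - F t * y) / F t\<bar>" using F by (simp add: diff_divide_distrib)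
  also have "\<dots> \<le> e / F t" using assms(3) F by (simp add: abs_divide divide_right_mono)
  also have "\<dots> \<le> e / (1 / 2)" using F \<open>0 \<le> e\<close> by (intro divide_left_mono) auto
  finally show ?thesis by simp
qed

text \<open>
  The expectation of \<open>\<phi>\<close> at the folded residual lifetime, given survival up to \<open>t\<close>.
\<close>

definition folded_mean :: "(real \<Rightarrow> real) \<Rightarrow> real \<Rightarrow> real" where
  "folded_mean \<phi> t = integral {0..\<Delta>} (\<lambda>z. folded t z * \<phi> z) / F t"

lemma folded_mean_close:
  assumes t: "0 \<le> t" "t \<le> \<Delta> - \<epsilon>" and "0 \<le> L"
    and L: "\<And>x y. x \<in> {0..\<Delta>} \<Longrightarrow> y \<in> {0..\<Delta>} \<Longrightarrow> \<bar>\<phi> x - \<phi> y\<bar> \<le> L * \<bar>x - y\<bar>"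
  shows "\<bar>folded_mean \<phi> t - \<phi> (\<Delta> - t)\<bar> \<le> 2 * L * \<epsilon>"
  unfolding folded_mean_def mult.assoc
  using t eps_pos by (intro divide_by_F folded_average L \<open>0 \<le> L\<close>) auto

lemma folded_mean_cont:
  assumes "continuous_on {0..\<Delta>} \<phi>"
  shows "continuous_on {0..\<Delta> - \<epsilon>} (folded_mean \<phi>)"
proof -
  have "continuous_on ({0..\<Delta> - \<epsilon>} \<times> cbox 0 \<Delta>) (\<lambda>(t, z). folded t z * \<phi> z)"
    unfolding split_beta
    by (intro continuous_intros continuous_on_compose2[OF assms]) auto
  then have "continuous_on {0..\<Delta> - \<epsilon>} (\<lambda>t. integral (cbox 0 \<Delta>) (\<lambda>z. folded t z * \<phi> z))"
    by (rule integral_continuous_on_param)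
  moreover have "F t \<noteq> 0" if "t \<in> {0..\<Delta> - \<epsilon>}" for t using F_half[of t] that by auto
  ultimately show ?thesis
    unfolding folded_mean_def by (auto intro!: continuous_intros)
qed

text \<open>
  A process of age \<open>t\<close> still lives for a time \<open>y\<close> close to \<open>\<Delta> - t\<close>; taking this \<open>y\<close> as the new
  age (cut off at \<open>\<Delta> - \<epsilon>\<close>), the residual lifetime comes back to about \<open>\<Delta> - y\<close>, that is, \<open>t\<close>. The
  cut-off costs \<open>\<epsilon>\<close> for \<open>t = 0\<close>; for \<open>t \<ge> \<epsilon>\<close> it is reached with probability of order
  \<open>\<kappa>\<close> only.
\<close>

lemma jump_average:
  assumes t: "0 \<le> t" "t \<le> \<Delta> - \<epsilon>" "t = 0 \<or> \<epsilon> \<le> t" and "0 \<le> L"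
    and L: "\<And>x y. x \<in> {0..\<Delta>} \<Longrightarrow> y \<in> {0..\<Delta>} \<Longrightarrow> \<bar>\<phi> x - \<phi> y\<bar> \<le> L * \<bar>x - y\<bar>"
  shows "\<bar>(integral {0..\<Delta> - \<epsilon>} (\<lambda>y. f (t + y) * folded_mean \<phi> y)
      + F (t + (\<Delta> - \<epsilon>)) * folded_mean \<phi> (\<Delta> - \<epsilon>)) / F t - \<phi> t\<bar> \<le> L * (8 * \<epsilon> + 2 * \<Delta> * \<kappa>)"
proof -
  note lipschitz_cont[OF L, continuous_intros] 
  have fmc[continuous_intros]: "continuous_on {0..\<Delta> - \<epsilon>} (folded_mean \<phi>)"
    by (intro folded_mean_cont lipschitz_cont[OF L])
  let ?I = "integral {0..\<Delta> - \<epsilon>} (\<lambda>y. f (t + y) * folded_mean \<phi> y)"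
  let ?tail = "F (t + (\<Delta> - \<epsilon>))"
  have mass: "integral {0..\<Delta> - \<epsilon>} (\<lambda>y. f (t + y)) = F t - ?tail"
    using integral_shift_window[of "\<Delta> - \<epsilon>" f t] integral_f[of t "t + (\<Delta> - \<epsilon>)"] eps_le eps_pos
    by (simp add: add.commute)
  have fnn: "0 \<le> f (t + y)" if "y \<in> {0..\<Delta> - \<epsilon>}" for y using that t by (intro f_nonneg) auto
  have diff: "\<bar>folded_mean \<phi> y - \<phi> t\<bar> \<le> 2 * L * \<epsilon> + L * \<bar>t + y - \<Delta>\<bar>" if "y \<in> {0..\<Delta> - \<epsilon>}" for y
    using folded_mean_close[of y L \<phi>, OF _ _ \<open>0 \<le> L\<close> L] L[of "\<Delta> - y" t] that t eps_pos
    by (auto simp: abs_minus_commute algebra_simps)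
  have eq: "?I - (F t - ?tail) * \<phi> t = integral {0..\<Delta> - \<epsilon>} (\<lambda>y. f (t + y) * folded_mean \<phi> y - f (t + y) * \<phi> t)"
    by (subst Henstock_Kurzweil_Integration.integral_diff)
       (auto intro!: integrable_continuous_real continuous_intros simp: mass)
  have "\<bar>?I - (F t - ?tail) * \<phi> t\<bar> \<le> integral {0..\<Delta> - \<epsilon>} (\<lambda>y. (2 * L * \<epsilon>) * f (t + y) + L * (f (t + y) * \<bar>t + y - \<Delta>\<bar>))"
    unfolding eq
  proof (intro abs_integral_le_integral continuous_intros)
    fix y assume y: "y \<in> {0..\<Delta> - \<epsilon>}"
    have "\<bar>f (t + y) * (folded_mean \<phi> y - \<phi> t)\<bar> \<le> f (t + y) * (2 * L * \<epsilon> + L * \<bar>t + y - \<Delta>\<bar>)"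
      unfolding abs_mult using fnn[OF y] by (simp add: mult_left_mono diff[OF y])
    then show "\<bar>f (t + y) * folded_mean \<phi> y - f (t + y) * \<phi> t\<bar>
        \<le> (2 * L * \<epsilon>) * f (t + y) + L * (f (t + y) * \<bar>t + y - \<Delta>\<bar>)"
      by (simp add: algebra_simps)
  qed
  also have "\<dots> = (2 * L * \<epsilon>) * (F t - ?tail)
      + L * integral {0..\<Delta> - \<epsilon>} (\<lambda>y. f (y + t) * \<bar>y + t - \<Delta>\<bar>)"
    by (subst Henstock_Kurzweil_Integration.integral_add)
       (auto intro!: integrable_continuous_real continuous_intros simp: mass mass[unfolded add.commute[of t]] add.commute[of t])
  also have "integral {0..\<Delta> - \<epsilon>} (\<lambda>y. f (y + t) * \<bar>y + t - \<Delta>\<bar>)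
      = integral {t..t + (\<Delta> - \<epsilon>)} (\<lambda>z. f z * \<bar>z - \<Delta>\<bar>)"
    by (rule integral_shift_window)
  finally have main: "\<bar>?I - (F t - ?tail) * \<phi> t\<bar> \<le> (2 * L * \<epsilon>) * (F t - ?tail) + L * \<epsilon>"
    using abs_moment[of t "t + (\<Delta> - \<epsilon>)"] t eps_le \<open>0 \<le> L\<close>
    by (smt (verit) mult_left_mono)
  have tail0: "0 \<le> ?tail" "?tail \<le> 1" using t eps_le by (auto intro!: F_nonneg F_le_1)
  have tail_small: "?tail * \<bar>\<epsilon> - t\<bar> \<le> \<epsilon> + \<Delta> * \<kappa>"
  proof (cases "t = 0")
    case True
    then show ?thesis using tail0 eps_pos F_cell F_nonneg[of \<Delta>] cell_pos
      by (simp add: mult_left_le_one_le add_increasing2)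
  next
    case False
    then have "?tail \<le> \<kappa>" using t F_antimono[of \<Delta> "t + (\<Delta> - \<epsilon>)"] F_cell cell_pos by auto
    moreover have "\<bar>\<epsilon> - t\<bar> \<le> \<Delta>" using t eps_pos eps_le by auto
    ultimately have "?tail * \<bar>\<epsilon> - t\<bar> \<le> \<kappa> * \<Delta>" using tail0 by (intro mult_mono) auto
    then show ?thesis using eps_pos by (simp add: mult.commute)
  qed
  have "\<bar>?tail * (folded_mean \<phi> (\<Delta> - \<epsilon>) - \<phi> t)\<bar> \<le> ?tail * (2 * L * \<epsilon> + L * \<bar>\<epsilon> - t\<bar>)"
    unfolding abs_mult using tail0 diff[of "\<Delta> - \<epsilon>"] eps_le eps_pos
    by (auto intro!: mult_left_mono simp: abs_minus_commute)
  also have "\<dots> = 2 * L * \<epsilon> * ?tail + L * (?tail * \<bar>\<epsilon> - t\<bar>)" by (simp add: algebra_simps)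
  also have "\<dots> \<le> 2 * L * \<epsilon> * ?tail + L * (\<epsilon> + \<Delta> * \<kappa>)"
    using \<open>0 \<le> L\<close> tail_small by (intro add_left_mono mult_left_mono)
  finally have tail: "\<bar>?tail * (folded_mean \<phi> (\<Delta> - \<epsilon>) - \<phi> t)\<bar> \<le> 2 * L * \<epsilon> * ?tail + L * (\<epsilon> + \<Delta> * \<kappa>)" .
  let ?X = "?I + ?tail * folded_mean \<phi> (\<Delta> - \<epsilon>)"
  have "?X - F t * \<phi> t = (?I - (F t - ?tail) * \<phi> t) + ?tail * (folded_mean \<phi> (\<Delta> - \<epsilon>) - \<phi> t)"
    by (simp add: algebra_simps)
  then have "\<bar>?X - F t * \<phi> t\<bar> \<le> (2 * L * \<epsilon>) * (F t - ?tail) + L * \<epsilon> + (2 * L * \<epsilon> * ?tail + L * (\<epsilon> + \<Delta> * \<kappa>))"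
    using main tail by linarith
  also have "\<dots> = 2 * L * \<epsilon> * F t + L * (2 * \<epsilon> + \<Delta> * \<kappa>)" by (simp add: algebra_simps)
  also have "\<dots> \<le> 2 * L * \<epsilon> * 1 + L * (2 * \<epsilon> + \<Delta> * \<kappa>)"
    using F_le_1[OF t(1)] \<open>0 \<le> L\<close> eps_pos by (intro add_right_mono mult_left_mono) auto
  finally show ?thesis using divide_by_F[OF t(1,2)] by (fastforce simp: algebra_simps)
qed

text \<open>
  The function \<open>U (z + t) - U (2 \<Delta> - z + t)\<close> is a primitive of the derivative of \<open>folded t\<close> taken
  with equal signs. It vanishes at \<open>z = \<Delta>\<close> and equals \<open>f t\<close> at \<open>z = 0\<close>.
\<close>

lemma derivative_by_parts:
  assumes U': "\<And>x. (U has_real_derivative U' x) (at x)" and "continuous_on UNIV U'"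
    and \<phi>': "\<And>x. x \<in> {0..\<Delta>} \<Longrightarrow> (\<phi> has_real_derivative \<phi>' x) (at x within {0..\<Delta>})"
    and "continuous_on {0..\<Delta>} \<phi>'"
  shows "integral {0..\<Delta>} (\<lambda>z. (U' (z + t) + U' (2 * \<Delta> - z + t)) * \<phi> z)
    = - f t * \<phi> 0 - integral {0..\<Delta>} (\<lambda>z. (U (z + t) - U (2 * \<Delta> - z + t)) * \<phi>' z)"
proof -
  let ?w = "\<lambda>z. U (z + t) - U (2 * \<Delta> - z + t)"
  let ?w' = "\<lambda>z. U' (z + t) + U' (2 * \<Delta> - z + t)"
  have [continuous_intros]: "continuous_on A (\<lambda>z. U' (h z))" if "continuous_on A h" for A and h :: "real \<Rightarrow> real"
    using continuous_on_compose2[OF assms(2) that] by auto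
  have [continuous_intros]: "continuous_on {0..\<Delta>} \<phi>"
    using \<phi>' by (rule DERIV_continuous_on)
  note [continuous_intros] = assms(4)
  have "(?w has_real_derivative ?w' z) (at z within {0..\<Delta>})" for z
  proof -
    have "((\<lambda>z. U (z + t)) has_real_derivative U' (z + t) * 1) (at z within {0..\<Delta>})"
      by (rule DERIV_chain2[OF U']) (auto intro!: derivative_eq_intros)
    moreover have "((\<lambda>z. U (2 * \<Delta> - z + t)) has_real_derivative U' (2 * \<Delta> - z + t) * (-1)) (at z within {0..\<Delta>})"
      by (rule DERIV_chain2[OF U']) (auto intro!: derivative_eq_intros)
    ultimately show ?thesis using DERIV_diff by fastforce
  qed
  note w' = this
  have "((\<lambda>z. ?w z * \<phi> z) has_real_derivative ?w' z * \<phi> z + ?w z * \<phi>' z) (at z within {0..\<Delta>})"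
    if "z \<in> {0..\<Delta>}" for z
    by (rule DERIV_cong[OF DERIV_mult[OF w' \<phi>'[OF that]]]) simp
  then have "((\<lambda>z. ?w' z * \<phi> z + ?w z * \<phi>' z) has_integral ?w \<Delta> * \<phi> \<Delta> - ?w 0 * \<phi> 0) {0..\<Delta>}"
    using cell_pos by (intro fundamental_theorem_of_calculus)
      (auto simp flip: has_real_derivative_iff_has_vector_derivative)
  then have "integral {0..\<Delta>} (\<lambda>z. ?w' z * \<phi> z + ?w z * \<phi>' z) = - (?w 0 * \<phi> 0)"
    by (simp add: integral_unique algebra_simps)
  moreover have "?w 0 = f t" using U_period[of t] by (simp add: add.commute)
  moreover have "integral {0..\<Delta>} (\<lambda>z. ?w' z * \<phi> z + ?w z * \<phi>' z)
      = integral {0..\<Delta>} (\<lambda>z. ?w' z * \<phi> z) + integral {0..\<Delta>} (\<lambda>z. ?w z * \<phi>' z)"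
    by (intro Henstock_Kurzweil_Integration.integral_add integrable_continuous_real continuous_intros)
  ultimately show ?thesis by simp
qed

text \<open>
  The value \<open>w\<close> comes from the neighbouring cell and replaces the boundary value \<open>\<phi> 0\<close> of the
  integration by parts.
\<close>

lemma drift_average:
  assumes U': "\<And>x. (U has_real_derivative U' x) (at x)" "continuous_on UNIV U'"
    and \<phi>': "\<And>x. x \<in> {0..\<Delta>} \<Longrightarrow> (\<phi> has_real_derivative \<phi>' x) (at x within {0..\<Delta>})"
    and L: "\<And>x y. x \<in> {0..\<Delta>} \<Longrightarrow> y \<in> {0..\<Delta>} \<Longrightarrow> \<bar>\<phi>' x - \<phi>' y\<bar> \<le> L * \<bar>x - y\<bar>"
    and G: "\<And>x. x \<in> {0..\<Delta>} \<Longrightarrow> \<bar>\<phi>' x\<bar> \<le> G"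
    and t: "0 \<le> t" "t \<le> \<Delta> - \<epsilon>" and "0 \<le> L" and w: "\<bar>w - \<phi> 0\<bar> \<le> \<eta>"
  shows "\<bar>(integral {0..\<Delta>} (\<lambda>z. (U' (z + t) + U' (2 * \<Delta> - z + t)) * \<phi> z) + f t * w) / F t + \<phi>' (\<Delta> - t)\<bar>
    \<le> 16 * \<eta> + 2 * L * \<epsilon> + 4 * G * \<kappa>"
proof -
  let ?I = "integral {0..\<Delta>} (\<lambda>z. (U (z + t) - U (2 * \<Delta> - z + t)) * \<phi>' z)"
  let ?X = "integral {0..\<Delta>} (\<lambda>z. (U' (z + t) + U' (2 * \<Delta> - z + t)) * \<phi> z) + f t * w"
  have X: "?X + F t * \<phi>' (\<Delta> - t) = f t * (w - \<phi> 0) - (?I - F t * \<phi>' (\<Delta> - t))"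
    using derivative_by_parts[OF U' \<phi>' lipschitz_cont[OF L], of t] by (simp add: algebra_simps)
  have "0 \<le> \<eta>" using w by linarith
  have "\<bar>f t * (w - \<phi> 0)\<bar> \<le> 8 * \<eta>"
    unfolding abs_mult using f_le_8[OF t] f_nonneg[OF t(1)] w by (intro mult_mono) auto
  moreover have "\<bar>?I - F t * \<phi>' (\<Delta> - t)\<bar> \<le> L * \<epsilon> + 2 * G * \<kappa>"
    using t eps_pos by (intro folded_signed_average L G \<open>0 \<le> L\<close>) auto
  ultimately have b: "\<bar>?X + F t * \<phi>' (\<Delta> - t)\<bar> \<le> 8 * \<eta> + (L * \<epsilon> + 2 * G * \<kappa>)"
    unfolding X by linarith
  have "\<bar>?X / F t + \<phi>' (\<Delta> - t)\<bar> \<le> 2 * (8 * \<eta> + (L * \<epsilon> + 2 * G * \<kappa>))"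
    using divide_by_F[OF t, of ?X "- \<phi>' (\<Delta> - t)" "8 * \<eta> + (L * \<epsilon> + 2 * G * \<kappa>)"] b by simp
  then show ?thesis by (simp add: algebra_simps)
qed

end

section \<open>Matrix exponentials\<close>

lemma mult_mat_entry:
  assumes "A \<in> carrier_mat n m" "B \<in> carrier_mat m k" "i < n" "j < k"
  shows "(A * B) $$ (i, j) = (\<Sum>l<m. A $$ (i, l) * B $$ (l, j))"
  using assms by (auto simp: scalar_prod_def atLeast0LessThan)

lemma smult_pow_mat:
  fixes A :: "'a :: comm_ring_1 mat"
  assumes "A \<in> carrier_mat n n"
  shows "(x \<cdot>\<^sub>m A) ^\<^sub>m k = x ^ k \<cdot>\<^sub>m (A ^\<^sub>m k)"
proof (induction k)
  case 0 show ?case using assms by (auto intro!: eq_matI)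
next
  case (Suc k)
  have Ak: "A ^\<^sub>m k \<in> carrier_mat n n" using assms by simp
  have "(x \<cdot>\<^sub>m A) ^\<^sub>m Suc k = (x ^ k \<cdot>\<^sub>m A ^\<^sub>m k) * (x \<cdot>\<^sub>m A)" using Suc by simp
  also have "\<dots> = x \<cdot>\<^sub>m (x ^ k \<cdot>\<^sub>m (A ^\<^sub>m k * A))"
    using assms Ak by (simp add: mult_smult_assoc_mat[of _ n n] mult_smult_distrib[of _ n n])
  also have "\<dots> = x ^ Suc k \<cdot>\<^sub>m (A ^\<^sub>m Suc k)"
    using assms by (intro eq_matI) (auto simp: ac_simps)
  finally show ?case .
qed

lemma pow_mat_add:
  assumes "A \<in> carrier_mat n n"
  shows "A ^\<^sub>m (r + k) = A ^\<^sub>m r * A ^\<^sub>m k"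
proof (induction k)
  case (Suc k)
  then show ?case using assms by (simp add: assoc_mult_mat[of _ n n _ n _ n])
qed (use assms in simp)

lemma mat_exp_carrier [simp]: "A \<in> carrier_mat n n \<Longrightarrow> mat_exp A \<in> carrier_mat n n"
  by (auto simp: mat_exp_def)

lemma mat_exp_dim [simp]: "dim_row (mat_exp A) = dim_row A" "dim_col (mat_exp A) = dim_row A"
  by (auto simp: mat_exp_def)

text \<open>
  With \<open>C\<close> the sum of all absolute entries of \<open>A\<close>, the row sums of the powers are bounded inductively.
\<close>

lemma pow_mat_entry_bound:
  fixes A :: "real mat"
  assumes A: "A \<in> carrier_mat n n"
  obtains C where "0 \<le> C" "\<And>k i j. i < n \<Longrightarrow> j < n \<Longrightarrow> \<bar>(A ^\<^sub>m k) $$ (i, j)\<bar> \<le> C ^ k"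
proof -
  define C where "C = (\<Sum>i<n. \<Sum>j<n. \<bar>A $$ (i, j)\<bar>)"
  have row: "(\<Sum>j<n. \<bar>(A ^\<^sub>m k) $$ (i, j)\<bar>) \<le> C ^ k" if "i < n" for i k
  proof (induction k)
    case 0
    have "(\<Sum>j<n. \<bar>(A ^\<^sub>m 0) $$ (i, j)\<bar>) = (\<Sum>j<n. if i = j then 1 else 0)"
      using A that by (intro sum.cong) auto
    then show ?case using that by simp
  next
    case (Suc k)
    have "(\<Sum>j<n. \<bar>(A ^\<^sub>m Suc k) $$ (i, j)\<bar>) = (\<Sum>j<n. \<bar>\<Sum>l<n. (A ^\<^sub>m k) $$ (i, l) * A $$ (l, j)\<bar>)"
      using A that by (intro sum.cong refl) (simp add: mult_mat_entry[of _ n n _ n] del: index_mult_mat)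
    also have "\<dots> \<le> (\<Sum>j<n. \<Sum>l<n. \<bar>(A ^\<^sub>m k) $$ (i, l)\<bar> * \<bar>A $$ (l, j)\<bar>)"
      by (intro sum_mono order_trans[OF sum_abs]) (simp add: abs_mult)
    also have "\<dots> = (\<Sum>l<n. \<bar>(A ^\<^sub>m k) $$ (i, l)\<bar> * (\<Sum>j<n. \<bar>A $$ (l, j)\<bar>))"
      by (subst sum.swap) (simp add: sum_distrib_left)
    also have "\<dots> \<le> (\<Sum>l<n. \<bar>(A ^\<^sub>m k) $$ (i, l)\<bar> * C)"
      unfolding C_def
      by (intro sum_mono mult_left_mono member_le_sum[where f="\<lambda>i. \<Sum>j<n. \<bar>A $$ (i, j)\<bar>"])
         (auto intro: sum_nonneg)
    also have "\<dots> \<le> C ^ k * C"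
      unfolding sum_distrib_right[symmetric]
      by (intro mult_right_mono Suc) (auto simp: C_def intro!: sum_nonneg)
    finally show ?case by (simp add: mult.commute)
  qed
  show ?thesis
  proof (rule that[of C])
    show "\<bar>(A ^\<^sub>m k) $$ (i, j)\<bar> \<le> C ^ k" if "i < n" "j < n" for i j k
      using row[OF that(1), of k] member_le_sum[of j "{..<n}" "\<lambda>j. \<bar>(A ^\<^sub>m k) $$ (i, j)\<bar>"] that
      by auto
  qed (auto simp: C_def intro!: sum_nonneg)
qed

lemma mat_exp_summable:
  fixes A :: "real mat"
  assumes A: "A \<in> carrier_mat n n" and "i < n" "j < n"
  shows "summable (\<lambda>k. norm ((A ^\<^sub>m k) $$ (i, j) / fact k))"
proof -
  obtain C where C: "0 \<le> C" "\<bar>(A ^\<^sub>m k) $$ (i, j)\<bar> \<le> C ^ k" for k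
    using pow_mat_entry_bound[OF A] assms by metis
  show ?thesis
  proof (rule summable_comparison_test'[of "\<lambda>k. C ^ k / fact k"])
    show "summable (\<lambda>k. C ^ k / fact k)" using summable_exp[of C] by (simp add: divide_inverse mult.commute)
  qed (use C in \<open>auto intro!: divide_right_mono\<close>)
qed

lemma mat_exp_sums:
  assumes "A \<in> carrier_mat n n" "i < n" "j < n"
  shows "(\<lambda>k. (A ^\<^sub>m k) $$ (i, j) / fact k) sums (mat_exp A $$ (i, j))"
  using summable_norm_cancel[OF mat_exp_summable[OF assms]] assms
  by (simp add: mat_exp_def summable_sums)

lemma mat_exp_eqI:
  assumes "A \<in> carrier_mat n n" "B \<in> carrier_mat n n"
    and "\<And>i j. i < n \<Longrightarrow> j < n \<Longrightarrow> (\<lambda>k. (A ^\<^sub>m k) $$ (i, j) / fact k) sums (B $$ (i, j))"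
  shows "mat_exp A = B"
  using assms by (intro eq_matI) (auto simp: mat_exp_def sums_iff)

text \<open>
  Entrywise this is the Cauchy product of the two exponential series.
\<close>

lemma mat_exp_add:
  assumes A: "A \<in> carrier_mat n n"
  shows "mat_exp ((x + y) \<cdot>\<^sub>m A) = mat_exp (x \<cdot>\<^sub>m A) * mat_exp (y \<cdot>\<^sub>m A)"
proof (rule mat_exp_eqI)
  fix i j assume ij: "i < n" "j < n"
  have pw: "(((x + y) \<cdot>\<^sub>m A) ^\<^sub>m k) $$ (i, j) / fact k
      = (\<Sum>l<n. \<Sum>r\<le>k. (((x \<cdot>\<^sub>m A) ^\<^sub>m r) $$ (i, l) / fact r) * (((y \<cdot>\<^sub>m A) ^\<^sub>m (k - r)) $$ (l, j) / fact (k - r)))" for k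
  proof -
    have entry: "(\<Sum>l<n. (A ^\<^sub>m r) $$ (i, l) * (A ^\<^sub>m (k - r)) $$ (l, j)) = (A ^\<^sub>m k) $$ (i, j)" if "r \<le> k" for r
    proof -
      have "A ^\<^sub>m k = A ^\<^sub>m r * A ^\<^sub>m (k - r)"
        using pow_mat_add[OF A, of r "k - r"] that by simp
      then show ?thesis using A ij by (simp add: mult_mat_entry[of _ n n _ n] del: index_mult_mat)
    qed
    have "(\<Sum>l<n. \<Sum>r\<le>k. (((x \<cdot>\<^sub>m A) ^\<^sub>m r) $$ (i, l) / fact r) * (((y \<cdot>\<^sub>m A) ^\<^sub>m (k - r)) $$ (l, j) / fact (k - r)))
        = (\<Sum>r\<le>k. x ^ r / fact r * (y ^ (k - r) / fact (k - r)) * (\<Sum>l<n. (A ^\<^sub>m r) $$ (i, l) * (A ^\<^sub>m (k - r)) $$ (l, j)))"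
      using A ij by (subst sum.swap)
        (auto intro!: sum.cong simp: smult_pow_mat[OF A] sum_distrib_left)
    also have "\<dots> = (\<Sum>r\<le>k. x ^ r / fact r * (y ^ (k - r) / fact (k - r))) * (A ^\<^sub>m k) $$ (i, j)"
      by (simp add: entry sum_distrib_right)
    also have "(\<Sum>r\<le>k. x ^ r / fact r * (y ^ (k - r) / fact (k - r))) = (x + y) ^ k / fact k"
      unfolding binomial_ring sum_divide_distrib
      by (intro sum.cong refl) (simp add: binomial_fact field_simps)
    finally show ?thesis using A ij by (simp add: smult_pow_mat[OF A])
  qed
  have "(\<lambda>k. \<Sum>r\<le>k. (((x \<cdot>\<^sub>m A) ^\<^sub>m r) $$ (i, l) / fact r) * (((y \<cdot>\<^sub>m A) ^\<^sub>m (k - r)) $$ (l, j) / fact (k - r)))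
      sums (mat_exp (x \<cdot>\<^sub>m A) $$ (i, l) * mat_exp (y \<cdot>\<^sub>m A) $$ (l, j))" if "l < n" for l
    using Cauchy_product_sums[OF mat_exp_summable[of "x \<cdot>\<^sub>m A" n i l] mat_exp_summable[of "y \<cdot>\<^sub>m A" n l j]]
      mat_exp_sums[of "x \<cdot>\<^sub>m A" n i l] mat_exp_sums[of "y \<cdot>\<^sub>m A" n l j] A ij that
    by (simp add: sums_iff)
  then have "(\<lambda>k. (((x + y) \<cdot>\<^sub>m A) ^\<^sub>m k) $$ (i, j) / fact k)
      sums (\<Sum>l<n. mat_exp (x \<cdot>\<^sub>m A) $$ (i, l) * mat_exp (y \<cdot>\<^sub>m A) $$ (l, j))"
    unfolding pw by (intro sums_sum) auto
  then show "(\<lambda>k. (((x + y) \<cdot>\<^sub>m A) ^\<^sub>m k) $$ (i, j) / fact k)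
      sums ((mat_exp (x \<cdot>\<^sub>m A) * mat_exp (y \<cdot>\<^sub>m A)) $$ (i, j))"
    using A ij by (subst mult_mat_entry[of _ n n _ n]) auto
qed (use A in auto)

lemma mat_exp_similar:
  assumes wit: "similar_mat_wit A B P P'" and A: "A \<in> carrier_mat n n" and R: "R \<in> carrier_mat n n"
    and "\<And>i j. i < n \<Longrightarrow> j < n \<Longrightarrow> (\<lambda>k. (B ^\<^sub>m k) $$ (i, j) / fact k) sums (R $$ (i, j))"
  shows "mat_exp A = P * R * P'"
proof (rule mat_exp_eqI)
  note D = similar_mat_witD2[OF A wit]
  fix i j assume ij: "i < n" "j < n"
  have three: "(P * X * P') $$ (i, j) = (\<Sum>m<n. \<Sum>l<n. P $$ (i, l) * X $$ (l, m) * P' $$ (m, j))"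
    if "X \<in> carrier_mat n n" for X
    using D ij that
    by (subst mult_mat_entry[of _ n n _ n]) (auto simp: mult_mat_entry[of _ n n _ n] sum_distrib_right simp del: index_mult_mat)
  have "(\<lambda>k. \<Sum>m<n. \<Sum>l<n. P $$ (i, l) * ((B ^\<^sub>m k) $$ (l, m) / fact k) * P' $$ (m, j))
      sums (\<Sum>m<n. \<Sum>l<n. P $$ (i, l) * R $$ (l, m) * P' $$ (m, j))"
    by (intro sums_sum sums_mult sums_mult2 assms(4)) auto
  moreover have "(A ^\<^sub>m k) $$ (i, j) / fact k
      = (\<Sum>m<n. \<Sum>l<n. P $$ (i, l) * ((B ^\<^sub>m k) $$ (l, m) / fact k) * P' $$ (m, j))" for k
    unfolding similar_mat_wit_pow_id[OF wit] using D(5)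
    by (subst three) (auto simp: sum_divide_distrib)
  ultimately show "(\<lambda>k. (A ^\<^sub>m k) $$ (i, j) / fact k) sums ((P * R * P') $$ (i, j))"
    by (simp add: three[OF R])
qed (use A R similar_mat_witD2[OF A wit] in auto)


section \<open>Exponential polynomials\<close>

text \<open>
  The factor \<open>1 / j!\<close> makes differentiation a Jordan block in the basis of these functions.
\<close>

definition exp_mono :: "real \<Rightarrow> nat \<Rightarrow> real \<Rightarrow> real" where
  "exp_mono \<theta> j x = exp (- \<theta> * x) * x ^ j / fact j"

definition exp_poly :: "real \<Rightarrow> nat \<Rightarrow> (nat \<Rightarrow> real) \<Rightarrow> real \<Rightarrow> real" where
  "exp_poly \<theta> p a x = (\<Sum>j<p. a j * exp_mono \<theta> j x)"

definition exp_poly_deriv :: "real \<Rightarrow> nat \<Rightarrow> (nat \<Rightarrow> real) \<Rightarrow> nat \<Rightarrow> real" where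
  "exp_poly_deriv \<theta> p a j = (if Suc j < p then a (Suc j) else 0) - \<theta> * a j"

definition exp_poly_shift :: "real \<Rightarrow> nat \<Rightarrow> real \<Rightarrow> (nat \<Rightarrow> real) \<Rightarrow> nat \<Rightarrow> real" where
  "exp_poly_shift \<theta> p x a i = (\<Sum>j<p. if i \<le> j then exp_mono \<theta> (j - i) x * a j else 0)"

lemma exp_mono_add: "exp_mono \<theta> j (x + y) = (\<Sum>i\<le>j. exp_mono \<theta> (j - i) x * exp_mono \<theta> i y)"
proof -
  have "(x + y) ^ j / fact j = (\<Sum>i\<le>j. (x ^ (j - i) / fact (j - i)) * (y ^ i / fact i))"
    unfolding add.commute[of x] binomial_ring sum_divide_distrib
    by (intro sum.cong refl) (simp add: binomial_fact field_simps)
  then have "exp_mono \<theta> j (x + y)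
      = exp (- \<theta> * x) * exp (- \<theta> * y) * (\<Sum>i\<le>j. (x ^ (j - i) / fact (j - i)) * (y ^ i / fact i))"
    by (simp add: exp_mono_def distrib_left exp_add exp_diff exp_minus field_simps)
  then show ?thesis
    by (simp add: exp_mono_def sum_distrib_left mult_ac)
qed

lemma exp_poly_shift: "exp_poly \<theta> p (exp_poly_shift \<theta> p x a) y = exp_poly \<theta> p a (x + y)"
proof -
  have "exp_poly \<theta> p a (x + y) = (\<Sum>j<p. \<Sum>i<p. if i \<le> j then a j * exp_mono \<theta> (j - i) x * exp_mono \<theta> i y else 0)"
    unfolding exp_poly_def
  proof (intro sum.cong refl)
    fix j assume "j \<in> {..<p}"
    then have "{..j} = {i \<in> {..<p}. i \<le> j}" by auto
    then show "a j * exp_mono \<theta> j (x + y) = (\<Sum>i<p. if i \<le> j then a j * exp_mono \<theta> (j - i) x * exp_mono \<theta> i y else 0)"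
      by (simp add: exp_mono_add sum_distrib_left mult.assoc sum.inter_filter[symmetric])
  qed
  also have "\<dots> = exp_poly \<theta> p (exp_poly_shift \<theta> p x a) y"
    unfolding exp_poly_def exp_poly_shift_def
    by (subst sum.swap) (auto intro!: sum.cong simp: sum_distrib_right)
  finally show ?thesis ..
qed

lemma exp_mono_deriv:
  "(exp_mono \<theta> j has_real_derivative (if j = 0 then 0 else exp_mono \<theta> (j - 1) x) - \<theta> * exp_mono \<theta> j x) (at x)"
proof (cases j)
  case 0
  then show ?thesis
    unfolding exp_mono_def[abs_def] by (auto intro!: derivative_eq_intros)
next
  case (Suc i)
  have "((\<lambda>x. exp (- \<theta> * x) * x ^ Suc i / fact (Suc i)) has_real_derivative
      (- \<theta> * exp (- \<theta> * x) * x ^ Suc i + exp (- \<theta> * x) * (real (Suc i) * x ^ i)) / fact (Suc i)) (at x)"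
    by (rule derivative_eq_intros refl | simp)+
  moreover
  have "real (Suc i) * x ^ i / fact (Suc i) = x ^ i / fact i"
    unfolding fact_Suc by (subst mult_divide_mult_cancel_left) auto
  then have "(- \<theta> * exp (- \<theta> * x) * x ^ Suc i + exp (- \<theta> * x) * (real (Suc i) * x ^ i)) / fact (Suc i)
      = exp (- \<theta> * x) * x ^ i / fact i - \<theta> * (exp (- \<theta> * x) * x ^ Suc i / fact (Suc i))"
    unfolding add_divide_distrib times_divide_eq_right[symmetric] by (simp only: mult.assoc minus_mult_left add.commute diff_conv_add_uminus)
  ultimately show ?thesis
    unfolding exp_mono_def[abs_def] Suc by (simp del: fact_Suc power_Suc)
qed

lemma exp_poly_deriv:
  "(exp_poly \<theta> p a has_real_derivative exp_poly \<theta> p (exp_poly_deriv \<theta> p a) x) (at x)"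
proof -
  have "(exp_poly \<theta> p a has_real_derivative
      (\<Sum>j<p. a j * ((if j = 0 then 0 else exp_mono \<theta> (j - 1) x) - \<theta> * exp_mono \<theta> j x))) (at x)"
    unfolding exp_poly_def[abs_def] by (intro DERIV_sum DERIV_cmult exp_mono_deriv)
  moreover have "(\<Sum>j<p. a j * (if j = 0 then 0 else exp_mono \<theta> (j - 1) x))
      = (\<Sum>j<p. (if Suc j < p then a (Suc j) else 0) * exp_mono \<theta> j x)"
  proof (cases p)
    case (Suc q)
    show ?thesis unfolding Suc by (subst sum.lessThan_Suc_shift) (simp add: sum.lessThan_Suc)
  qed simp
  ultimately show ?thesis
    by (simp add: exp_poly_def exp_poly_deriv_def right_diff_distrib left_diff_distrib sum_subtractf mult_ac)
qed

lemma exp_poly_cont: "continuous_on A (exp_poly \<theta> p a)"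
  by (rule DERIV_continuous_on) (rule has_field_derivative_at_within[OF exp_poly_deriv])

lemma exp_poly_lim:
  assumes "0 < \<theta>" shows "(exp_poly \<theta> p a \<longlongrightarrow> 0) at_top"
proof -
  have "(exp_mono \<theta> j \<longlongrightarrow> 0) at_top" for j
  proof -
    have "filterlim (\<lambda>x. \<theta> * x) at_top at_top"
      using assms by (intro filterlim_tendsto_pos_mult_at_top[OF tendsto_const _ filterlim_ident])
    from filterlim_compose[OF tendsto_power_div_exp_0 this, of j]
    have "((\<lambda>x. (\<theta> * x) ^ j / exp (\<theta> * x) / (\<theta> ^ j * fact j)) \<longlongrightarrow> 0 / (\<theta> ^ j * fact j)) at_top"
      using assms by (intro tendsto_intros) auto
    moreover have "(\<lambda>x. (\<theta> * x) ^ j / exp (\<theta> * x) / (\<theta> ^ j * fact j)) = exp_mono \<theta> j"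
      using assms by (auto simp: fun_eq_iff exp_mono_def power_mult_distrib exp_minus field_simps)
    ultimately show ?thesis by simp
  qed
  then have "((\<lambda>x. \<Sum>j<p. a j * exp_mono \<theta> j x) \<longlongrightarrow> (\<Sum>j<p. a j * 0)) at_top"
    by (intro tendsto_intros)
  then show ?thesis by (simp add: exp_poly_def[abs_def])
qed

lemma exp_poly_zero_iff: "exp_poly \<theta> p a x = 0 \<longleftrightarrow> (\<Sum>j<p. a j / fact j * x ^ j) = 0"
proof -
  have "exp_poly \<theta> p a x = exp (- \<theta> * x) * (\<Sum>j<p. a j / fact j * x ^ j)"
    by (simp add: exp_poly_def exp_mono_def sum_distrib_left mult_ac)
  then show ?thesis by simp
qed

text \<open>
  Apart from the factor \<open>exp (- \<theta> x)\<close> this is a polynomial of degree below \<open>p\<close>.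
\<close>

lemma exp_poly_many_zeros:
  assumes "X \<subseteq> {x. exp_poly \<theta> p a x = 0}" "infinite X \<or> p \<le> card X" "j < p"
  shows "a j = 0"
proof (rule ccontr)
  assume "a j \<noteq> 0"
  define c where "c i = a i / fact i" for i
  have p: "{..<p} = {..p - 1}" using assms(3) by auto
  have R: "{x. exp_poly \<theta> p a x = 0} = {x. (\<Sum>i\<le>p - 1. c i * x ^ i) = 0}"
    by (simp add: exp_poly_zero_iff c_def p)
  have "c j \<noteq> 0" using \<open>a j \<noteq> 0\<close> by (simp add: c_def)
  then have "finite {x. exp_poly \<theta> p a x = 0}" "card {x. exp_poly \<theta> p a x = 0} \<le> p - 1"
  proof -
    have "\<exists>k\<le>p - 1. c k \<noteq> 0" using \<open>c j \<noteq> 0\<close> assms(3) by (intro exI[of _ j]) auto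
    then show "finite {x. exp_poly \<theta> p a x = 0}" "card {x. exp_poly \<theta> p a x = 0} \<le> p - 1"
      unfolding R using polyfun_rootbound[of "p - 1" c] by auto
  qed
  with assms show False
    by (auto dest: card_mono finite_subset)
qed

section \<open>Representations in nodal coordinates\<close>

text \<open>
  The exponential of a Jordan block is a Toeplitz matrix: on the \<open>d\<close>-th superdiagonal the series
  starts at \<open>k = d\<close> and is \<open>x\<^sup>d / d!\<close> times that of \<open>exp (- \<theta> x)\<close>.
\<close>

lemma jordan_block_exp_sums:
  assumes "i < n" "j < n"
  shows "(\<lambda>k. ((x \<cdot>\<^sub>m jordan_block n (- \<theta>)) ^\<^sub>m k) $$ (i, j) / fact k)
    sums (if i \<le> j then exp_mono \<theta> (j - i) x else 0)"
proof -
  have pw: "((x \<cdot>\<^sub>m jordan_block n (- \<theta>)) ^\<^sub>m k) $$ (i, j)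
      = x ^ k * (if i \<le> j then real (k choose (j - i)) * (- \<theta>) ^ (k + i - j) else 0)" for k
  proof -
    have J: "jordan_block n (- \<theta>) \<in> carrier_mat n n" by (simp add: jordan_block_def)
    show ?thesis using assms unfolding smult_pow_mat[OF J] jordan_block_pow by simp
  qed
  show ?thesis
  proof (cases "i \<le> j")
    case True
    define d where "d = j - i"
    have "(\<lambda>r. x ^ d / fact d * ((- \<theta> * x) ^ r / fact r)) sums (x ^ d / fact d * exp (- \<theta> * x))"
      using exp_converges[of "- \<theta> * x"] by (intro sums_mult) (simp add: divide_inverse mult.commute)
    moreover have "x ^ (r + d) * (real ((r + d) choose d) * (- \<theta>) ^ r) / fact (r + d)
        = x ^ d / fact d * ((- \<theta> * x) ^ r / fact r)" for r
    proof -
      have "(- (\<theta> * x)) ^ r = x ^ r * (- \<theta>) ^ r"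
        unfolding power_mult_distrib[symmetric] by (simp add: mult.commute)
      then show ?thesis by (simp add: binomial_fact power_add field_simps)
    qed
    moreover define g where "g k = x ^ k * (real (k choose d) * (- \<theta>) ^ (k - d)) / fact k" for k
    ultimately have "(\<lambda>r. g (r + d)) sums exp_mono \<theta> d x"
      by (simp add: exp_mono_def mult_ac)
    then have "g sums exp_mono \<theta> d x"
      using sums_zero_iff_shift[of d g "exp_mono \<theta> d x"] by (simp add: g_def[abs_def])
    then show ?thesis using True by (simp add: pw d_def g_def[abs_def])
  qed (simp add: pw)
qed

text \<open>
  The coordinates of a function \<open>g\<close> in the space of exponential polynomials are
  \<open>g (t\<^sub>n) / F (t\<^sub>n)\<close>. The denominators turn the coordinates of the translate of \<open>F\<close> by \<open>x\<close> into the
  conditional survival probabilities \<open>F (t\<^sub>n + x) / F (t\<^sub>n)\<close>, and those of \<open>F\<close> itself into the vector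
  of ones.
\<close>

locale node_representation =
  fixes \<theta> :: real and p :: nat and t q :: "nat \<Rightarrow> real" and F :: "real \<Rightarrow> real"
  assumes rate_pos: "0 < \<theta>" and order_pos: "0 < p" and nodes_inj: "inj_on t {..<p}"
    and F_eq: "F = exp_poly \<theta> p q"
    and F_node_pos: "n < p \<Longrightarrow> 0 < F (t n)"
begin

declare One_nat_def [simp del]

lemma F_node_neq [simp]: "n < p \<Longrightarrow> F (t n) \<noteq> 0"
  using F_node_pos[of n] by simp

definition node_mat :: "real mat" where
  "node_mat = Matrix.mat p p (\<lambda>(n, j). exp_mono \<theta> j (t n) / F (t n))"

definition node_inv :: "real mat" where "node_inv = the (mat_inverse node_mat)"

text \<open>
  Differentiation, transported from the basis of monomials to the coordinates at the nodes.
\<close>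

definition gen_mat :: "real mat" where
  "gen_mat = node_mat * jordan_block p (- \<theta>) * node_inv"

definition coeff_col :: "(nat \<Rightarrow> real) \<Rightarrow> real mat" where
  "coeff_col a = Matrix.mat p 1 (\<lambda>(j, _). a j)"

definition value_col :: "(nat \<Rightarrow> real) \<Rightarrow> real mat" where
  "value_col a = Matrix.mat p 1 (\<lambda>(n, _). exp_poly \<theta> p a (t n) / F (t n))"

lemma node_carrier [simp]:
  "node_mat \<in> carrier_mat p p" "coeff_col a \<in> carrier_mat p 1" "value_col a \<in> carrier_mat p 1"
  "jordan_block p (- \<theta>) \<in> carrier_mat p p"
  by (auto simp: node_mat_def coeff_col_def value_col_def jordan_block_def)

lemma value_col_eq: "value_col a = node_mat * coeff_col a"
proof (rule eq_matI)
  fix i j assume "i < dim_row (node_mat * coeff_col a)" "j < dim_col (node_mat * coeff_col a)"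
  then have ij: "i < p" "j = 0" using node_carrier by (auto simp: coeff_col_def node_mat_def)
  then show "value_col a $$ (i, j) = (node_mat * coeff_col a) $$ (i, j)"
    by (subst mult_mat_entry[of _ p p _ 1])
       (auto simp: value_col_def coeff_col_def node_mat_def exp_poly_def sum_divide_distrib mult_ac)
qed (auto simp: value_col_def coeff_col_def node_mat_def)

lemma zero_at_nodes:
  assumes "\<And>n. n < p \<Longrightarrow> exp_poly \<theta> p a (t n) = 0" "j < p"
  shows "a j = 0"
  using assms card_image[OF nodes_inj]
  by (intro exp_poly_many_zeros[of "t ` {..<p}" \<theta> p a j]) auto

text \<open>
  A vector in the kernel is an exponential polynomial with \<open>p\<close> zeros.
\<close>

lemma det_node_mat: "Determinant.det node_mat \<noteq> 0"
proof
  assume "Determinant.det node_mat = 0"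
  then obtain v where v: "v \<in> carrier_vec p" "v \<noteq> 0\<^sub>v p" "node_mat *\<^sub>v v = 0\<^sub>v p"
    using det_0_iff_vec_prod_zero_field[OF node_carrier(1)] by auto
  have "vec_index v j = 0" if "j < p" for j
  proof (rule zero_at_nodes[of "vec_index v", OF _ that])
    fix n assume n: "n < p"
    then have "vec_index (node_mat *\<^sub>v v) n = 0" using v(3) by simp
    moreover have "vec_index (node_mat *\<^sub>v v) n = exp_poly \<theta> p (vec_index v) (t n) / F (t n)"
      using n v(1) by (auto simp: node_mat_def exp_poly_def scalar_prod_def atLeast0LessThan
          sum_divide_distrib mult_ac intro!: sum.cong)
    ultimately show "exp_poly \<theta> p (vec_index v) (t n) = 0" using F_node_pos[OF n] by simp
  qed
  then have "v = 0\<^sub>v p" using v(1) by (intro eq_vecI) auto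
  with v(2) show False by simp
qed

lemma mat_inverse_works:
  assumes "A \<in> carrier_mat p p" "Determinant.det A \<noteq> (0 :: real)"
  shows "the (mat_inverse A) \<in> carrier_mat p p" "A * the (mat_inverse A) = 1\<^sub>m p"
    "the (mat_inverse A) * A = 1\<^sub>m p"
proof -
  obtain B where "mat_inverse A = Some B"
    using mat_inverse(1)[OF assms(1), where b = "()"] det_non_zero_imp_unit[OF assms, where b = "()"] by blast
  with mat_inverse(2)[OF assms(1) this] show "the (mat_inverse A) \<in> carrier_mat p p"
    "A * the (mat_inverse A) = 1\<^sub>m p" "the (mat_inverse A) * A = 1\<^sub>m p" by auto
qed

lemma node_inv [simp]:
  "node_inv \<in> carrier_mat p p" "node_mat * node_inv = 1\<^sub>m p" "node_inv * node_mat = 1\<^sub>m p"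
  unfolding node_inv_def using mat_inverse_works[OF node_carrier(1) det_node_mat] by auto

lemma gen_mat_carrier [simp]: "gen_mat \<in> carrier_mat p p"
  unfolding gen_mat_def using node_carrier node_inv by (metis mult_carrier_mat)

lemma conj_value_col:
  assumes "X \<in> carrier_mat p p"
  shows "node_mat * X * node_inv * value_col a = node_mat * (X * coeff_col a)"
proof -
  have "node_mat * X * node_inv * value_col a = node_mat * X * (node_inv * (node_mat * coeff_col a))"
    unfolding value_col_eq using assms
    by (intro assoc_mult_mat[of _ p p _ p _ 1]) (auto intro!: mult_carrier_mat[OF node_carrier(1)])
  also have "node_inv * (node_mat * coeff_col a) = coeff_col a"
    by (subst assoc_mult_mat[of _ p p _ p _ 1, symmetric]) (auto simp: left_mult_one_mat[OF node_carrier(2)])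
  also have "node_mat * X * coeff_col a = node_mat * (X * coeff_col a)"
    using assms node_carrier by (intro assoc_mult_mat[of _ p p _ p _ 1]) auto
  finally show ?thesis .
qed

definition shift_mat :: "real \<Rightarrow> real mat" where
  "shift_mat x = Matrix.mat p p (\<lambda>(i, j). if i \<le> j then exp_mono \<theta> (j - i) x else 0)"

lemma mat_exp_gen_mat: "mat_exp (x \<cdot>\<^sub>m gen_mat) = node_mat * shift_mat x * node_inv"
proof (rule mat_exp_similar[where n = p and B = "x \<cdot>\<^sub>m jordan_block p (- \<theta>)"])
  show "similar_mat_wit (x \<cdot>\<^sub>m gen_mat) (x \<cdot>\<^sub>m jordan_block p (- \<theta>)) node_mat node_inv"
  proof (rule similar_mat_witI[of _ _ p])
    show "x \<cdot>\<^sub>m gen_mat = node_mat * (x \<cdot>\<^sub>m jordan_block p (- \<theta>)) * node_inv"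
      unfolding gen_mat_def mult_smult_distrib[OF node_carrier(1,4)]
        mult_smult_assoc_mat[OF mult_carrier_mat[OF node_carrier(1,4)] node_inv(1)] ..
  qed auto
  show "(\<lambda>k. ((x \<cdot>\<^sub>m jordan_block p (- \<theta>)) ^\<^sub>m k) $$ (i, j) / fact k) sums (shift_mat x $$ (i, j))"
    if "i < p" "j < p" for i j
    using jordan_block_exp_sums[OF that, of x \<theta>] that by (simp add: shift_mat_def)
qed (auto simp: shift_mat_def)

text \<open>
  Since \<open>gen_mat\<close> is differentiation, its exponential is translation.
\<close>

lemma mat_exp_value_col: "mat_exp (x \<cdot>\<^sub>m gen_mat) * value_col a = value_col (exp_poly_shift \<theta> p x a)"
proof -
  have "shift_mat x * coeff_col a = coeff_col (exp_poly_shift \<theta> p x a)"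
  proof (rule eq_matI)
    fix i j assume "i < dim_row (coeff_col (exp_poly_shift \<theta> p x a))" "j < dim_col (coeff_col (exp_poly_shift \<theta> p x a))"
    then have ij: "i < p" "j = 0" by (auto simp: coeff_col_def)
    then show "(shift_mat x * coeff_col a) $$ (i, j) = coeff_col (exp_poly_shift \<theta> p x a) $$ (i, j)"
      by (subst mult_mat_entry[of _ p p _ 1])
         (auto simp: shift_mat_def coeff_col_def exp_poly_shift_def intro!: sum.cong)
  qed (auto simp: shift_mat_def coeff_col_def)
  then show ?thesis
    unfolding mat_exp_gen_mat
    by (subst conj_value_col) (auto simp: shift_mat_def value_col_eq)
qed

lemma gen_mat_value_col: "gen_mat * value_col a = value_col (exp_poly_deriv \<theta> p a)"
proof -
  have "jordan_block p (- \<theta>) * coeff_col a = coeff_col (exp_poly_deriv \<theta> p a)"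
  proof (rule eq_matI)
    fix i j assume "i < dim_row (coeff_col (exp_poly_deriv \<theta> p a))" "j < dim_col (coeff_col (exp_poly_deriv \<theta> p a))"
    then have ij: "i < p" "j = 0" by (auto simp: coeff_col_def)
    have "(jordan_block p (- \<theta>) * coeff_col a) $$ (i, 0)
        = (\<Sum>j<p. (if i = j then - \<theta> else if Suc i = j then 1 else 0) * a j)"
      using ij by (subst mult_mat_entry[of _ p p _ 1]) (auto simp: jordan_block_def coeff_col_def intro!: sum.cong)
    also have "\<dots> = (\<Sum>j<p. (if j = i then - \<theta> * a j else 0) + (if j = Suc i then a j else 0))"
      by (intro sum.cong) auto
    also have "\<dots> = exp_poly_deriv \<theta> p a i"
      using ij by (simp add: sum.distrib exp_poly_deriv_def)
    finally show "(jordan_block p (- \<theta>) * coeff_col a) $$ (i, j) = coeff_col (exp_poly_deriv \<theta> p a) $$ (i, j)"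
      using ij by (simp add: coeff_col_def)
  qed (auto simp: coeff_col_def jordan_block_def)
  then show ?thesis
    unfolding gen_mat_def by (subst conj_value_col) (auto simp: value_col_eq)
qed

lemma mat_exp_node_sum:
  assumes "n < p"
  shows "(\<Sum>m<p. mat_exp (x \<cdot>\<^sub>m gen_mat) $$ (n, m) * (exp_poly \<theta> p a (t m) / F (t m)))
    = exp_poly \<theta> p a (x + t n) / F (t n)"
proof -
  have "(mat_exp (x \<cdot>\<^sub>m gen_mat) * value_col a) $$ (n, 0)
      = (\<Sum>m<p. mat_exp (x \<cdot>\<^sub>m gen_mat) $$ (n, m) * value_col a $$ (m, 0))"
    using assms by (intro mult_mat_entry[of _ p p _ 1]) auto
  then show ?thesis
    using assms by (simp add: mat_exp_value_col) (simp add: value_col_def exp_poly_shift)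
qed

lemma gen_mat_node_sum:
  assumes "n < p"
  shows "(\<Sum>m<p. gen_mat $$ (n, m) * (exp_poly \<theta> p a (t m) / F (t m)))
    = exp_poly \<theta> p (exp_poly_deriv \<theta> p a) (t n) / F (t n)"
proof -
  have "(gen_mat * value_col a) $$ (n, 0) = (\<Sum>m<p. gen_mat $$ (n, m) * value_col a $$ (m, 0))"
    using assms by (intro mult_mat_entry[of _ p p _ 1]) auto
  then show ?thesis
    using assms by (simp add: gen_mat_value_col) (simp add: value_col_def)
qed

lemma ones_eq: "ones p = value_col q"
  by (intro eq_matI) (auto simp: ones_def value_col_def simp flip: F_eq)

definition density_coeff :: "nat \<Rightarrow> real" where
  "density_coeff j = - exp_poly_deriv \<theta> p q j"

abbreviation density :: "real \<Rightarrow> real" where "density \<equiv> exp_poly \<theta> p density_coeff"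

lemma exp_poly_uminus: "exp_poly \<theta> p (\<lambda>j. - a j) x = - exp_poly \<theta> p a x"
  by (simp add: exp_poly_def sum_negf)

lemma exp_poly_diff: "exp_poly \<theta> p (\<lambda>j. a j - c j) x = exp_poly \<theta> p a x - exp_poly \<theta> p c x"
  by (simp add: exp_poly_def sum_subtractf left_diff_distrib)

lemma F_deriv: "(F has_real_derivative - density x) (at x)"
  using exp_poly_deriv[of \<theta> p q x] unfolding F_eq density_coeff_def[abs_def] exp_poly_uminus by simp

lemma exit_rates_eq: "exit_rates gen_mat = value_col density_coeff"
proof -
  have "exit_rates gen_mat = - value_col (exp_poly_deriv \<theta> p q)"
    using carrier_matD(1)[OF gen_mat_carrier] by (simp add: exit_rates_def ones_eq gen_mat_value_col)
  also have "\<dots> = value_col density_coeff"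
    by (intro eq_matI) (auto simp: value_col_def density_coeff_def[abs_def] exp_poly_uminus)
  finally show ?thesis .
qed

lemma survival_entry:
  "n < p \<Longrightarrow> (mat_exp (x \<cdot>\<^sub>m gen_mat) * ones p) $$ (n, 0) = F (x + t n) / F (t n)"
  by (simp add: ones_eq mat_exp_value_col) (simp add: value_col_def exp_poly_shift flip: F_eq)

lemma density_entry:
  "n < p \<Longrightarrow> (mat_exp (x \<cdot>\<^sub>m gen_mat) * exit_rates gen_mat) $$ (n, 0) = density (x + t n) / F (t n)"
  by (simp add: exit_rates_eq mat_exp_value_col) (simp add: value_col_def exp_poly_shift)

lemma exit_entry: "n < p \<Longrightarrow> exit_rates gen_mat $$ (n, 0) = density (t n) / F (t n)"
  by (simp add: exit_rates_eq) (simp add: value_col_def)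

definition period_mat :: "real \<Rightarrow> real mat" where
  "period_mat x = 1\<^sub>m p - mat_exp (x \<cdot>\<^sub>m gen_mat)"

text \<open>
  In the basis of monomials, translation by \<open>x\<close> is upper triangular with diagonal \<open>exp (- \<theta> x)\<close>.
\<close>

lemma det_period_mat:
  assumes "0 < x" shows "Determinant.det (period_mat x) \<noteq> 0"
proof -
  have Q: "shift_mat x \<in> carrier_mat p p" by (simp add: shift_mat_def)
  then have Q': "1\<^sub>m p - shift_mat x \<in> carrier_mat p p" by (rule minus_carrier_mat)
  have "period_mat x = node_mat * (1\<^sub>m p - shift_mat x) * node_inv"
  proof -
    have "node_mat * (1\<^sub>m p - shift_mat x) * node_inv
        = (node_mat * 1\<^sub>m p - node_mat * shift_mat x) * node_inv"
      using Q by (subst mult_minus_distrib_mat[of _ p p]) auto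
    also have "\<dots> = node_mat * 1\<^sub>m p * node_inv - node_mat * shift_mat x * node_inv"
      using Q by (intro minus_mult_distrib_mat[of _ p p _ _ p]) (auto intro!: mult_carrier_mat[OF node_carrier(1)])
    finally show ?thesis using node_carrier node_inv by (simp add: period_mat_def mat_exp_gen_mat)
  qed
  moreover have "Determinant.det (node_mat * (1\<^sub>m p - shift_mat x) * node_inv)
      = Determinant.det (1\<^sub>m p - shift_mat x) * (Determinant.det node_mat * Determinant.det node_inv)"
    using det_mult[OF mult_carrier_mat[OF node_carrier(1) Q'] node_inv(1)] det_mult[OF node_carrier(1) Q'] by simp
  moreover have "Determinant.det node_mat * Determinant.det node_inv = 1"
    using det_mult[OF node_carrier(1) node_inv(1)] by simp
  moreover have "Determinant.det (1\<^sub>m p - shift_mat x) \<noteq> 0"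
  proof -
    have "upper_triangular (1\<^sub>m p - shift_mat x)"
      by (auto simp: upper_triangular_def shift_mat_def)
    then have "Determinant.det (1\<^sub>m p - shift_mat x) = prod_list (diag_mat (1\<^sub>m p - shift_mat x))"
      using Q by (intro det_upper_triangular) auto
    moreover have "exp (- (\<theta> * x)) \<noteq> 1" using assms rate_pos by simp
    ultimately show ?thesis
      by (auto simp: prod_list_zero_iff diag_mat_def shift_mat_def exp_mono_def)
  qed
  ultimately show ?thesis by simp
qed

text \<open>
  The function with these coefficients is the periodisation of the density with period \<open>x\<close>; no
  infinite sum is needed.
\<close>

definition fold_coeff :: "real \<Rightarrow> nat \<Rightarrow> real" where
  "fold_coeff x j = (node_inv * (the (mat_inverse (period_mat x)) * exit_rates gen_mat)) $$ (j, 0)"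

lemma fold_col:
  assumes "0 < x"
  shows "the (mat_inverse (period_mat x)) * exit_rates gen_mat = value_col (fold_coeff x)"
proof -
  have P: "period_mat x \<in> carrier_mat p p"
    by (auto simp: period_mat_def intro!: minus_carrier_mat mat_exp_carrier)
  let ?u = "the (mat_inverse (period_mat x)) * exit_rates gen_mat"
  have e: "exit_rates gen_mat \<in> carrier_mat p 1" by (simp add: exit_rates_eq)
  have u: "?u \<in> carrier_mat p 1"
    using mat_inverse_works(1)[OF P det_period_mat[OF assms]] by (simp add: exit_rates_eq)
  have "coeff_col (fold_coeff x) = node_inv * ?u"
    using carrier_matD[OF node_inv(1)] carrier_matD[OF u] carrier_matD[OF e]
    by (intro eq_matI) (auto simp: coeff_col_def fold_coeff_def simp del: index_mult_mat(1))
  then have "value_col (fold_coeff x) = node_mat * (node_inv * ?u)" by (simp add: value_col_eq)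
  also have "\<dots> = node_mat * node_inv * ?u"
    using u node_carrier node_inv by (intro assoc_mult_mat[of _ p p _ p _ 1, symmetric]) auto
  finally show ?thesis using left_mult_one_mat[OF u] by simp
qed

text \<open>
  The identity holds at the nodes by the definition of the inverse, and both sides are exponential
  polynomials with \<open>p\<close> coefficients.
\<close>

lemma fold_period:
  assumes "0 < x"
  shows "exp_poly \<theta> p (fold_coeff x) y = density y + exp_poly \<theta> p (fold_coeff x) (y + x)"
proof -
  have P: "period_mat x \<in> carrier_mat p p"
    by (auto simp: period_mat_def intro!: minus_carrier_mat mat_exp_carrier)
  note inv = mat_inverse_works[OF P det_period_mat[OF assms]]
  let ?a = "fold_coeff x"
  let ?c = "\<lambda>j. ?a j - exp_poly_shift \<theta> p x ?a j - density_coeff j"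
  have val: "exp_poly \<theta> p ?c z = exp_poly \<theta> p ?a z - exp_poly \<theta> p ?a (x + z) - density z" for z
    by (simp add: exp_poly_diff exp_poly_shift)
  have "period_mat x * value_col ?a = value_col density_coeff"
  proof -
    have "period_mat x * value_col ?a = period_mat x * the (mat_inverse (period_mat x)) * value_col density_coeff"
      using P inv unfolding fold_col[OF assms, symmetric] exit_rates_eq
      by (intro assoc_mult_mat[of _ p p _ p _ 1, symmetric]) auto
    then show ?thesis using inv by (simp add: left_mult_one_mat[OF node_carrier(3)])
  qed
  moreover have "period_mat x * value_col ?a = value_col ?a - value_col (exp_poly_shift \<theta> p x ?a)"
    unfolding period_mat_def using node_carrier gen_mat_carrier
    by (subst minus_mult_distrib_mat[of _ p p _ _ 1])
       (auto simp: mat_exp_value_col left_mult_one_mat[OF node_carrier(3)])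
  ultimately have eq: "value_col ?a - value_col (exp_poly_shift \<theta> p x ?a) = value_col density_coeff" by simp
  have "exp_poly \<theta> p ?c (t n) = 0" if "n < p" for n
  proof -
    have "(value_col ?a - value_col (exp_poly_shift \<theta> p x ?a)) $$ (n, 0) = value_col density_coeff $$ (n, 0)"
      by (simp add: eq)
    then have "exp_poly \<theta> p ?a (t n) / F (t n) - exp_poly \<theta> p ?a (x + t n) / F (t n) = density (t n) / F (t n)"
      using that by (simp add: value_col_def exp_poly_shift)
    then show ?thesis unfolding val using F_node_pos[OF that] by (simp add: field_simps)
  qed
  then have "?c j = 0" if "j < p" for j using zero_at_nodes that by blast
  then have "exp_poly \<theta> p ?c y = 0" by (simp add: exp_poly_def)
  then show ?thesis unfolding val by (simp add: add.commute)
qed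

text \<open>
  Expanding the translates of \<open>F\<close> in the monomials, the vanishing combination becomes a triangular
  system for the moments \<open>M d\<close> of the weights, whose diagonal entry is the leading coefficient
  \<open>q (p - 1)\<close>. Hence all moments vanish, and with them the weights, since \<open>node_mat\<close> is invertible.
\<close>

lemma survival_independent:
  assumes top: "q (p - 1) \<noteq> 0"
    and zero: "\<And>x. 0 \<le> x \<Longrightarrow> (\<Sum>n<p. a n * (F (x + t n) / F (t n))) = 0" and "n < p"
  shows "a n = 0"
proof -
  define b where "b n = a n / F (t n)" for n
  define M where "M d = (\<Sum>n<p. b n * exp_mono \<theta> d (t n))" for d
  define A where "A i = (\<Sum>n<p. b n * exp_poly_shift \<theta> p (t n) q i)" for i
  have "exp_poly \<theta> p A x = (\<Sum>n<p. a n * (F (x + t n) / F (t n)))" for x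
  proof -
    have "exp_poly \<theta> p A x = (\<Sum>n<p. b n * exp_poly \<theta> p (exp_poly_shift \<theta> p (t n) q) x)"
      unfolding exp_poly_def A_def sum_distrib_left sum_distrib_right
      by (subst sum.swap) (simp add: mult.assoc)
    then show ?thesis by (simp add: exp_poly_shift F_eq b_def add.commute)
  qed
  then have sub: "{0..} \<subseteq> {x. exp_poly \<theta> p A x = 0}" using zero by auto
  have A0: "A i = 0" if "i < p" for i
    by (rule exp_poly_many_zeros[OF sub _ that]) (simp add: infinite_Ici)
  have A_eq: "A i = (\<Sum>j<p. if i \<le> j then M (j - i) * q j else 0)" for i
    unfolding A_def exp_poly_shift_def M_def sum_distrib_left sum_distrib_right
    by (subst sum.swap) (auto intro!: sum.cong simp: sum_distrib_left sum_distrib_right)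
  have M0: "M d = 0" if "d < p" for d
    using that
  proof (induction d rule: less_induct)
    case (less d)
    let ?i = "p - 1 - d"
    have "0 = (\<Sum>j<p. if ?i \<le> j then M (j - ?i) * q j else 0)"
    proof -
      have "A ?i = 0" using A0[of ?i] less.prems by simp
      then show ?thesis unfolding A_eq by (rule sym)
    qed
    also have "\<dots> = (\<Sum>j<p. if j = p - 1 then M d * q j else 0)"
    proof (intro sum.cong refl)
      fix j assume "j \<in> {..<p}"
      then show "(if ?i \<le> j then M (j - ?i) * q j else 0) = (if j = p - 1 then M d * q j else 0)"
        using less.prems less.IH[of "j - ?i"] by (cases "j = p - 1") auto
    qed
    also have "\<dots> = M d * q (p - 1)" using order_pos by simp
    finally show ?case using top by simp
  qed
  let ?r = "Matrix.mat 1 p (\<lambda>(_, n). a n)"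
  have r: "?r \<in> carrier_mat 1 p" by simp
  have "?r * node_mat = 0\<^sub>m 1 p"
  proof (rule eq_matI)
    fix i j assume "i < dim_row (0\<^sub>m 1 p)" "j < dim_col (0\<^sub>m 1 p)"
    then have ij: "i = 0" "j < p" by auto
    have "(?r * node_mat) $$ (i, j) = (\<Sum>n<p. a n * (exp_mono \<theta> j (t n) / F (t n)))"
      using ij by (subst mult_mat_entry[OF r node_carrier(1)]) (auto simp: node_mat_def)
    also have "\<dots> = M j" by (simp add: M_def b_def)
    finally show "(?r * node_mat) $$ (i, j) = 0\<^sub>m 1 p $$ (i, j)" using M0 ij by simp
  qed (auto simp: node_mat_def)
  then have "?r * node_mat * node_inv = 0\<^sub>m 1 p * node_inv" by simp
  also have "?r * node_mat * node_inv = ?r * (node_mat * node_inv)"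
    by (intro assoc_mult_mat[of _ 1 p _ p _ p]) auto
  finally have "?r = 0\<^sub>m 1 p" by (simp add: left_mult_zero_mat[OF node_inv(1)])
  then have "?r $$ (0, n) = 0\<^sub>m 1 p $$ (0, n)" by simp
  then show ?thesis using \<open>n < p\<close> by simp
qed

end

text \<open>
  The \<open>p\<close> row vectors \<open>\<alpha> exp (t\<^sub>n S)\<close> live in a space of dimension \<open>r < p\<close>, so that they are linearly
  dependent; multiplication by \<open>exp (x S)\<close> preserves the dependence for all \<open>x\<close>.
\<close>

lemma short_representation_dependent:
  fixes \<alpha> S :: "real mat" and t :: "nat \<Rightarrow> real"
  assumes \<alpha>: "\<alpha> \<in> carrier_mat 1 r" and S: "S \<in> carrier_mat r r" and "r < p"
  obtains a where "\<exists>n<p. a n \<noteq> 0"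
    "\<And>x. (\<Sum>n<p. a n * (\<alpha> * mat_exp ((x + t n) \<cdot>\<^sub>m S) * ones r) $$ (0, 0)) = 0"
proof -
  define X where "X n = \<alpha> * mat_exp (t n \<cdot>\<^sub>m S)" for n
  have X: "X n \<in> carrier_mat 1 r" for n
    unfolding X_def using S \<alpha> by (intro mult_carrier_mat[of _ _ r]) auto
  define N where "N = Matrix.mat p p (\<lambda>(m, n). if m < r then X n $$ (0, m) else 0)"
  have N: "N \<in> carrier_mat p p" by (simp add: N_def)
  \<comment> \<open>The matrix of these rows is padded by zeros to a square one, of which row \<open>r\<close> vanishes.\<close>
  have "Determinant.det (transpose_mat N) = 0"
  proof -
    have "(N\<^sup>T *\<^sub>v unit_vec p r) = 0\<^sub>v p"
      using \<open>r < p\<close> N by (intro eq_vecI) (auto simp: N_def)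
    moreover have "unit_vec p r \<noteq> (0\<^sub>v p :: real Matrix.vec)" using \<open>r < p\<close>
      by (metis index_unit_vec(2) index_zero_vec(1) zero_neq_one)
    ultimately show ?thesis using N by (subst det_0_iff_vec_prod_zero_field[of _ p]) (auto intro!: exI[of _ "unit_vec p r"])
  qed
  then have "Determinant.det N = 0" using Determinant.det_transpose[OF N] by simp
  then obtain v where v: "v \<in> carrier_vec p" "v \<noteq> 0\<^sub>v p" "N *\<^sub>v v = 0\<^sub>v p"
    using det_0_iff_vec_prod_zero_field[OF N] by auto
  show ?thesis
  proof (rule that[of "vec_index v"])
    show "\<exists>n<p. vec_index v n \<noteq> 0"
    proof (rule ccontr)
      assume "\<not> ?thesis"
      then have "v = 0\<^sub>v p" using v(1) by (intro eq_vecI) auto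
      with v(2) show False ..
    qed
    fix x
    have comb: "(\<Sum>n<p. vec_index v n * X n $$ (0, m)) = 0" if "m < r" for m
    proof -
      have "vec_index (N *\<^sub>v v) m = (\<Sum>n<p. X n $$ (0, m) * vec_index v n)"
        using that \<open>r < p\<close> v(1) by (auto simp: N_def scalar_prod_def atLeast0LessThan)
      then show ?thesis using v(3) that \<open>r < p\<close> by (simp add: mult.commute)
    qed
    have ent: "(\<alpha> * mat_exp ((x + t n) \<cdot>\<^sub>m S) * ones r) $$ (0, 0)
        = (\<Sum>m<r. X n $$ (0, m) * (mat_exp (x \<cdot>\<^sub>m S) * ones r) $$ (m, 0))" for n
    proof -
      have o: "ones r \<in> carrier_mat r 1" by (simp add: ones_def)
      have e: "mat_exp (y \<cdot>\<^sub>m S) \<in> carrier_mat r r" for y using S by simp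
      have "\<alpha> * mat_exp ((t n + x) \<cdot>\<^sub>m S) * ones r = \<alpha> * (mat_exp (t n \<cdot>\<^sub>m S) * mat_exp (x \<cdot>\<^sub>m S)) * ones r"
        unfolding mat_exp_add[OF S] ..
      also have "\<dots> = X n * mat_exp (x \<cdot>\<^sub>m S) * ones r"
        unfolding X_def using assoc_mult_mat[OF \<alpha> e e] by simp
      also have "\<dots> = X n * (mat_exp (x \<cdot>\<^sub>m S) * ones r)"
        by (rule assoc_mult_mat[OF X e o])
      finally show ?thesis using X mult_carrier_mat[OF e o]
        by (simp add: add.commute mult_mat_entry[of _ 1 r _ 1] del: index_mult_mat)
    qed
    have "(\<Sum>n<p. vec_index v n * (\<alpha> * mat_exp ((x + t n) \<cdot>\<^sub>m S) * ones r) $$ (0, 0))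
        = (\<Sum>m<r. (\<Sum>n<p. vec_index v n * X n $$ (0, m)) * (mat_exp (x \<cdot>\<^sub>m S) * ones r) $$ (m, 0))"
      unfolding ent sum_distrib_left sum_distrib_right by (subst sum.swap) (simp add: mult.assoc)
    then show "(\<Sum>n<p. vec_index v n * (\<alpha> * mat_exp ((x + t n) \<cdot>\<^sub>m S) * ones r) $$ (0, 0)) = 0"
      by (simp add: comb)
  qed
qed

section \<open>The discrete generator on smooth functions\<close>

lemma interval_partition_exists:
  fixes s :: "nat \<Rightarrow> real"
  shows "s 0 \<le> y \<Longrightarrow> y < s N \<Longrightarrow> \<exists>n<N. s n \<le> y \<and> y < s (Suc n)"
    and "s 0 < y \<Longrightarrow> y \<le> s N \<Longrightarrow> \<exists>n<N. s n < y \<and> y \<le> s (Suc n)"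
proof -
  show "s 0 \<le> y \<Longrightarrow> y < s N \<Longrightarrow> \<exists>n<N. s n \<le> y \<and> y < s (Suc n)"
  proof (induction N)
    case (Suc N)
    then show ?case by (cases "y < s N") (auto simp: less_Suc_eq)
  qed simp
  show "s 0 < y \<Longrightarrow> y \<le> s N \<Longrightarrow> \<exists>n<N. s n < y \<and> y \<le> s (Suc n)"
  proof (induction N)
    case (Suc N)
    then show ?case by (cases "y \<le> s N") (auto simp: less_Suc_eq)
  qed simp
qed

lemma steps_mono:
  fixes s :: "nat \<Rightarrow> real"
  assumes "\<And>n. n < N \<Longrightarrow> s n \<le> s (Suc n)" "m \<le> n" "n \<le> N"
  shows "s m \<le> s n"
  using assms(2,3)
proof (induction n rule: dec_induct)
  case (step k)
  then show ?case using assms(1)[of k] by auto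
qed simp

lemma interval_partition_unique:
  fixes s :: "nat \<Rightarrow> real"
  assumes mono: "\<And>n. n < N \<Longrightarrow> s n \<le> s (Suc n)"
    and "m < N" "n < N" "s m \<le> y \<and> y < s (Suc m) \<and> s n \<le> y \<and> y < s (Suc n)
      \<or> s m < y \<and> y \<le> s (Suc m) \<and> s n < y \<and> y \<le> s (Suc n)"
  shows "m = n"
proof (rule ccontr)
  assume "m \<noteq> n"
  then consider "Suc m \<le> n" | "Suc n \<le> m" by linarith
  then show False
    using steps_mono[of N s "Suc m" n] steps_mono[of N s "Suc n" m] assms by cases auto
qed

lemma LBINT_half_open:
  fixes g :: "real \<Rightarrow> real"
  assumes "continuous_on {u..v} g"
  shows "(LBINT x:{u..<v}. g x) = integral {u..v} g" "(LBINT x:{u<..v}. g x) = integral {u..v} g"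
    "(LBINT x:{u..v}. g x) = integral {u..v} g"
proof -
  have int: "set_integrable lborel {u..v} g" by (rule borel_integrable_atLeastAtMost'[OF assms])
  have *: "(LBINT x:X. g x) = integral {u..v} g"
    if "X \<in> sets lborel" "X \<subseteq> {u..v}" "{u..v} - X \<subseteq> {u, v}" for X
  proof -
    have "(LBINT x:X. g x) = integral X g"
      using set_integrable_subset[OF int that(1,2)] by (rule set_borel_integral_eq_integral)
    also have "\<dots> = integral {u..v} g"
      using that by (intro integral_subset_negligible) (auto intro: negligible_subset[of "{u, v}"])
    finally show ?thesis .
  qed
  show "(LBINT x:{u..<v}. g x) = integral {u..v} g" "(LBINT x:{u<..v}. g x) = integral {u..v} g"
    "(LBINT x:{u..v}. g x) = integral {u..v} g"
    by (auto intro!: *)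
qed

lemma qbd_index_sum:
  fixes X :: "nat \<Rightarrow> 's::finite \<Rightarrow> nat \<Rightarrow> real"
  shows "(\<Sum>(l, j, m)\<in>qbd_index K c p. X l j m)
    = (\<Sum>j | c j < 0. X 0 j 0) + (\<Sum>l\<in>{1..K}. \<Sum>j\<in>UNIV. \<Sum>m<p. X l j m) + (\<Sum>j | c j > 0. X (K + 1) j 0)"
proof -
  let ?A = "{0::nat} \<times> {i. c i < 0} \<times> {0::nat}" and ?B = "{1..K} \<times> (UNIV :: 's set) \<times> {..<p}"
    and ?C = "{K + 1} \<times> {i. c i > 0} \<times> {0::nat}"
  let ?X = "\<lambda>(l, j, m). X l j m"
  have "sum ?X (?A \<union> ?B \<union> ?C) = sum ?X (?A \<union> ?B) + sum ?X ?C"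
    by (rule sum.union_disjoint) auto
  moreover have "sum ?X (?A \<union> ?B) = sum ?X ?A + sum ?X ?B"
    by (rule sum.union_disjoint) auto
  moreover have "sum ?X ({a} \<times> J \<times> {d}) = (\<Sum>j\<in>J. X a j d)" for a d and J :: "'s set"
    by (rule sum.reindex_bij_witness[of _ "\<lambda>j. (a, j, d)" "\<lambda>(l, j, m). j"]) auto
  moreover have "sum ?X ?B = (\<Sum>l\<in>{1..K}. \<Sum>j\<in>UNIV. \<Sum>m<p. X l j m)"
    by (simp add: sum.cartesian_product case_prod_unfold)
  ultimately show ?thesis
    by (simp add: qbd_index_def)
qed

text \<open>
  The phase-space data \<open>b, K, T, c\<close> and the function \<open>f\<close> are added to a folded law that is given by
  a nodal representation. One constant \<open>L\<close> bounds the derivative of \<open>f\<close> and is a Lipschitz constant of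
  it; \<open>\<gamma>\<close> is the mesh width of the nodes.
\<close>

locale fluid_approximation =
  node_representation \<theta> p t q F + folded_law \<Delta> \<epsilon> \<kappa> F h U
  for \<theta> p t q F \<Delta> \<epsilon> \<kappa> h U +
  fixes b :: real and K :: nat and T :: "'s::finite \<Rightarrow> 's \<Rightarrow> real" and c :: "'s \<Rightarrow> real"
    and f :: "real \<Rightarrow> 's \<Rightarrow> real" and L :: real and \<gamma> :: real
  assumes h_eq: "h = density" and U_eq: "U = exp_poly \<theta> p (fold_coeff (2 * \<Delta>))"
    and K_pos: "1 \<le> K" and \<Delta>_eq: "\<Delta> = b / real K" and c_neq: "c i \<noteq> 0"
    and t_0: "t 0 = 0" and t_p: "t p = \<Delta>" and t_less: "n < p \<Longrightarrow> t n < t (Suc n)"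
    and t_le: "n < p \<Longrightarrow> t n \<le> \<Delta> - \<epsilon>" and t_gap_0: "n < p \<Longrightarrow> t n = 0 \<or> \<epsilon> \<le> t n"
    and mesh: "n < p \<Longrightarrow> t (Suc n) - t n \<le> \<gamma>"
    and f_deriv: "x \<in> {0..b} \<Longrightarrow> ((\<lambda>x. f x j) has_real_derivative dx b f x j) (at x within {0..b})"
    and dx_bound: "x \<in> {0..b} \<Longrightarrow> \<bar>dx b f x j\<bar> \<le> L"
    and dx_lip: "x \<in> {0..b} \<Longrightarrow> y \<in> {0..b} \<Longrightarrow> \<bar>dx b f x j - dx b f y j\<bar> \<le> L * \<bar>x - y\<bar>"
begin

declare One_nat_def [simp]

lemma b_eq: "b = real K * \<Delta>" and b_pos: "0 < b"
  using \<Delta>_eq K_pos cell_pos by (auto simp: field_simps zero_less_divide_iff)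

lemma t_nonneg: "n \<le> p \<Longrightarrow> 0 \<le> t n"
  using steps_mono[of p t 0 n] t_less t_0 by (auto intro: less_imp_le)

lemma F_t_0 [simp]: "F (t 0) = 1" by (simp add: t_0 F_0)

lemma L_nonneg: "0 \<le> L"
  using order_trans[OF abs_ge_zero dx_bound[of 0]] b_pos by simp

lemma f_lip: "x \<in> {0..b} \<Longrightarrow> y \<in> {0..b} \<Longrightarrow> \<bar>f x j - f y j\<bar> \<le> L * \<bar>x - y\<bar>"
  using field_differentiable_bound[of "{0..b}" "\<lambda>x. f x j" "\<lambda>x. dx b f x j" L x y] f_deriv dx_bound
  by (auto simp: convex_real_interval)

abbreviation y\<^sub>g :: "nat \<Rightarrow> real" where "y\<^sub>g \<equiv> grid b K"

lemma grid_eq: "y\<^sub>g k = (real k - 1) * \<Delta>"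
  by (simp add: grid_def \<Delta>_eq)

lemma grid_Suc: "y\<^sub>g (Suc k) = y\<^sub>g k + \<Delta>"
  by (simp add: grid_eq algebra_simps)

lemma grid_range: "1 \<le> k \<Longrightarrow> k \<le> K + 1 \<Longrightarrow> y\<^sub>g k \<in> {0..b}"
  unfolding grid_eq using cell_pos mult_right_mono[of "real k - 1" "real K" \<Delta>] b_eq by simp

lemma grid_ends: "y\<^sub>g 1 = 0" "y\<^sub>g (Suc K) = b"
  unfolding grid_eq using b_eq by simp_all

text \<open>
  The point at distance \<open>z\<close> from the end of cell \<open>k\<close> towards which phase \<open>j\<close> moves. In this variable
  both signs of the rate are treated alike.
\<close>

definition cell_pt :: "nat \<Rightarrow> 's \<Rightarrow> real \<Rightarrow> real" where
  "cell_pt k j z = (if c j > 0 then y\<^sub>g (Suc k) - z else y\<^sub>g k + z)"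

definition cell_fun :: "nat \<Rightarrow> 's \<Rightarrow> real \<Rightarrow> real" where
  "cell_fun k j z = f (cell_pt k j z) j"

definition cell_deriv :: "nat \<Rightarrow> 's \<Rightarrow> real \<Rightarrow> real" where
  "cell_deriv k j z = (if c j > 0 then - 1 else 1) * dx b f (cell_pt k j z) j"

lemma cell_pt_range:
  assumes "1 \<le> k" "k \<le> K" "z \<in> {0..\<Delta>}" shows "cell_pt k j z \<in> {0..b}"
  using grid_range[of k] grid_range[of "Suc k"] assms unfolding cell_pt_def grid_Suc by auto

lemma cell_fun_lip:
  assumes "1 \<le> k" "k \<le> K" "x \<in> {0..\<Delta>}" "y \<in> {0..\<Delta>}"
  shows "\<bar>cell_fun k j x - cell_fun k j y\<bar> \<le> L * \<bar>x - y\<bar>"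
proof -
  have "\<bar>cell_pt k j x - cell_pt k j y\<bar> = \<bar>x - y\<bar>" by (auto simp: cell_pt_def)
  then show ?thesis
    using f_lip[of "cell_pt k j x" "cell_pt k j y" j] cell_pt_range assms by (simp add: cell_fun_def)
qed

lemma cell_deriv_lip:
  assumes "1 \<le> k" "k \<le> K" "x \<in> {0..\<Delta>}" "y \<in> {0..\<Delta>}"
  shows "\<bar>cell_deriv k j x - cell_deriv k j y\<bar> \<le> L * \<bar>x - y\<bar>"
proof -
  have "\<bar>cell_pt k j x - cell_pt k j y\<bar> = \<bar>x - y\<bar>" by (auto simp: cell_pt_def)
  then show ?thesis
    using dx_lip[of "cell_pt k j x" "cell_pt k j y" j] cell_pt_range assms
    by (auto simp: cell_deriv_def abs_minus_commute)
qed

lemma cell_deriv_bound: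
  assumes "1 \<le> k" "k \<le> K" "x \<in> {0..\<Delta>}"
  shows "\<bar>cell_deriv k j x\<bar> \<le> L"
  using dx_bound[OF cell_pt_range[OF assms], of j] by (auto simp: cell_deriv_def abs_mult)

lemma cell_fun_deriv:
  assumes "1 \<le> k" "k \<le> K" "z \<in> {0..\<Delta>}"
  shows "(cell_fun k j has_real_derivative cell_deriv k j z) (at z within {0..\<Delta>})"
proof -
  have "(cell_pt k j has_real_derivative (if c j > 0 then - 1 else 1)) (at z within {0..\<Delta>})"
    unfolding cell_pt_def[abs_def] by (auto intro!: derivative_eq_intros)
  moreover have "((\<lambda>x. f x j) has_real_derivative dx b f (cell_pt k j z) j)
      (at (cell_pt k j z) within cell_pt k j ` {0..\<Delta>})"
    using assms cell_pt_range
    by (intro DERIV_subset[OF f_deriv[OF cell_pt_range]]) auto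
  ultimately have "((\<lambda>x. f x j) \<circ> cell_pt k j has_real_derivative
      dx b f (cell_pt k j z) j * (if c j > 0 then - 1 else 1)) (at z within {0..\<Delta>})"
    by (intro DERIV_image_chain)
  moreover have "(\<lambda>x. f x j) \<circ> cell_pt k j = cell_fun k j" by (auto simp: cell_fun_def)
  ultimately show ?thesis by (simp add: cell_deriv_def mult.commute)
qed

lemma cell_fun_cont: "1 \<le> k \<Longrightarrow> k \<le> K \<Longrightarrow> continuous_on {0..\<Delta>} (cell_fun k j)"
  using cell_fun_deriv by (rule DERIV_continuous_on) auto

lemma f_cont': "continuous_on {0..b} (\<lambda>x. f x j)"
  using f_deriv by (rule DERIV_continuous_on)

definition \<alpha> :: "real mat" where "\<alpha> = Matrix.mat 1 p (\<lambda>(_, m). if m = 0 then 1 else 0)"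
abbreviation S :: "real mat" where "S \<equiv> gen_mat"
abbreviation D :: "real mat" where "D \<equiv> jump_mat \<Delta> \<epsilon> p \<alpha> S"
abbreviation V :: "nat \<Rightarrow> 's \<Rightarrow> nat \<Rightarrow> real" where
  "V k j m \<equiv> closing_op b K c p S f (k, j, m)"

lemma closing_vec_entry:
  assumes "m < p"
  shows "closing_vec b K c p S l j x $$ (m, 0)
    = folded (t m) (if c j > 0 then y\<^sub>g (Suc l) - x else x - y\<^sub>g l) / F (t m)"
proof -
  let ?z = "if c j > 0 then y\<^sub>g (Suc l) - x else x - y\<^sub>g l"
  let ?X = "mat_exp (?z \<cdot>\<^sub>m S)" and ?Y = "mat_exp ((2 * \<Delta> - ?z) \<cdot>\<^sub>m S)"
  let ?R = "the (mat_inverse (period_mat (2 * \<Delta>)))"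
  have XY: "?X \<in> carrier_mat p p" "?Y \<in> carrier_mat p p" by simp_all
  have "period_mat (2 * \<Delta>) \<in> carrier_mat p p"
    by (auto simp: period_mat_def intro!: minus_carrier_mat mat_exp_carrier)
  then have R: "?R \<in> carrier_mat p p"
    using cell_pos by (intro mat_inverse_works det_period_mat) auto
  have E: "exit_rates S \<in> carrier_mat p 1" unfolding exit_rates_eq by (rule node_carrier(3))
  have "closing_vec b K c p S l j x = (?X + ?Y) * ?R * exit_rates S"
    by (simp add: closing_vec_def Let_def period_mat_def \<Delta>_eq)
  also have "\<dots> = (?X + ?Y) * (?R * exit_rates S)"
    by (rule assoc_mult_mat[OF add_carrier_mat[OF XY(2)] R E])
  also have "\<dots> = ?X * value_col (fold_coeff (2 * \<Delta>)) + ?Y * value_col (fold_coeff (2 * \<Delta>))"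
    using cell_pos by (simp add: fold_col add_mult_distrib_mat[OF XY node_carrier(3)])
  finally have "closing_vec b K c p S l j x = value_col (exp_poly_shift \<theta> p ?z (fold_coeff (2 * \<Delta>)))
      + value_col (exp_poly_shift \<theta> p (2 * \<Delta> - ?z) (fold_coeff (2 * \<Delta>)))"
    unfolding mat_exp_value_col .
  then show ?thesis
    using assms by (simp add: value_col_def exp_poly_shift folded_def add_divide_distrib flip: U_eq)
qed

text \<open>
  In terms of the distance from the exit end, \<open>v(z)\<close> is the vector of the folded densities.
\<close>

lemma closing_op_eq:
  assumes l: "1 \<le> l" "l \<le> K" and m: "m < p"
  shows "V l j m = folded_mean (cell_fun l j) (t m)"
proof -
  let ?z = "\<lambda>x. if c j > 0 then y\<^sub>g (Suc l) - x else x - y\<^sub>g l"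
  let ?g = "\<lambda>x. folded (t m) (?z x) / F (t m) * f x j"
  have "continuous_on {y\<^sub>g l..y\<^sub>g (Suc l)} (\<lambda>x. f x j)"
    using grid_range[of l] grid_range[of "Suc l"] l by (intro continuous_on_subset[OF f_cont']) auto
  then have cont: "continuous_on {y\<^sub>g l..y\<^sub>g (Suc l)} ?g"
    using F_node_neq[OF m] by (cases "c j > 0") (auto intro!: continuous_intros)
  have "V l j m = (LBINT x:cell b K c l j. ?g x)"
    using l by (simp add: closing_op_def closing_vec_entry[OF m])
  also have "\<dots> = integral {y\<^sub>g l..y\<^sub>g (Suc l)} ?g"
    using LBINT_half_open[OF cont] by (cases "c j > 0") (simp_all add: cell_def)
  also have "\<dots> = integral {0..\<Delta>} (\<lambda>z. folded (t m) z / F (t m) * cell_fun l j z)"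
  proof (cases "c j > 0")
    case True
    then show ?thesis
      using integral_reflect_window[of \<Delta> ?g "y\<^sub>g (Suc l)", symmetric] unfolding grid_Suc
      by (simp add: cell_fun_def cell_pt_def grid_Suc)
  next
    case False
    then show ?thesis
      using integral_shift_window[of \<Delta> ?g "y\<^sub>g l", symmetric] unfolding grid_Suc
      by (simp add: cell_fun_def cell_pt_def add.commute)
  qed
  also have "\<dots> = folded_mean (cell_fun l j) (t m)"
    by (simp add: folded_mean_def)
  finally show ?thesis .
qed

lemma closing_op_ends: "V 0 j m = f 0 j" "V (Suc K) j m = f b j"
  by (simp_all add: closing_op_def)

lemma weighted_folded_means:
  assumes "continuous_on {0..\<Delta>} \<phi>"
  shows "(\<Sum>m<p. w m * folded_mean \<phi> (t m))
    = integral {0..\<Delta>} (\<lambda>z. (\<Sum>m<p. w m * (folded (t m) z / F (t m))) * \<phi> z)"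
proof -
  note [continuous_intros] = assms
  have "(\<Sum>m<p. w m * folded_mean \<phi> (t m))
      = (\<Sum>m<p. integral {0..\<Delta>} (\<lambda>z. w m * (folded (t m) z / F (t m)) * \<phi> z))"
    unfolding folded_mean_def
  proof (intro sum.cong refl)
    fix m
    have "(\<lambda>z. w m * (folded (t m) z / F (t m)) * \<phi> z) = (\<lambda>z. (w m / F (t m)) * (folded (t m) z * \<phi> z))"
      by (simp add: fun_eq_iff)
    then show "w m * (integral {0..\<Delta>} (\<lambda>z. folded (t m) z * \<phi> z) / F (t m))
        = integral {0..\<Delta>} (\<lambda>z. w m * (folded (t m) z / F (t m)) * \<phi> z)"
      by (simp only: integral_mult_right) simp
  qed
  also have "\<dots> = integral {0..\<Delta>} (\<lambda>z. \<Sum>m<p. w m * (folded (t m) z / F (t m)) * \<phi> z)"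
    by (intro integral_sum[symmetric] integrable_continuous_real continuous_intros) auto
  finally show ?thesis by (simp add: sum_distrib_right)
qed

text \<open>
  As \<open>t 0 = 0\<close>, the first row of the exponential evaluates a function, given by its values at the
  nodes, at the point \<open>y\<close>.
\<close>

lemma mat_exp_row_shift:
  "(\<Sum>m<p. mat_exp (y \<cdot>\<^sub>m S) $$ (0, m) * (exp_poly \<theta> p a (x + t m) / F (t m))) = exp_poly \<theta> p a (x + y)"
  using mat_exp_node_sum[OF order_pos, of y "exp_poly_shift \<theta> p x a"]
  by (simp add: exp_poly_shift t_0 F_0)

text \<open>
  Translation commutes with differentiation.
\<close>

lemma gen_mat_row_shift:
  assumes "n < p"
  shows "(\<Sum>m<p. S $$ (n, m) * (exp_poly \<theta> p a (x + t m) / F (t m)))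
    = exp_poly \<theta> p (exp_poly_deriv \<theta> p a) (x + t n) / F (t n)"
proof -
  have "(exp_poly \<theta> p (exp_poly_shift \<theta> p x a) has_real_derivative
      exp_poly \<theta> p (exp_poly_deriv \<theta> p a) (x + t n)) (at (t n))"
    using DERIV_shift[of "exp_poly \<theta> p a" _ "t n" x] exp_poly_deriv[of \<theta> p a "x + t n"]
    by (simp add: exp_poly_shift[abs_def] add.commute)
  then have "exp_poly \<theta> p (exp_poly_deriv \<theta> p (exp_poly_shift \<theta> p x a)) (t n)
      = exp_poly \<theta> p (exp_poly_deriv \<theta> p a) (x + t n)"
    using exp_poly_deriv DERIV_unique by blast
  then show ?thesis
    using gen_mat_node_sum[OF assms, of "exp_poly_shift \<theta> p x a"] by (simp add: exp_poly_shift)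
qed

text \<open>
  The row vector \<open>\<alpha> exp (y S) / F y\<close> is the state at age \<open>y\<close>, so it turns the vector
  of means at the nodes into the mean at \<open>y\<close>.
\<close>

lemma initial_row_mean:
  assumes "continuous_on {0..\<Delta>} \<phi>" "F y \<noteq> 0"
  shows "(\<Sum>m<p. mat_exp (y \<cdot>\<^sub>m S) $$ (0, m) * folded_mean \<phi> (t m)) = F y * folded_mean \<phi> y"
proof -
  have "(\<Sum>m<p. mat_exp (y \<cdot>\<^sub>m S) $$ (0, m) * (folded (t m) z / F (t m))) = folded y z" for z
    using mat_exp_row_shift[of y "fold_coeff (2 * \<Delta>)" z, folded U_eq]
      mat_exp_row_shift[of y "fold_coeff (2 * \<Delta>)" "2 * \<Delta> - z", folded U_eq]
    by (simp add: folded_def add_divide_distrib distrib_left sum.distrib)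
  then show ?thesis using assms(2)
    by (subst weighted_folded_means[OF assms(1)]) (simp add: folded_mean_def)
qed

lemma alpha_carrier: "\<alpha> \<in> carrier_mat 1 p" and alpha_entry: "m < p \<Longrightarrow> \<alpha> $$ (0, m) = (if m = 0 then 1 else 0)"
  by (auto simp: \<alpha>_def)

lemma alpha_row: "A \<in> carrier_mat p p \<Longrightarrow> m < p \<Longrightarrow> (\<alpha> * A) $$ (0, m) = A $$ (0, m)"
  unfolding \<alpha>_def using order_pos by (subst mult_mat_entry[of _ 1 p _ p]) (auto simp: if_distrib[of "\<lambda>x. x * _"] cong: if_cong)

lemma alpha_product:
  assumes B: "B \<in> carrier_mat p 1"
  shows "(\<alpha> * mat_exp (y \<cdot>\<^sub>m S) * B) $$ (0, 0) = (mat_exp (y \<cdot>\<^sub>m S) * B) $$ (0, 0)"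
proof -
  have e: "mat_exp (y \<cdot>\<^sub>m S) \<in> carrier_mat p p" by simp
  have "(\<alpha> * mat_exp (y \<cdot>\<^sub>m S) * B) $$ (0, 0) = (\<Sum>m<p. (\<alpha> * mat_exp (y \<cdot>\<^sub>m S)) $$ (0, m) * B $$ (m, 0))"
    by (intro mult_mat_entry[OF mult_carrier_mat[OF alpha_carrier e] B]) auto
  also have "\<dots> = (\<Sum>m<p. mat_exp (y \<cdot>\<^sub>m S) $$ (0, m) * B $$ (m, 0))"
    using alpha_row[OF e] by (intro sum.cong refl) (simp only: lessThan_iff)
  also have "\<dots> = (mat_exp (y \<cdot>\<^sub>m S) * B) $$ (0, 0)"
    using order_pos by (intro mult_mat_entry[OF e B, symmetric]) auto
  finally show ?thesis .
qed

lemma alpha_survival: "(\<alpha> * mat_exp (y \<cdot>\<^sub>m S) * ones p) $$ (0, 0) = F y"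
  using survival_entry[OF order_pos, of y] by (subst alpha_product) (auto simp: ones_def t_0 F_0)

lemma alpha_density: "(\<alpha> * mat_exp (y \<cdot>\<^sub>m S) * exit_rates S) $$ (0, 0) = h y"
  using density_entry[OF order_pos, of y] node_carrier(3)[of density_coeff]
  by (subst alpha_product) (auto simp: exit_rates_eq t_0 F_0 h_eq)

lemma mat_exp_entry_cont:
  assumes "n < p" "m < p"
  shows "continuous_on A (\<lambda>y. mat_exp (y \<cdot>\<^sub>m S) $$ (n, m))"
proof -
  have Q: "shift_mat y \<in> carrier_mat p p" for y by (simp add: shift_mat_def)
  have "mat_exp (y \<cdot>\<^sub>m S) $$ (n, m)
      = (\<Sum>j<p. (\<Sum>i<p. node_mat $$ (n, i) * (if i \<le> j then exp_mono \<theta> (j - i) y else 0)) * node_inv $$ (j, m))" for y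
    unfolding mat_exp_gen_mat
    using assms mult_mat_entry[OF mult_carrier_mat[OF node_carrier(1) Q] node_inv(1), of n m y]
      mult_mat_entry[OF node_carrier(1) Q, of n _ y]
    by (simp add: shift_mat_def)
  moreover have "continuous_on A (\<lambda>y. exp_mono \<theta> k y)" for k
    unfolding exp_mono_def by (intro continuous_intros) auto
  then have "continuous_on A (\<lambda>y. if i \<le> j then exp_mono \<theta> (j - i) y else 0)" for i j
    by (cases "i \<le> j") auto
  ultimately show ?thesis by (auto intro!: continuous_intros)
qed

text \<open>
  The integrals in the definition of the jump matrix, applied to the means at the nodes by
  \<open>initial_row_mean\<close>.
\<close>

lemma jump_row_mean:
  assumes "n < p" and \<phi>: "continuous_on {0..\<Delta>} \<phi>"
  shows "(\<Sum>m<p. D $$ (n, m) * folded_mean \<phi> (t m))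
    = (integral {0..\<Delta> - \<epsilon>} (\<lambda>y. h (t n + y) * folded_mean \<phi> y)
      + F (t n + (\<Delta> - \<epsilon>)) * folded_mean \<phi> (\<Delta> - \<epsilon>)) / F (t n)"
proof -
  have Fy: "F y \<noteq> 0" if "y \<in> {0..\<Delta> - \<epsilon>}" for y using F_half[of y] that by auto
  have end_pt: "\<Delta> - \<epsilon> \<in> {0..\<Delta> - \<epsilon>}" using eps_pos eps_le by auto
  let ?e = "\<lambda>y m. mat_exp (y \<cdot>\<^sub>m S) $$ (0, m)"
  have dens: "(mat_exp (y \<cdot>\<^sub>m S) * exit_rates S) $$ (n, 0) = h (y + t n) / F (t n)" for y
    using density_entry[OF assms(1)] by (simp add: h_eq)
  have tail: "(LBINT y:{\<Delta> - \<epsilon>..}. h (y + t n)) = F (t n + (\<Delta> - \<epsilon>))"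
    unfolding add.commute[of "t n" "\<Delta> - \<epsilon>"]
  proof (rule tail_integral(3)[where F = "\<lambda>y. F (y + t n)"])
      show "((\<lambda>y. F (y + t n)) has_real_derivative - h (x + t n)) (at x)" for x
        using folded_law_axioms folded_law.F_deriv DERIV_shift by blast
      show "((\<lambda>y. F (y + t n)) \<longlongrightarrow> 0) at_top"
        by (rule filterlim_compose[OF F_lim]) real_asymp
      show "0 \<le> h (x + t n)" if "\<Delta> - \<epsilon> \<le> x" for x
        using that end_pt t_nonneg[of n] assms(1) by (intro f_nonneg) auto
  qed (intro continuous_intros)
  have entry: "D $$ (n, m) = integral {0..\<Delta> - \<epsilon>} (\<lambda>y. h (y + t n) / F (t n) * (?e y m / F y))
      + F (t n + (\<Delta> - \<epsilon>)) / F (t n) * (?e (\<Delta> - \<epsilon>) m / F (\<Delta> - \<epsilon>))" if m: "m < p" for m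
  proof -
    have ar: "(\<alpha> * mat_exp (y \<cdot>\<^sub>m S)) $$ (0, m) = ?e y m" for y by (rule alpha_row) (use m in auto)
    have "continuous_on {0..\<Delta> - \<epsilon>} (\<lambda>y. h (y + t n) / F (t n) * (?e y m / F y))"
      using Fy F_node_neq[OF assms(1)] m order_pos
      by (intro continuous_intros mat_exp_entry_cont) auto
    from LBINT_half_open(3)[OF this] show ?thesis
      using m assms(1) by (simp add: jump_mat_def dens ar alpha_survival tail)
  qed
  have row: "(\<Sum>m<p. ?e y m / F y * folded_mean \<phi> (t m)) = folded_mean \<phi> y" if "y \<in> {0..\<Delta> - \<epsilon>}" for y
    using initial_row_mean[OF \<phi> Fy[OF that]] Fy[OF that]
    by (simp add: sum_divide_distrib[symmetric])
  have "(\<Sum>m<p. D $$ (n, m) * folded_mean \<phi> (t m))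
      = (\<Sum>m<p. integral {0..\<Delta> - \<epsilon>} (\<lambda>y. h (y + t n) / F (t n) * (?e y m / F y)) * folded_mean \<phi> (t m))
      + F (t n + (\<Delta> - \<epsilon>)) / F (t n) * (\<Sum>m<p. ?e (\<Delta> - \<epsilon>) m / F (\<Delta> - \<epsilon>) * folded_mean \<phi> (t m))"
    by (simp add: entry distrib_right sum.distrib sum_distrib_left mult.assoc)
  also have "(\<Sum>m<p. ?e (\<Delta> - \<epsilon>) m / F (\<Delta> - \<epsilon>) * folded_mean \<phi> (t m)) = folded_mean \<phi> (\<Delta> - \<epsilon>)"
    by (rule row[OF end_pt])
  also have "(\<Sum>m<p. integral {0..\<Delta> - \<epsilon>} (\<lambda>y. h (y + t n) / F (t n) * (?e y m / F y)) * folded_mean \<phi> (t m))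
      = integral {0..\<Delta> - \<epsilon>} (\<lambda>y. \<Sum>m<p. h (y + t n) / F (t n) * (?e y m / F y) * folded_mean \<phi> (t m))"
    unfolding integral_mult_left[symmetric]
    using Fy F_node_neq[OF assms(1)] order_pos
    by (intro integral_sum[symmetric] integrable_continuous_real)
       (auto intro!: continuous_intros mat_exp_entry_cont)
  also have "\<dots> = integral {0..\<Delta> - \<epsilon>} (\<lambda>y. (1 / F (t n)) * (h (t n + y) * folded_mean \<phi> y))"
  proof (intro integral_cong)
    fix y assume y: "y \<in> {0..\<Delta> - \<epsilon>}"
    have "(\<Sum>m<p. h (y + t n) / F (t n) * (?e y m / F y) * folded_mean \<phi> (t m))
        = h (y + t n) / F (t n) * (\<Sum>m<p. ?e y m / F y * folded_mean \<phi> (t m))"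
      by (simp add: sum_distrib_left mult.assoc)
    then show "(\<Sum>m<p. h (y + t n) / F (t n) * (?e y m / F y) * folded_mean \<phi> (t m))
        = (1 / F (t n)) * (h (t n + y) * folded_mean \<phi> y)"
      unfolding row[OF y] by (simp add: add.commute)
  qed
  finally show ?thesis by (simp add: add_divide_distrib)
qed

abbreviation U' :: "real \<Rightarrow> real" where
  "U' \<equiv> exp_poly \<theta> p (exp_poly_deriv \<theta> p (fold_coeff (2 * \<Delta>)))"

lemma drift_row_mean:
  assumes "n < p" and \<phi>: "continuous_on {0..\<Delta>} \<phi>"
  shows "(\<Sum>m<p. S $$ (n, m) * folded_mean \<phi> (t m))
    = integral {0..\<Delta>} (\<lambda>z. (U' (z + t n) + U' (2 * \<Delta> - z + t n)) * \<phi> z) / F (t n)"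
proof -
  have "(\<Sum>m<p. S $$ (n, m) * (folded (t m) z / F (t m))) = (U' (z + t n) + U' (2 * \<Delta> - z + t n)) / F (t n)" for z
    using gen_mat_row_shift[OF assms(1), of "fold_coeff (2 * \<Delta>)" z, folded U_eq]
      gen_mat_row_shift[OF assms(1), of "fold_coeff (2 * \<Delta>)" "2 * \<Delta> - z", folded U_eq]
    by (simp add: folded_def add_divide_distrib distrib_left sum.distrib)
  then show ?thesis by (simp add: weighted_folded_means[OF \<phi>])
qed

lemma exit_entry_h: "n < p \<Longrightarrow> exit_rates S $$ (n, 0) = h (t n) / F (t n)"
  using exit_entry by (simp add: h_eq)

lemma interior_blocks:
  assumes k: "1 \<le> k" "k \<le> K" and n: "n < p"
  shows
    "m < p \<Longrightarrow> qbd_block K T c p \<alpha> S D k k (i, n) (j, m) =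
      (if (c i > 0) = (c j > 0)
       then (if i = j then \<bar>c i\<bar> * S $$ (n, m) else 0) + T i j * (if n = m then 1 else 0)
       else T i j * D $$ (n, m))" (is "_ \<Longrightarrow> ?diag")
    "m < p \<Longrightarrow> 1 \<le> l \<Longrightarrow> l \<le> K \<Longrightarrow> l \<noteq> k \<Longrightarrow> qbd_block K T c p \<alpha> S D k l (i, n) (j, m) =
      (if i = j \<and> m = 0 \<and> (if c i > 0 then l = Suc k else k = Suc l)
       then \<bar>c i\<bar> * (h (t n) / F (t n)) else 0)" (is "_ \<Longrightarrow> _ \<Longrightarrow> _ \<Longrightarrow> _ \<Longrightarrow> ?off")
    "c j < 0 \<Longrightarrow> qbd_block K T c p \<alpha> S D k 0 (i, n) (j, 0) =
      (if i = j \<and> k = 1 then \<bar>c i\<bar> * (h (t n) / F (t n)) else 0)" (is "_ \<Longrightarrow> ?low")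
    "c j > 0 \<Longrightarrow> qbd_block K T c p \<alpha> S D k (K + 1) (i, n) (j, 0) =
      (if i = j \<and> k = K then \<bar>c i\<bar> * (h (t n) / F (t n)) else 0)" (is "_ \<Longrightarrow> ?high")
proof -
  note defs = qbd_block_def Let_def phase_block_def kron_def block_add_def rate_diag_def zero_block_def
  have sa: "(exit_rates S * \<alpha>) $$ (n, m) = (if m = 0 then h (t n) / F (t n) else 0)" if "m < p" for m
    using mult_mat_entry[of "exit_rates S" p 1 \<alpha> p n m] n that exit_entry_h[OF n] node_carrier(3)[of density_coeff]
      alpha_carrier alpha_entry[OF that]
    unfolding exit_rates_eq by simp
  show ?diag if "m < p" using k n that by (auto simp: defs)
  show ?off if "m < p" "1 \<le> l" "l \<le> K" "l \<noteq> k"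
    using k n that sa[OF that(1)] by (auto simp: defs)
  show ?low if "c j < 0" using k n that exit_entry_h[OF n] by (auto simp: defs)
  show ?high if "c j > 0" using k n that exit_entry_h[OF n] by (auto simp: defs)
qed

text \<open>
  What a row of level \<open>k\<close> reads from the level that the fluid enters when it leaves the cell: the
  boundary value of \<open>f\<close>, or the first entry of the neighbouring block.
\<close>

definition next_value :: "nat \<Rightarrow> 's \<Rightarrow> real" where
  "next_value k i = (if c i > 0 then (if k = K then f b i else V (Suc k) i 0)
     else (if k = 1 then f 0 i else V (k - 1) i 0))"

lemma interior_row:
  assumes k: "1 \<le> k" "k \<le> K" and n: "n < p"
  shows "qbd_row b K T c p \<alpha> S D f k i n
    = \<bar>c i\<bar> * ((\<Sum>m<p. S $$ (n, m) * V k i m) + h (t n) / F (t n) * next_value k i)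
      + (\<Sum>j\<in>UNIV. T i j * (if (c i > 0) = (c j > 0) then V k j n else \<Sum>m<p. D $$ (n, m) * V k j m))"
proof -
  let ?s = "\<bar>c i\<bar> * (h (t n) / F (t n))"
  let ?X = "\<lambda>l j m. qbd_block K T c p \<alpha> S D k l (i, n) (j, m) * V l j m"
  have low: "(\<Sum>j | c j < 0. ?X 0 j 0) = (if k = 1 \<and> c i < 0 then ?s * f 0 i else 0)"
  proof -
    have "(\<Sum>j | c j < 0. ?X 0 j 0) = (\<Sum>j | c j < 0. if i = j then (if k = 1 then ?s * f 0 i else 0) else 0)"
      by (intro sum.cong) (auto simp: interior_blocks(3)[OF assms] closing_op_ends)
    then show ?thesis by simp
  qed
  have high: "(\<Sum>j | c j > 0. ?X (K + 1) j 0) = (if k = K \<and> c i > 0 then ?s * f b i else 0)"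
  proof -
    have "(\<Sum>j | c j > 0. ?X (K + 1) j 0) = (\<Sum>j | c j > 0. if i = j then (if k = K then ?s * f b i else 0) else 0)"
      using interior_blocks(4)[OF assms] by (intro sum.cong) (auto simp: closing_op_ends)
    then show ?thesis by simp
  qed
  have diag: "(\<Sum>j\<in>UNIV. \<Sum>m<p. ?X k j m) = \<bar>c i\<bar> * (\<Sum>m<p. S $$ (n, m) * V k i m)
      + (\<Sum>j\<in>UNIV. T i j * (if (c i > 0) = (c j > 0) then V k j n else \<Sum>m<p. D $$ (n, m) * V k j m))"
  proof -
    have "(\<Sum>m<p. ?X k j m) = (if i = j then \<bar>c i\<bar> * (\<Sum>m<p. S $$ (n, m) * V k i m) else 0)
        + T i j * (if (c i > 0) = (c j > 0) then V k j n else \<Sum>m<p. D $$ (n, m) * V k j m)" for j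
    proof (cases "(c i > 0) = (c j > 0)")
      case True
      then have "(\<Sum>m<p. ?X k j m) = (\<Sum>m<p. (if i = j then \<bar>c i\<bar> * (S $$ (n, m) * V k i m) else 0)
          + (if n = m then T i j * V k j n else 0))"
        by (intro sum.cong) (auto simp: interior_blocks(1)[OF assms] algebra_simps)
      then show ?thesis using True n by (simp add: sum.distrib sum_distrib_left)
    next
      case False
      then have "(\<Sum>m<p. ?X k j m) = (\<Sum>m<p. T i j * (D $$ (n, m) * V k j m))"
        by (intro sum.cong refl) (subst interior_blocks(1)[OF assms], auto)
      moreover have "i \<noteq> j" using False by auto
      ultimately show ?thesis using False by (simp add: sum_distrib_left)
    qed
    then show ?thesis by (simp add: sum.distrib)
  qed
  have off: "(\<Sum>j\<in>UNIV. \<Sum>m<p. ?X l j m) = (if (if c i > 0 then l = Suc k else k = Suc l) then ?s * V l i 0 else 0)"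
    if l: "1 \<le> l" "l \<le> K" "l \<noteq> k" for l
  proof -
    have "(\<Sum>m<p. ?X l j m) = (\<Sum>m<p. if m = 0 then (if i = j \<and> (if c i > 0 then l = Suc k else k = Suc l)
        then ?s * V l i 0 else 0) else 0)" for j
      using interior_blocks(2)[OF assms _ l] by (intro sum.cong refl) auto
    then have "(\<Sum>m<p. ?X l j m) = (if i = j then (if (if c i > 0 then l = Suc k else k = Suc l)
        then ?s * V l i 0 else 0) else 0)" for j
      using order_pos by auto
    then show ?thesis by simp
  qed
  have mid: "(\<Sum>l\<in>{1..K}. \<Sum>j\<in>UNIV. \<Sum>m<p. ?X l j m) = (\<Sum>j\<in>UNIV. \<Sum>m<p. ?X k j m)
      + (\<Sum>l\<in>{1..K} - {k}. if (if c i > 0 then l = Suc k else k = Suc l) then ?s * V l i 0 else 0)"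
    using k off by (subst sum.remove[of _ k]) auto
  have nb: "(\<Sum>l\<in>{1..K} - {k}. if (if c i > 0 then l = Suc k else k = Suc l) then ?s * V l i 0 else 0)
      = (if c i > 0 then (if k < K then ?s * V (Suc k) i 0 else 0) else (if 1 < k then ?s * V (k - 1) i 0 else 0))"
  proof (cases "c i > 0")
    case True
    then have "(\<Sum>l\<in>{1..K} - {k}. if (if c i > 0 then l = Suc k else k = Suc l) then ?s * V l i 0 else 0)
        = (\<Sum>l\<in>{1..K} - {k}. if l = Suc k then ?s * V l i 0 else 0)" by simp
    then show ?thesis using True k by (subst (asm) sum.delta) auto
  next
    case False
    then have "(\<Sum>l\<in>{1..K} - {k}. if (if c i > 0 then l = Suc k else k = Suc l) then ?s * V l i 0 else 0)
        = (\<Sum>l\<in>{1..K} - {k}. if l = k - 1 then ?s * V l i 0 else 0)"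
      using k by (intro sum.cong) auto
    then show ?thesis using False k by (subst (asm) sum.delta) auto
  qed
  have "qbd_row b K T c p \<alpha> S D f k i n = (if k = 1 \<and> c i < 0 then ?s * f 0 i else 0)
      + ((\<Sum>j\<in>UNIV. \<Sum>m<p. ?X k j m) + (if c i > 0 then (if k < K then ?s * V (Suc k) i 0 else 0)
        else (if 1 < k then ?s * V (k - 1) i 0 else 0)))
      + (if k = K \<and> c i > 0 then ?s * f b i else 0)"
    unfolding qbd_row_def qbd_index_sum low high mid nb ..
  also have "\<dots> = (\<Sum>j\<in>UNIV. \<Sum>m<p. ?X k j m) + ?s * next_value k i"
    using c_neq[of i] k by (auto simp: next_value_def)
  finally show ?thesis unfolding diag by (simp add: algebra_simps)
qed

lemma boundary_rows:
  "c i < 0 \<Longrightarrow> qbd_row b K T c p \<alpha> S D f 0 i 0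
    = (\<Sum>j\<in>UNIV. T i j * (if c j < 0 then f 0 j else V 1 j 0))"
  "c i > 0 \<Longrightarrow> qbd_row b K T c p \<alpha> S D f (Suc K) i 0
    = (\<Sum>j\<in>UNIV. T i j * (if c j > 0 then f b j else V K j 0))"
proof -
  note defs = qbd_block_def Let_def phase_block_def kron_def block_add_def rate_diag_def zero_block_def alpha_entry
  have split: "(\<Sum>j\<in>UNIV. g j) = (\<Sum>j | c j < 0. g j) + (\<Sum>j | c j > 0. g j)" for g :: "'s \<Rightarrow> real"
  proof -
    have "{j. c j < 0} \<union> {j. c j > 0} = UNIV" using c_neq by (auto simp: neq_iff)
    then show ?thesis using sum.union_disjoint[of "{j. c j < 0}" "{j. c j > 0}" g] by (simp add: disjoint_iff)
  qed
  {
    assume i: "c i < 0"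
    let ?X = "\<lambda>l j m. qbd_block K T c p \<alpha> S D 0 l (i, 0) (j, m) * V l j m"
    have "(\<Sum>j | c j < 0. ?X 0 j 0) = (\<Sum>j | c j < 0. T i j * f 0 j)"
      by (intro sum.cong) (auto simp: defs closing_op_ends)
    moreover have "(\<Sum>j\<in>UNIV. \<Sum>m<p. ?X l j m) = (if l = 1 then \<Sum>j | c j > 0. T i j * V 1 j 0 else 0)"
      if "l \<in> {1..K}" for l
    proof -
      have "(\<Sum>m<p. ?X l j m) = (\<Sum>m<p. if m = 0 then (if l = 1 \<and> c j > 0 then T i j * V 1 j 0 else 0) else 0)" for j
        using i that K_pos by (intro sum.cong) (auto simp: defs)
      then have "(\<Sum>m<p. ?X l j m) = (if l = 1 \<and> c j > 0 then T i j * V 1 j 0 else 0)" for j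
        using order_pos by simp
      then show ?thesis by (simp add: sum.If_cases)
    qed
    then have "(\<Sum>l\<in>{1..K}. \<Sum>j\<in>UNIV. \<Sum>m<p. ?X l j m) = (\<Sum>j | c j > 0. T i j * V 1 j 0)"
      using K_pos by simp
    moreover have "(\<Sum>j | c j > 0. ?X (K + 1) j 0) = 0"
      using K_pos by (intro sum.neutral) (auto simp: defs)
    ultimately show "qbd_row b K T c p \<alpha> S D f 0 i 0
      = (\<Sum>j\<in>UNIV. T i j * (if c j < 0 then f 0 j else V 1 j 0))"
      unfolding qbd_row_def qbd_index_sum split by simp
  next
    assume i: "c i > 0"
    let ?X = "\<lambda>l j m. qbd_block K T c p \<alpha> S D (Suc K) l (i, 0) (j, m) * V l j m"
    have "(\<Sum>j | c j > 0. ?X (K + 1) j 0) = (\<Sum>j | c j > 0. T i j * f b j)"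
      by (intro sum.cong) (auto simp: defs closing_op_ends)
    moreover have "(\<Sum>j\<in>UNIV. \<Sum>m<p. ?X l j m) = (if l = K then \<Sum>j | c j < 0. T i j * V K j 0 else 0)"
      if "l \<in> {1..K}" for l
    proof -
      have "(\<Sum>m<p. ?X l j m) = (\<Sum>m<p. if m = 0 then (if l = K \<and> c j < 0 then T i j * V K j 0 else 0) else 0)" for j
        using i that K_pos c_neq[of j] by (intro sum.cong) (auto simp: defs)
      then have "(\<Sum>m<p. ?X l j m) = (if l = K \<and> c j < 0 then T i j * V K j 0 else 0)" for j
        using order_pos by simp
      then show ?thesis by (simp add: sum.If_cases)
    qed
    then have "(\<Sum>l\<in>{1..K}. \<Sum>j\<in>UNIV. \<Sum>m<p. ?X l j m) = (\<Sum>j | c j < 0. T i j * V K j 0)"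
      using K_pos by simp
    moreover have "(\<Sum>j | c j < 0. ?X 0 j 0) = 0"
      using K_pos by (intro sum.neutral) (auto simp: defs)
    ultimately show "qbd_row b K T c p \<alpha> S D f (Suc K) i 0
      = (\<Sum>j\<in>UNIV. T i j * (if c j > 0 then f b j else V K j 0))"
      unfolding qbd_row_def qbd_index_sum split by simp
  }
qed

text \<open>
  The point at distance \<open>t n\<close> from the end at which phase \<open>i\<close> enters cell \<open>k\<close>.
\<close>

definition node_pt :: "nat \<Rightarrow> 's \<Rightarrow> nat \<Rightarrow> real" where
  "node_pt k i n = (if c i > 0 then y\<^sub>g k + t n else y\<^sub>g (Suc k) - t n)"

text \<open>
  A phase \<open>j\<close> that moves in the direction of \<open>i\<close> has the remaining distance \<open>\<Delta> - t n\<close> at this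
  point, a phase that moves in the opposite direction has the distance \<open>t n\<close>.
\<close>

lemma cell_pt_node:
  "(c i > 0) = (c j > 0) \<Longrightarrow> cell_pt k j (\<Delta> - t n) = node_pt k i n"
  "(c i > 0) \<noteq> (c j > 0) \<Longrightarrow> cell_pt k j (t n) = node_pt k i n"
  by (auto simp: cell_pt_def node_pt_def grid_Suc)

lemma t_cell: "n < p \<Longrightarrow> t n \<in> {0..\<Delta>}" "n < p \<Longrightarrow> \<Delta> - t n \<in> {0..\<Delta>}"
  using t_le[of n] t_nonneg[of n] eps_pos by auto

lemma \<kappa>_nonneg: "0 \<le> \<kappa>"
  using F_nonneg[of \<Delta>] F_cell cell_pos by simp

lemma closing_op_close:
  assumes "1 \<le> k" "k \<le> K" "n < p"
  shows "\<bar>V k j n - cell_fun k j (\<Delta> - t n)\<bar> \<le> 2 * L * \<epsilon>"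
  using folded_mean_close[OF t_nonneg[of n] t_le[of n] L_nonneg, of "cell_fun k j"] assms cell_fun_lip
  by (simp add: closing_op_eq)

lemma coupling_error:
  assumes k: "1 \<le> k" "k \<le> K" and n: "n < p"
  shows "\<bar>(if (c i > 0) = (c j > 0) then V k j n else \<Sum>m<p. D $$ (n, m) * V k j m) - f (node_pt k i n) j\<bar>
    \<le> L * (8 * \<epsilon> + 2 * \<Delta> * \<kappa>)"
proof (cases "(c i > 0) = (c j > 0)")
  case True
  have "2 * L * \<epsilon> \<le> L * (8 * \<epsilon> + 2 * \<Delta> * \<kappa>)"
    using L_nonneg eps_pos \<kappa>_nonneg cell_pos by (simp add: distrib_left)
  then show ?thesis
    using closing_op_close[OF assms, of j] True by (simp add: cell_fun_def cell_pt_node(1)[OF True])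
next
  case False
  have "(\<Sum>m<p. D $$ (n, m) * V k j m) = (\<Sum>m<p. D $$ (n, m) * folded_mean (cell_fun k j) (t m))"
    using k by (intro sum.cong) (auto simp: closing_op_eq)
  then show ?thesis
    using jump_average[OF t_nonneg[of n] t_le[of n] t_gap_0[of n] L_nonneg, of "cell_fun k j"] cell_fun_lip k n False
    by (simp add: jump_row_mean[OF n cell_fun_cont[OF k]] cell_fun_def cell_pt_node(2))
qed

text \<open>
  The start of the neighbouring cell is the end of cell \<open>k\<close>.
\<close>

lemma next_value_close:
  assumes k: "1 \<le> k" "k \<le> K"
  shows "\<bar>next_value k i - cell_fun k i 0\<bar> \<le> 2 * L * \<epsilon>"
proof -
  have nn: "0 \<le> 2 * L * \<epsilon>" using L_nonneg eps_pos by simp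
  show ?thesis
  proof (cases "c i > 0")
    case True
    then show ?thesis
      using closing_op_close[of "Suc k" 0 i] nn k order_pos grid_ends
      by (auto simp: next_value_def cell_fun_def cell_pt_def grid_Suc t_0 add.commute[of \<Delta>])
  next
    case False
    then show ?thesis
      using closing_op_close[of "k - 1" 0 i] nn k order_pos grid_ends grid_Suc[of "k - 1"]
      by (auto simp: next_value_def cell_fun_def cell_pt_def t_0)
  qed
qed

lemma U_deriv: "(U has_real_derivative U' x) (at x)"
  unfolding U_eq by (rule exp_poly_deriv)

text \<open>
  The constant 34 consists of 16 times the error 2 of \<open>next_value_close\<close> and of the error 2 of the
  signed average.
\<close>

lemma drift_error:
  assumes k: "1 \<le> k" "k \<le> K" and n: "n < p"
  shows "\<bar>((\<Sum>m<p. S $$ (n, m) * V k i m) + h (t n) / F (t n) * next_value k i) + cell_deriv k i (\<Delta> - t n)\<bar>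
    \<le> L * (34 * \<epsilon> + 4 * \<kappa>)"
proof -
  have "(\<Sum>m<p. S $$ (n, m) * V k i m) = (\<Sum>m<p. S $$ (n, m) * folded_mean (cell_fun k i) (t m))"
    using k by (intro sum.cong) (auto simp: closing_op_eq)
  then have "(\<Sum>m<p. S $$ (n, m) * V k i m) + h (t n) / F (t n) * next_value k i
      = (integral {0..\<Delta>} (\<lambda>z. (U' (z + t n) + U' (2 * \<Delta> - z + t n)) * cell_fun k i z)
        + h (t n) * next_value k i) / F (t n)"
    by (simp add: drift_row_mean[OF n cell_fun_cont[OF k]] add_divide_distrib)
  moreover have "\<bar>(integral {0..\<Delta>} (\<lambda>z. (U' (z + t n) + U' (2 * \<Delta> - z + t n)) * cell_fun k i z)
        + h (t n) * next_value k i) / F (t n) + cell_deriv k i (\<Delta> - t n)\<bar>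
      \<le> 16 * (2 * L * \<epsilon>) + 2 * L * \<epsilon> + 4 * L * \<kappa>"
    using n t_le t_nonneg
    by (intro drift_average U_deriv exp_poly_cont cell_fun_deriv cell_deriv_lip cell_deriv_bound
        L_nonneg next_value_close k) auto
  ultimately show ?thesis by (simp add: algebra_simps)
qed

definition size_of_rates :: "'s \<Rightarrow> real" where
  "size_of_rates i = (\<Sum>j\<in>UNIV. \<bar>T i j\<bar>) + \<bar>c i\<bar>"

definition error_bound :: real where
  "error_bound = L * (34 * \<epsilon> + (4 + 2 * \<Delta>) * \<kappa>)"

lemma weighted_error:
  assumes "\<And>j. \<bar>g j - g' j\<bar> \<le> e"
  shows "\<bar>(\<Sum>j\<in>UNIV. T i j * g j) - (\<Sum>j\<in>UNIV. T i j * g' j)\<bar> \<le> (\<Sum>j\<in>UNIV. \<bar>T i j\<bar>) * e"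
proof -
  have "(\<Sum>j\<in>UNIV. T i j * g j) - (\<Sum>j\<in>UNIV. T i j * g' j) = (\<Sum>j\<in>UNIV. T i j * (g j - g' j))"
    by (simp add: sum_subtractf right_diff_distrib)
  also have "\<bar>\<dots>\<bar> \<le> (\<Sum>j\<in>UNIV. \<bar>T i j\<bar> * e)"
    by (rule order_trans[OF sum_abs]) (auto intro!: sum_mono mult_left_mono assms simp: abs_mult)
  finally show ?thesis by (simp add: sum_distrib_right)
qed

text \<open>
  The generator of the fluid queue away from the regulated boundaries.
\<close>

definition interior_gen :: "real \<Rightarrow> 's \<Rightarrow> real" where
  "interior_gen x i = (\<Sum>j\<in>UNIV. T i j * f x j) + c i * dx b f x i"

lemma interior_row_error:
  assumes k: "1 \<le> k" "k \<le> K" and n: "n < p"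
  shows "\<bar>qbd_row b K T c p \<alpha> S D f k i n - interior_gen (node_pt k i n) i\<bar> \<le> size_of_rates i * error_bound"
proof -
  let ?N = "node_pt k i n"
  let ?d = "(\<Sum>m<p. S $$ (n, m) * V k i m) + h (t n) / F (t n) * next_value k i"
  let ?g = "\<lambda>j. if (c i > 0) = (c j > 0) then V k j n else \<Sum>m<p. D $$ (n, m) * V k j m"
  have "c i * dx b f ?N i = \<bar>c i\<bar> * (- cell_deriv k i (\<Delta> - t n))"
    using c_neq[of i] by (auto simp: cell_deriv_def cell_pt_node(1)[of i i])
  then have "\<bar>c i\<bar> * ?d - c i * dx b f ?N i = \<bar>c i\<bar> * (?d + cell_deriv k i (\<Delta> - t n))"
    by (simp only: right_diff_distrib[symmetric] diff_minus_eq_add)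
  then have "\<bar>\<bar>c i\<bar> * ?d - c i * dx b f ?N i\<bar> = \<bar>c i\<bar> * \<bar>?d + cell_deriv k i (\<Delta> - t n)\<bar>"
    by (simp only: abs_mult abs_abs)
  also have "\<dots> \<le> \<bar>c i\<bar> * (L * (34 * \<epsilon> + 4 * \<kappa>))"
    by (intro mult_left_mono drift_error assms) auto
  also have "\<dots> \<le> \<bar>c i\<bar> * error_bound"
    unfolding error_bound_def using L_nonneg \<kappa>_nonneg cell_pos
    by (intro mult_left_mono) (auto simp: algebra_simps)
  finally have 1: "\<bar>\<bar>c i\<bar> * ?d - c i * dx b f ?N i\<bar> \<le> \<bar>c i\<bar> * error_bound" .
  have "\<bar>(\<Sum>j\<in>UNIV. T i j * ?g j) - (\<Sum>j\<in>UNIV. T i j * f ?N j)\<bar>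
      \<le> (\<Sum>j\<in>UNIV. \<bar>T i j\<bar>) * (L * (8 * \<epsilon> + 2 * \<Delta> * \<kappa>))"
    by (intro weighted_error coupling_error assms)
  also have "\<dots> \<le> (\<Sum>j\<in>UNIV. \<bar>T i j\<bar>) * error_bound"
    unfolding error_bound_def using L_nonneg \<kappa>_nonneg cell_pos eps_pos
    by (intro mult_left_mono sum_nonneg) (auto simp: algebra_simps)
  finally have 2: "\<bar>(\<Sum>j\<in>UNIV. T i j * ?g j) - (\<Sum>j\<in>UNIV. T i j * f ?N j)\<bar> \<le> (\<Sum>j\<in>UNIV. \<bar>T i j\<bar>) * error_bound" .
  show ?thesis
    unfolding interior_row[OF assms] interior_gen_def size_of_rates_def distrib_right using 1 2 by linarith
qed

lemma boundary_row_error: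
  "c i < 0 \<Longrightarrow> \<bar>qbd_row b K T c p \<alpha> S D f 0 i 0 - (\<Sum>j\<in>UNIV. T i j * f 0 j)\<bar> \<le> size_of_rates i * error_bound"
  "c i > 0 \<Longrightarrow> \<bar>qbd_row b K T c p \<alpha> S D f (Suc K) i 0 - (\<Sum>j\<in>UNIV. T i j * f b j)\<bar> \<le> size_of_rates i * error_bound"
proof -
  have nn: "0 \<le> 2 * L * \<epsilon>" using L_nonneg eps_pos by simp
  have "0 \<le> (4 + 2 * \<Delta>) * \<kappa>" using \<kappa>_nonneg cell_pos by (intro mult_nonneg_nonneg) auto
  then have "L * (2 * \<epsilon>) \<le> error_bound"
    unfolding error_bound_def using L_nonneg eps_pos by (intro mult_left_mono) auto
  then have le: "(\<Sum>j\<in>UNIV. \<bar>T i j\<bar>) * (2 * L * \<epsilon>) \<le> size_of_rates i * error_bound"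
    unfolding size_of_rates_def using nn
    by (intro mult_mono) (auto simp: mult_ac intro!: add_nonneg_nonneg sum_nonneg)
  show "\<bar>qbd_row b K T c p \<alpha> S D f 0 i 0 - (\<Sum>j\<in>UNIV. T i j * f 0 j)\<bar> \<le> size_of_rates i * error_bound" if "c i < 0"
  proof (rule order_trans[OF _ le], unfold boundary_rows(1)[OF that], rule weighted_error)
    fix j show "\<bar>(if c j < 0 then f 0 j else V 1 j 0) - f 0 j\<bar> \<le> 2 * L * \<epsilon>"
      using closing_op_close[of 1 0 j] K_pos order_pos nn c_neq[of j] grid_ends grid_Suc[of 1]
      by (auto simp: cell_fun_def cell_pt_def t_0)
  qed
  show "\<bar>qbd_row b K T c p \<alpha> S D f (Suc K) i 0 - (\<Sum>j\<in>UNIV. T i j * f b j)\<bar> \<le> size_of_rates i * error_bound" if "c i > 0"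
  proof (rule order_trans[OF _ le], unfold boundary_rows(2)[OF that], rule weighted_error)
    fix j show "\<bar>(if c j > 0 then f b j else V K j 0) - f b j\<bar> \<le> 2 * L * \<epsilon>"
      using closing_op_close[of K 0 j] K_pos order_pos nn c_neq[of j] grid_ends grid_Suc[of K]
      by (auto simp: cell_fun_def cell_pt_def t_0)
  qed
qed

lemma interior_gen_modulus:
  assumes "x \<in> {0..b}" "y \<in> {0..b}"
  shows "\<bar>interior_gen x i - interior_gen y i\<bar> \<le> size_of_rates i * (L * \<bar>x - y\<bar>)"
proof -
  have "\<bar>c i * dx b f x i - c i * dx b f y i\<bar> \<le> \<bar>c i\<bar> * (L * \<bar>x - y\<bar>)"
    unfolding right_diff_distrib[symmetric] abs_mult by (intro mult_left_mono dx_lip assms) auto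
  moreover have "\<bar>(\<Sum>j\<in>UNIV. T i j * f x j) - (\<Sum>j\<in>UNIV. T i j * f y j)\<bar> \<le> (\<Sum>j\<in>UNIV. \<bar>T i j\<bar>) * (L * \<bar>x - y\<bar>)"
    by (intro weighted_error f_lip assms)
  ultimately show ?thesis unfolding interior_gen_def size_of_rates_def distrib_right by linarith
qed

lemma grid_mono: "y\<^sub>g (Suc m) \<le> y\<^sub>g (Suc (Suc m))"
  using grid_Suc[of "Suc m"] cell_pos by simp

lemma piece_exists:
  assumes x: "x \<in> {0..b}" "\<not> (x = 0 \<and> c i < 0)" "\<not> (x = b \<and> c i > 0)"
  shows "\<exists>k\<in>{1..K}. \<exists>n<p. x \<in> piece b K c t k i n"
proof (cases "c i > 0")
  case True
  then have "y\<^sub>g (Suc 0) \<le> x" "x < y\<^sub>g (Suc K)" using x grid_ends by auto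
  then obtain k where k: "k < K" "y\<^sub>g (Suc k) \<le> x" "x < y\<^sub>g (Suc (Suc k))"
    using interval_partition_exists(1)[of "\<lambda>m. y\<^sub>g (Suc m)" x K] by auto
  then have "t 0 \<le> x - y\<^sub>g (Suc k)" "x - y\<^sub>g (Suc k) < t p" by (auto simp: t_0 t_p grid_Suc)
  then obtain n where "n < p" "t n \<le> x - y\<^sub>g (Suc k)" "x - y\<^sub>g (Suc k) < t (Suc n)"
    using interval_partition_exists(1) by blast
  with k True show ?thesis by (intro bexI[of _ "Suc k"] exI[of _ n]) (auto simp: piece_def)
next
  case False
  then have "y\<^sub>g (Suc 0) < x" "x \<le> y\<^sub>g (Suc K)" using x grid_ends c_neq[of i] by auto
  then obtain k where k: "k < K" "y\<^sub>g (Suc k) < x" "x \<le> y\<^sub>g (Suc (Suc k))"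
    using interval_partition_exists(2)[of "\<lambda>m. y\<^sub>g (Suc m)" x K] by auto
  then have "t 0 \<le> y\<^sub>g (Suc (Suc k)) - x" "y\<^sub>g (Suc (Suc k)) - x < t p"
    by (auto simp: t_0 t_p grid_Suc[of "Suc k"])
  then obtain n where "n < p" "t n \<le> y\<^sub>g (Suc (Suc k)) - x" "y\<^sub>g (Suc (Suc k)) - x < t (Suc n)"
    using interval_partition_exists(1) by blast
  with k False show ?thesis by (intro bexI[of _ "Suc k"] exI[of _ n]) (auto simp: piece_def)
qed

lemma piece_bounds:
  assumes "x \<in> piece b K c t k i n" "n < p"
  shows "c i > 0 \<Longrightarrow> y\<^sub>g k \<le> x \<and> x < y\<^sub>g (Suc k) \<and> t n \<le> x - y\<^sub>g k \<and> x - y\<^sub>g k < t (Suc n)"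
    and "\<not> c i > 0 \<Longrightarrow> y\<^sub>g k < x \<and> x \<le> y\<^sub>g (Suc k) \<and> t n \<le> y\<^sub>g (Suc k) - x \<and> y\<^sub>g (Suc k) - x < t (Suc n)"
  using assms t_nonneg[of n] steps_mono[of p t "Suc n" p] t_less
  by (auto simp: piece_def grid_Suc t_p less_imp_le)

lemma piece_unique:
  assumes "x \<in> piece b K c t k i n" "x \<in> piece b K c t k' i n'" "k \<in> {1..K}" "k' \<in> {1..K}" "n < p" "n' < p"
  shows "k = k' \<and> n = n'"
proof -
  obtain m m' where m: "k = Suc m" "k' = Suc m'" "m < K" "m' < K"
    using assms(3,4) by (metis Suc_le_D Suc_le_lessD atLeastAtMost_iff One_nat_def)
  note b = piece_bounds[OF assms(1,5)] piece_bounds[OF assms(2,6)]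
  have "m = m'"
    using b m by (intro interval_partition_unique[of K "\<lambda>m. y\<^sub>g (Suc m)" m m' x] grid_mono) auto
  then have "k = k'" using m by simp
  moreover have "n = n'"
    using b \<open>k = k'\<close> t_less assms(5,6)
    by (intro interval_partition_unique[of p t n n' "if c i > 0 then x - y\<^sub>g k else y\<^sub>g (Suc k) - x"])
       (auto intro: less_imp_le)
  ultimately show ?thesis ..
qed

text \<open>
  Every point lies in exactly one piece, within the mesh width of the node at which the row of that
  piece approximates the generator.
\<close>

theorem qbd_apply_error:
  assumes x: "x \<in> {0..b}"
  shows "\<bar>qbd_apply b K T c p t \<alpha> S D f x i - fluid_gen b T c f x i\<bar>
    \<le> size_of_rates i * (error_bound + L * \<gamma>)"
proof -
  have R: "0 \<le> size_of_rates i" by (simp add: size_of_rates_def sum_nonneg)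
  have "0 \<le> \<gamma>" using mesh[OF order_pos] t_less[OF order_pos] by simp
  then have widen: "e \<le> size_of_rates i * (error_bound + L * \<gamma>)" if "e \<le> size_of_rates i * error_bound" for e
    using that R L_nonneg by (auto simp: distrib_left intro: order_trans)
  consider "x = 0" "c i < 0" | "x = b" "c i > 0" | "\<not> (x = 0 \<and> c i < 0)" "\<not> (x = b \<and> c i > 0)" by blast
  then show ?thesis
  proof cases
    case 1
    then show ?thesis using boundary_row_error(1)[of i] by (intro widen) (simp add: qbd_apply_def fluid_gen_def)
  next
    case 2
    then show ?thesis using boundary_row_error(2)[of i] b_pos
      by (intro widen) (simp add: qbd_apply_def fluid_gen_def)
  next
    case 3
    obtain k n where kn: "k \<in> {1..K}" "n < p" "x \<in> piece b K c t k i n"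
      using piece_exists[OF x 3] by blast
    have "(THE r. \<exists>k\<in>{1..K}. \<exists>n<p. x \<in> piece b K c t k i n \<and> r = qbd_row b K T c p \<alpha> S D f k i n)
        = qbd_row b K T c p \<alpha> S D f k i n"
      using kn piece_unique by (intro the_equality) blast+
    then have row: "qbd_apply b K T c p t \<alpha> S D f x i = qbd_row b K T c p \<alpha> S D f k i n"
      using 3 by (auto simp: qbd_apply_def)
    have gen: "fluid_gen b T c f x i = interior_gen x i" using 3 by (auto simp: fluid_gen_def interior_gen_def)
    have N: "node_pt k i n \<in> {0..b}"
      using cell_pt_range[of k "\<Delta> - t n" i] t_cell[OF kn(2)] kn(1) by (simp add: cell_pt_node(1)[of i i])
    have "\<bar>node_pt k i n - x\<bar> \<le> \<gamma>"
      using piece_bounds[OF kn(3,2)] mesh[OF kn(2)] by (auto simp: node_pt_def)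
    then have "\<bar>interior_gen (node_pt k i n) i - interior_gen x i\<bar> \<le> size_of_rates i * (L * \<gamma>)"
      using interior_gen_modulus[OF N x, of i] R L_nonneg
      by (meson mult_left_mono order_trans)
    then show ?thesis
      using interior_row_error[of k n i] kn unfolding row gen distrib_left by fastforce
  qed
qed

end

section \<open>Mixtures of two Erlang laws\<close>

text \<open>
  The law on the half-line with a given smooth survival function.
\<close>

locale survival_law =
  fixes F f :: "real \<Rightarrow> real"
  assumes F_deriv: "(F has_real_derivative - f x) (at x)"
    and f_cont: "continuous_on UNIV f"
    and f_nonneg: "0 \<le> x \<Longrightarrow> 0 \<le> f x"
    and F_lim: "(F \<longlongrightarrow> 0) at_top"
    and F_0: "F 0 = 1"
begin

definition dens :: "real \<Rightarrow> real" where "dens x = (if 0 \<le> x then f x else 0)"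

definition law :: "real measure" where "law = density lborel (\<lambda>x. ennreal (dens x))"

text \<open>
  The variable has to be nonnegative everywhere, whereas the law lives on the whole line with a null
  set of negative numbers.
\<close>

definition Z :: "real \<Rightarrow> real" where "Z \<omega> = max 0 \<omega>"

lemma dens_nonneg: "0 \<le> dens x" by (simp add: dens_def f_nonneg)

lemma dens_measurable [measurable]: "dens \<in> borel_measurable borel"
proof -
  have "f \<in> borel_measurable borel" by (rule borel_measurable_continuous_onI[OF f_cont])
  then show ?thesis unfolding dens_def[abs_def] by measurable
qed

lemma pos_measurable [measurable]: "Z \<in> borel_measurable borel"
  unfolding Z_def[abs_def] by measurable

lemma space_law [simp]: "space law = UNIV" and sets_law [simp, measurable_cong]: "sets law = sets borel"
  by (simp_all add: law_def)

lemma emeasure_tail: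
  assumes "0 \<le> x" shows "emeasure law {x..} = ennreal (F x)"
proof -
  have "emeasure law {x..} = (\<integral>\<^sup>+y. ennreal (dens y) * indicator {x..} y \<partial>lborel)"
    unfolding law_def by (intro emeasure_density) auto
  also have "\<dots> = (\<integral>\<^sup>+y. ennreal (f y) * indicator {x..} y \<partial>lborel)"
    using assms by (intro nn_integral_cong) (auto simp: dens_def split: split_indicator)
  also have "\<dots> = ennreal (F x)"
    using assms by (intro tail_integral(2) f_cont F_deriv F_lim f_nonneg) auto
  finally show ?thesis .
qed

lemma emeasure_point: "emeasure law {x} = 0"
proof -
  have "emeasure law {x} = (\<integral>\<^sup>+y. ennreal (dens y) * indicator {x} y \<partial>lborel)"
    unfolding law_def by (intro emeasure_density) auto
  also have "\<dots> = 0" by (intro nn_integral_null_set finite_imp_null_set_lborel) simp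
  finally show ?thesis .
qed

lemma AE_law_pos: "AE x in law. 0 \<le> x"
  unfolding law_def by (subst AE_density, measurable) (auto simp: dens_def)

lemma emeasure_UNIV: "emeasure law UNIV = 1"
proof -
  have "emeasure law UNIV = emeasure law {0..}"
    using AE_law_pos by (intro emeasure_eq_AE) auto
  then show ?thesis by (simp add: emeasure_tail F_0)
qed

sublocale prob_space law
  by (rule prob_spaceI) (simp add: emeasure_UNIV)

lemma prob_point: "prob {x} = 0"
  by (simp add: measure_def emeasure_point)

lemma F_nonneg: "0 \<le> x \<Longrightarrow> 0 \<le> F x"
  using tail_integral(1)[of f x F] f_cont f_nonneg F_deriv F_lim by simp

lemma prob_tail: "0 \<le> x \<Longrightarrow> prob {x..} = F x" "0 \<le> x \<Longrightarrow> prob {x<..} = F x"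
proof -
  assume x: "0 \<le> x"
  show *: "prob {x..} = F x" using emeasure_tail[OF x] F_nonneg[OF x] by (simp add: measure_def)
  have "{x..} = {x} \<union> {x<..}" by auto
  then have "prob {x..} = prob {x} + prob {x<..}"
    using finite_measure_Union[of "{x}" "{x<..}"] by simp
  then show "prob {x<..} = F x" using * prob_point by simp
qed

lemma prob_pos_gt: "0 \<le> x \<Longrightarrow> \<P>(\<omega> in law. Z \<omega> > x) = F x"
proof -
  assume "0 \<le> x"
  then have "{\<omega> \<in> space law. Z \<omega> > x} = {x<..}" by (auto simp: Z_def)
  then show ?thesis using prob_tail(2)[OF \<open>0 \<le> x\<close>] by simp
qed

lemma prob_pos_0: "\<P>(\<omega> in law. Z \<omega> = 0) = 0"
proof -
  have "{\<omega> \<in> space law. Z \<omega> = 0} = - {0<..}" by (auto simp: Z_def)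
  then show ?thesis using prob_compl[of "{0<..}"] prob_tail(2)[of 0] F_0 by (simp add: Compl_eq_Diff_UNIV)
qed

lemma residual_life:
  assumes "0 \<le> x" "0 \<le> t"
  shows "\<P>(\<omega> in law. Z \<omega> - t \<ge> x \<bar> Z \<omega> > t) = F (x + t) / F t"
proof -
  have "{\<omega> \<in> space law. Z \<omega> - t \<ge> x \<and> Z \<omega> > t} = (if x = 0 then {t<..} else {x + t..})"
    using assms by (auto simp: Z_def)
  then have "\<P>(\<omega> in law. Z \<omega> - t \<ge> x \<and> Z \<omega> > t) = F (x + t)"
    using prob_tail[of t] prob_tail[of "x + t"] assms by auto
  then show ?thesis using prob_pos_gt[OF assms(2)] by (simp add: cond_prob_def)
qed

lemma distributed_pos: "distributed law lborel Z (\<lambda>x. ennreal (dens x))"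
proof -
  have "distr law lborel Z = distr law lborel (\<lambda>x. x)"
    using AE_law_pos by (intro distr_cong_AE) (auto simp: Z_def elim: eventually_mono)
  also have "\<dots> = density lborel (\<lambda>x. ennreal (dens x))"
    using distr_id2[of lborel law] by (simp add: law_def)
  finally show ?thesis by (auto simp: distributed_def)
qed

lemma integral_pos:
  assumes [measurable]: "g \<in> borel_measurable borel" and g: "has_bochner_integral lborel (\<lambda>x. dens x * g x) a"
  shows "integrable law (\<lambda>\<omega>. g (Z \<omega>))" "expectation (\<lambda>\<omega>. g (Z \<omega>)) = a"
proof -
  have eq: "(\<lambda>x. dens x * g (Z x)) = (\<lambda>x. dens x * g x)" by (auto simp: dens_def Z_def)
  have "integrable law (\<lambda>\<omega>. g (Z \<omega>)) \<longleftrightarrow> integrable lborel (\<lambda>x. dens x *\<^sub>R g (Z x))"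
    unfolding law_def by (intro integrable_density) (auto simp: dens_nonneg)
  then show "integrable law (\<lambda>\<omega>. g (Z \<omega>))"
    using g by (simp add: eq has_bochner_integral_iff)
  have "expectation (\<lambda>\<omega>. g (Z \<omega>)) = integral\<^sup>L lborel (\<lambda>x. dens x *\<^sub>R g (Z x))"
    unfolding law_def by (intro integral_density) (auto simp: dens_nonneg)
  then show "expectation (\<lambda>\<omega>. g (Z \<omega>)) = a"
    using g by (simp add: eq has_bochner_integral_iff)
qed

lemma moments:
  assumes m1: "has_bochner_integral lborel (\<lambda>x. dens x * x) \<mu>"
    and m2: "has_bochner_integral lborel (\<lambda>x. dens x * x\<^sup>2) s"
  shows "integrable law (\<lambda>\<omega>. (Z \<omega>)\<^sup>2)" "expectation Z = \<mu>" "variance Z = s - \<mu>\<^sup>2"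
    and "0 \<le> A \<Longrightarrow> integral {0..A} (\<lambda>z. f z * (z - \<mu>)\<^sup>2) \<le> s - \<mu>\<^sup>2"
proof -
  note i1 = integral_pos[OF _ m1] and i2 = integral_pos[OF _ m2]
  show sq: "integrable law (\<lambda>\<omega>. (Z \<omega>)\<^sup>2)" using i2 by simp
  show e: "expectation Z = \<mu>" using i1 by simp
  have "integrable law Z" using i1 by simp
  then show "variance Z = s - \<mu>\<^sup>2" using variance_eq[of Z] sq i2 e by simp
  have "has_bochner_integral lborel (\<lambda>x. dens x * 1) 1"
    using dens_nonneg emeasure_UNIV unfolding law_def
    by (intro has_bochner_integral_nn_integral) (auto simp: emeasure_density)
  from has_bochner_integral_add[OF has_bochner_integral_diff[OF m2 has_bochner_integral_mult_right[OF m1, of "2 * \<mu>"]]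
      has_bochner_integral_mult_right[OF this, of "\<mu>\<^sup>2"]]
  have full: "has_bochner_integral lborel (\<lambda>x. dens x * (x - \<mu>)\<^sup>2) (s - \<mu>\<^sup>2)"
    by (simp add: power2_eq_square algebra_simps)
  assume "0 \<le> A"
  have c: "continuous_on {0..A} (\<lambda>z. f z * (z - \<mu>)\<^sup>2)"
    by (intro continuous_intros continuous_on_subset[OF f_cont]) auto
  have int: "set_integrable lborel {0..A} (\<lambda>z. f z * (z - \<mu>)\<^sup>2)" by (rule borel_integrable_atLeastAtMost'[OF c])
  have "integral {0..A} (\<lambda>z. f z * (z - \<mu>)\<^sup>2) = (LBINT z:{0..A}. f z * (z - \<mu>)\<^sup>2)"
    using set_borel_integral_eq_integral(2)[OF int] by simp
  also have "\<dots> \<le> (\<integral>x. dens x * (x - \<mu>)\<^sup>2 \<partial>lborel)"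
    unfolding set_lebesgue_integral_def
    using int full f_nonneg unfolding set_integrable_def
    by (intro integral_mono) (auto simp: has_bochner_integral_iff dens_def split: split_indicator)
  also have "\<dots> = s - \<mu>\<^sup>2" using full by (simp add: has_bochner_integral_iff)
  finally show "integral {0..A} (\<lambda>z. f z * (z - \<mu>)\<^sup>2) \<le> s - \<mu>\<^sup>2" .
qed

end

lemma erlang_moment:
  assumes "0 < \<theta>"
  shows "has_bochner_integral lborel (\<lambda>x. erlang_density k \<theta> x * x ^ i) (fact (k + i) / (fact k * \<theta> ^ i))"
proof (rule has_bochner_integral_nn_integral)
  show "AE x in lborel. 0 \<le> erlang_density k \<theta> x * x ^ i"
    using assms by (auto simp: erlang_density_def)
qed (use assms in \<open>auto simp: nn_integral_erlang_ith_moment\<close>)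

lemma exp_mono_mono_on:
  assumes "0 < \<theta>"
  shows "mono_on {0..real k / \<theta>} (exp_mono \<theta> k)"
proof (rule mono_onI)
  fix x y assume xy: "x \<in> {0..real k / \<theta>}" "y \<in> {0..real k / \<theta>}" "x \<le> y"
  show "exp_mono \<theta> k x \<le> exp_mono \<theta> k y"
  proof (cases k)
    case 0
    then show ?thesis using xy by simp
  next
    case (Suc i)
    show ?thesis
    proof (rule DERIV_nonneg_imp_nondecreasing[OF xy(3)])
      fix z assume z: "x \<le> z" "z \<le> y"
      have "\<theta> * z \<le> \<theta> * y" using z assms by (intro mult_left_mono) auto
      moreover have "\<theta> * y \<le> real k" using xy assms by (simp add: field_simps)
      ultimately have z': "0 \<le> z" "\<theta> * z \<le> real k" using z xy by auto
      have "\<theta> * exp_mono \<theta> k z = exp_mono \<theta> i z * (\<theta> * z / real k)"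
        by (simp add: exp_mono_def Suc field_simps)
      also have "\<dots> \<le> exp_mono \<theta> i z * 1"
        using z' Suc by (intro mult_left_mono) (auto simp: exp_mono_def field_simps)
      finally show "\<exists>d. (exp_mono \<theta> k has_real_derivative d) (at z) \<and> 0 \<le> d"
        using exp_mono_deriv[of \<theta> k z] Suc by (intro exI conjI) auto
    qed
  qed
qed

text \<open>
  The mixture with weights \<open>1 - w\<close> and \<open>w\<close> of the Erlang laws of rate \<open>\<theta>\<close> with \<open>m\<close> and \<open>2 m\<close>
  stages. The common rate makes the survival function an exponential polynomial with \<open>2 m\<close>
  coefficients, the last of which is nonzero.
\<close>

locale erlang_mixture =
  fixes \<theta> :: real and m :: nat and w :: real
  assumes rate_pos: "0 < \<theta>" and m_pos: "0 < m" and w: "0 < w" "w < 1"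
begin

abbreviation stages :: nat where "stages \<equiv> 2 * m"

definition surv_coeff :: "nat \<Rightarrow> real" where
  "surv_coeff j = \<theta> ^ j * ((if j < m then 1 - w else 0) + w)"

abbreviation Fm :: "real \<Rightarrow> real" where "Fm \<equiv> exp_poly \<theta> stages surv_coeff"

abbreviation fm :: "real \<Rightarrow> real" where "fm \<equiv> exp_poly \<theta> stages (\<lambda>j. - exp_poly_deriv \<theta> stages surv_coeff j)"

text \<open>
  The derivative of the survival function telescopes; only the indices at which the coefficients drop
  remain.
\<close>

lemma fm_eq: "fm x = (1 - w) * (\<theta> ^ m * exp_mono \<theta> (m - 1) x) + w * (\<theta> ^ stages * exp_mono \<theta> (stages - 1) x)"
proof -
  have "- exp_poly_deriv \<theta> stages surv_coeff j
      = (if j = m - 1 then \<theta> ^ m * (1 - w) else 0) + (if j = stages - 1 then \<theta> ^ stages * w else 0)" if "j < stages" for j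
  proof -
    have "Suc j = m \<longleftrightarrow> j = m - 1" "Suc j = stages \<longleftrightarrow> j = stages - 1" "Suc j < m \<longleftrightarrow> j < m - 1" "j < m \<longleftrightarrow> j < m - 1 \<or> j = m - 1"
      "Suc j < stages \<longleftrightarrow> j \<noteq> stages - 1" "m - 1 \<noteq> stages - 1"
      using m_pos that by auto
    moreover have "\<theta> ^ m = \<theta> * \<theta> ^ (m - 1)" "\<theta> ^ stages = \<theta> * \<theta> ^ (stages - 1)"
      using m_pos by (auto simp: power_Suc[symmetric] simp del: power_Suc)
    ultimately show ?thesis
      by (auto simp: exp_poly_deriv_def surv_coeff_def algebra_simps)
  qed
  then have "fm x = (\<Sum>j<stages. ((if j = m - 1 then \<theta> ^ m * (1 - w) else 0)
      + (if j = stages - 1 then \<theta> ^ stages * w else 0)) * exp_mono \<theta> j x)"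
    unfolding exp_poly_def by (intro sum.cong) auto
  also have "\<dots> = (\<Sum>j<stages. if j = m - 1 then \<theta> ^ m * (1 - w) * exp_mono \<theta> j x else 0)
      + (\<Sum>j<stages. if j = stages - 1 then \<theta> ^ stages * w * exp_mono \<theta> j x else 0)"
    unfolding sum.distrib[symmetric] by (intro sum.cong) (auto simp: distrib_right)
  finally show ?thesis using m_pos by simp
qed

lemma exp_mono_nonneg: "0 \<le> x \<Longrightarrow> 0 \<le> exp_mono \<theta> k x"
  by (simp add: exp_mono_def)

lemma Fm_pos: assumes "0 \<le> x" shows "0 < Fm x"
proof -
  have "0 \<le> surv_coeff j" for j using rate_pos w by (auto simp: surv_coeff_def)
  then have "0 \<le> surv_coeff j * exp_mono \<theta> j x" for j using exp_mono_nonneg[OF assms] by simp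
  moreover have "0 < surv_coeff 0 * exp_mono \<theta> 0 x" using m_pos by (simp add: surv_coeff_def exp_mono_def)
  ultimately show ?thesis unfolding exp_poly_def using m_pos by (intro sum_pos2[of _ 0]) auto
qed

lemma Fm_deriv: "(Fm has_real_derivative - fm x) (at x)"
  using exp_poly_deriv[of \<theta> stages surv_coeff x] by (simp add: exp_poly_def sum_negf)

sublocale survival_law Fm fm
proof
  show "(Fm has_real_derivative - fm x) (at x)" for x by (rule Fm_deriv)
  show "continuous_on UNIV fm" by (rule exp_poly_cont)
  show "0 \<le> fm x" if "0 \<le> x" for x
    using exp_mono_nonneg[OF that] w rate_pos by (simp add: fm_eq)
  show "(Fm \<longlongrightarrow> 0) at_top" by (rule exp_poly_lim[OF rate_pos])
  have "Fm 0 = (\<Sum>j<stages. if j = 0 then 1 else 0)"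
    unfolding exp_poly_def using m_pos by (intro sum.cong) (auto simp: surv_coeff_def exp_mono_def)
  then show "Fm 0 = 1" using m_pos by simp
qed

lemma dens_eq: "dens x = (1 - w) * erlang_density (m - 1) \<theta> x + w * erlang_density (stages - 1) \<theta> x"
  unfolding dens_def fm_eq erlang_density_def exp_mono_def using m_pos by (simp add: mult_ac)

lemma dens_moment:
  "has_bochner_integral lborel (\<lambda>x. dens x * x ^ i)
    ((1 - w) * (fact (m - 1 + i) / (fact (m - 1) * \<theta> ^ i)) + w * (fact (stages - 1 + i) / (fact (stages - 1) * \<theta> ^ i)))"
  using has_bochner_integral_add[OF has_bochner_integral_mult_right[OF erlang_moment[OF rate_pos, of "m - 1" i], of "1 - w"]
      has_bochner_integral_mult_right[OF erlang_moment[OF rate_pos, of "stages - 1" i], of w]]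
  by (simp add: dens_eq distrib_right mult.assoc)

lemma fact_ratio:
  assumes "0 < k"
  shows "fact (k - 1 + 1) = fact (k - 1) * real k" "fact (k - 1 + 2) = fact (k - 1) * (real k * (real k + 1))"
  using assms by (cases k; simp add: algebra_simps)+

lemma mean_eq: "has_bochner_integral lborel (\<lambda>x. dens x * x) ((1 + w) * real m / \<theta>)"
proof -
  have "(1 - w) * (fact (m - 1 + 1) / (fact (m - 1) * \<theta> ^ 1)) + w * (fact (stages - 1 + 1) / (fact (stages - 1) * \<theta> ^ 1))
      = (1 + w) * real m / \<theta>"
    using m_pos fact_ratio(1)[of stages] unfolding fact_ratio[OF m_pos]
    by (simp add: add_divide_distrib[symmetric] algebra_simps del: fact_Suc)
  then show ?thesis using dens_moment[of 1] by simp
qed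

lemma square_eq: "has_bochner_integral lborel (\<lambda>x. dens x * x\<^sup>2)
    (((1 - w) * (real m * (real m + 1)) + w * (2 * real m * (2 * real m + 1))) / \<theta>\<^sup>2)"
proof -
  have "(1 - w) * (fact (m - 1 + 2) / (fact (m - 1) * \<theta> ^ 2)) + w * (fact (stages - 1 + 2) / (fact (stages - 1) * \<theta> ^ 2))
      = ((1 - w) * (real m * (real m + 1)) + w * (2 * real m * (2 * real m + 1))) / \<theta>\<^sup>2"
    using m_pos fact_ratio(2)[of stages] unfolding fact_ratio[OF m_pos]
    by (simp add: add_divide_distrib del: fact_Suc)
  then show ?thesis using dens_moment[of 2] by simp
qed

text \<open>
  The interval ends at the mode of the component with fewer stages.
\<close>

lemma density_increasing: "mono_on {0..(real m - 1) / \<theta>} fm"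
proof -
  have "mono_on {0..(real m - 1) / \<theta>} (exp_mono \<theta> k)" if "m - 1 \<le> k" for k
  proof (rule mono_on_subset[OF exp_mono_mono_on[OF rate_pos]])
    have "real m - 1 \<le> real k" using that by linarith
    then show "{0..(real m - 1) / \<theta>} \<subseteq> {0..real k / \<theta>}"
      using rate_pos by (auto intro: order_trans divide_right_mono)
  qed
  from this[of "m - 1"] this[of "stages - 1"] show ?thesis
    unfolding fm_eq[abs_def] mono_on_def using w rate_pos
    by (auto intro!: add_mono mult_left_mono)
qed

text \<open>
  Chebyshev's inequality for the component with \<open>m\<close> stages, and the trivial bound for the other.
\<close>

lemma tail_bound:
  assumes "real m / \<theta> < a"
  shows "Fm a \<le> w + (real m / \<theta>\<^sup>2) / (a - real m / \<theta>)\<^sup>2"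
proof -
  let ?\<mu> = "real m / \<theta>"
  let ?e = "erlang_density (m - 1) \<theta>" and ?e2 = "erlang_density (stages - 1) \<theta>"
  have a: "0 \<le> a" using assms rate_pos m_pos by (smt (verit) divide_nonneg_pos of_nat_0_le_iff)
  have mom: "has_bochner_integral lborel ?e 1" "has_bochner_integral lborel (\<lambda>x. ?e x * x) ?\<mu>"
    "has_bochner_integral lborel (\<lambda>x. ?e x * x\<^sup>2) (real m * (real m + 1) / \<theta>\<^sup>2)"
    "has_bochner_integral lborel ?e2 1"
    using erlang_moment[OF rate_pos, of "m - 1" 0] erlang_moment[OF rate_pos, of "m - 1" 1]
      erlang_moment[OF rate_pos, of "m - 1" 2] erlang_moment[OF rate_pos, of "stages - 1" 0]
    unfolding fact_ratio[OF m_pos] by simp_all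
  have "has_bochner_integral lborel (\<lambda>x. ?e x * x\<^sup>2 - 2 * ?\<mu> * (?e x * x) + ?\<mu>\<^sup>2 * ?e x)
      (real m * (real m + 1) / \<theta>\<^sup>2 - 2 * ?\<mu> * ?\<mu> + ?\<mu>\<^sup>2 * 1)"
    by (intro has_bochner_integral_add has_bochner_integral_diff has_bochner_integral_mult_right mom)
  moreover have "real m * (real m + 1) / \<theta>\<^sup>2 - 2 * ?\<mu> * ?\<mu> + ?\<mu>\<^sup>2 * 1 = real m / \<theta>\<^sup>2"
    using rate_pos by (simp add: power2_eq_square field_simps)
  moreover have "(\<lambda>x. ?e x * x\<^sup>2 - 2 * ?\<mu> * (?e x * x) + ?\<mu>\<^sup>2 * ?e x) = (\<lambda>x. ?e x * (x - ?\<mu>)\<^sup>2)"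
    by (simp add: fun_eq_iff power2_eq_square algebra_simps)
  ultimately have var: "has_bochner_integral lborel (\<lambda>x. ?e x * (x - ?\<mu>)\<^sup>2) (real m / \<theta>\<^sup>2)"
    by simp
  let ?g = "\<lambda>x. ?e x * (x - ?\<mu>)\<^sup>2 / (a - ?\<mu>)\<^sup>2 + w * ?e2 x"
  have g: "has_bochner_integral lborel ?g ((real m / \<theta>\<^sup>2) / (a - ?\<mu>)\<^sup>2 + w * 1)"
    using assms by (intro has_bochner_integral_add has_bochner_integral_divide has_bochner_integral_mult_right var mom)
  have "Fm a = prob {a..}" using prob_tail(1)[OF a] by simp
  also have "ennreal \<dots> = (\<integral>\<^sup>+x. ennreal (dens x) * indicator {a..} x \<partial>lborel)"
    unfolding emeasure_eq_measure[symmetric] by (subst law_def, subst emeasure_density) auto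
  also have "\<dots> \<le> (\<integral>\<^sup>+x. ennreal (?g x) \<partial>lborel)"
  proof (intro nn_integral_mono)
    fix x
    have e0: "0 \<le> ?e x" "0 \<le> ?e2 x" using rate_pos by simp_all
    then have g0: "0 \<le> ?g x" using w by simp
    have "dens x \<le> ?g x" if "a \<le> x"
    proof -
      have "(a - ?\<mu>)\<^sup>2 \<le> (x - ?\<mu>)\<^sup>2" using that assms by (intro power_mono) auto
      then have "1 \<le> (x - ?\<mu>)\<^sup>2 / (a - ?\<mu>)\<^sup>2" using assms by (simp add: le_divide_eq)
      then have "?e x * 1 \<le> ?e x * ((x - ?\<mu>)\<^sup>2 / (a - ?\<mu>)\<^sup>2)" using e0 by (intro mult_left_mono) auto
      moreover have "(1 - w) * ?e x \<le> ?e x" using e0 w by (simp add: mult_left_le_one_le)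
      ultimately show ?thesis unfolding dens_eq by simp
    qed
    then show "ennreal (dens x) * indicator {a..} x \<le> ennreal (?g x)"
      using g0 by (auto split: split_indicator intro: ennreal_leI)
  qed
  also have "\<dots> = ennreal ((real m / \<theta>\<^sup>2) / (a - ?\<mu>)\<^sup>2 + w * 1)"
    using g w rate_pos
    by (subst nn_integral_eq_integral) (auto simp: has_bochner_integral_iff)
  finally have "ennreal (Fm a) \<le> ennreal ((real m / \<theta>\<^sup>2) / (a - ?\<mu>)\<^sup>2 + w * 1)" .
  then show ?thesis using w rate_pos by (subst (asm) ennreal_le_iff) (auto intro!: add_nonneg_nonneg)
qed

end

section \<open>Approximation in the graph norm by Lipschitz derivatives\<close>

lemma dx_works:
  assumes "(\<lambda>y. f y i) differentiable_on {0..b}" "x \<in> {0..b}"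
  shows "((\<lambda>y. f y i) has_real_derivative dx b f x i) (at x within {0..b})"
  using assms unfolding dx_def has_real_derivative_iff_has_vector_derivative differentiable_on_def
  by (simp add: vector_derivative_works)

lemma dx_eqI:
  assumes "0 < b" "x \<in> {0..b}" "((\<lambda>y. f y i) has_real_derivative d) (at x within {0..b})"
  shows "dx b f x i = d"
  using assms unfolding dx_def has_real_derivative_iff_has_vector_derivative
  by (intro vector_derivative_within_closed_interval) auto

lemma sup_norm_less:
  assumes "0 \<le> b" "\<And>x i. x \<in> {0..b} \<Longrightarrow> \<bar>g x i\<bar> \<le> e" "e < \<eta>"
  shows "sup_norm b g < \<eta>"
proof -
  have "sup_norm b g \<le> e"
    unfolding sup_norm_def using assms(1,2) by (intro cSUP_least) auto
  with assms(3) show ?thesis by simp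
qed

lemma lipschitz_C1_subset_dom:
  assumes "0 < b" shows "lipschitz_C1 b \<subseteq> fluid_dom b"
proof
  fix f :: "real \<Rightarrow> 's::finite \<Rightarrow> real" assume f: "f \<in> lipschitz_C1 b"
  then obtain G L where d: "\<And>j. (\<lambda>x. f x j) differentiable_on {0..b}"
    and L: "\<And>j x y. x \<in> {0..b} \<Longrightarrow> y \<in> {0..b} \<Longrightarrow> \<bar>dx b f x j - dx b f y j\<bar> \<le> L * \<bar>x - y\<bar>"
    unfolding lipschitz_C1_def by blast
  have "\<exists>G. \<forall>x\<in>{0..b}. \<bar>f x i\<bar> \<le> G" for i
  proof -
    have "compact ((\<lambda>x. f x i) ` {0..b})"
      by (intro compact_continuous_image differentiable_imp_continuous_on d) simp
    then show ?thesis by (force dest: compact_imp_bounded simp: bounded_iff)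
  qed
  then obtain G where G: "\<And>i x. x \<in> {0..b} \<Longrightarrow> \<bar>f x i\<bar> \<le> G i" by metis
  have "\<bar>f x i\<bar> \<le> (\<Sum>j\<in>UNIV. \<bar>G j\<bar>)" if "x \<in> {0..b}" for x i
    using G[OF that, of i] member_le_sum[of i UNIV "\<lambda>j. \<bar>G j\<bar>"] by simp
  moreover have "continuous_on {0..b} (\<lambda>x. dx b f x i)" for i
    using L by (rule lipschitz_cont)
  ultimately show "f \<in> fluid_dom b" unfolding fluid_dom_def using d by blast
qed

text \<open>
  A polynomial is close to the derivative of \<open>g\<close>, and \<open>h\<close> is its primitive that agrees with \<open>g\<close> at 0.
\<close>

lemma polynomial_C1_approximation:
  fixes g :: "real \<Rightarrow> real"
  assumes "0 < b" "0 < e" and g': "\<And>x. x \<in> {0..b} \<Longrightarrow> (g has_real_derivative g' x) (at x within {0..b})"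
    and "continuous_on {0..b} g'"
  obtains h h' B where "\<And>x. x \<in> {0..b} \<Longrightarrow> (h has_real_derivative h' x) (at x within {0..b})"
    "\<And>x. x \<in> {0..b} \<Longrightarrow> \<bar>g x - h x\<bar> \<le> e * b" "\<And>x. x \<in> {0..b} \<Longrightarrow> \<bar>g' x - h' x\<bar> \<le> e"
    "\<And>x. x \<in> {0..b} \<Longrightarrow> \<bar>h' x\<bar> \<le> B"
    "\<And>x y. x \<in> {0..b} \<Longrightarrow> y \<in> {0..b} \<Longrightarrow> \<bar>h' x - h' y\<bar> \<le> B * \<bar>x - y\<bar>"
proof -
  obtain q where q: "real_polynomial_function q" "\<And>x. x \<in> {0..b} \<Longrightarrow> \<bar>g' x - q x\<bar> < e"
    using Stone_Weierstrass_real_polynomial_function[OF compact_Icc assms(4,2)] by blast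
  obtain q' where q': "real_polynomial_function q'" "\<And>x. (q has_real_derivative q' x) (at x)"
    using has_real_derivative_polynomial_function[OF q(1)] by blast
  have bnd: "\<exists>B. \<forall>x\<in>{0..b}. \<bar>r x\<bar> \<le> B" if "real_polynomial_function r" for r
  proof -
    have "compact (r ` {0..b})"
      using that by (intro compact_continuous_image continuous_on_polymonial_function) (auto simp: real_polynomial_function_eq)
    then show ?thesis by (force dest: compact_imp_bounded simp: bounded_iff)
  qed
  obtain B1 B2 where B: "\<And>x. x \<in> {0..b} \<Longrightarrow> \<bar>q x\<bar> \<le> B1" "\<And>x. x \<in> {0..b} \<Longrightarrow> \<bar>q' x\<bar> \<le> B2"
    using bnd[OF q(1)] bnd[OF q'(1)] by blast
  define h where "h x = g 0 + integral {0..x} q" for x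
  have qc: "continuous_on {0..b} q"
    using q'(2) by (intro DERIV_continuous_on[where D = q']) (rule has_field_derivative_at_within)
  have h: "(h has_real_derivative q x) (at x within {0..b})" if "x \<in> {0..b}" for x
    unfolding h_def[abs_def] using integral_has_real_derivative[OF qc that]
    by (auto intro!: derivative_eq_intros)
  have "\<bar>g x - h x\<bar> \<le> e * b" if x: "x \<in> {0..b}" for x
  proof -
    have "norm ((g x - h x) - (g 0 - h 0)) \<le> e * norm (x - 0)"
    proof (rule field_differentiable_bound[of "{0..b}" "\<lambda>x. g x - h x" "\<lambda>x. g' x - q x"])
      show "((\<lambda>x. g x - h x) has_real_derivative g' z - q z) (at z within {0..b})" if "z \<in> {0..b}" for z
        using g'[OF that] h[OF that] by (rule DERIV_diff)
      show "norm (g' z - q z) \<le> e" if "z \<in> {0..b}" for z using q(2)[OF that] by simp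
    qed (use x \<open>0 < b\<close> in auto)
    also have "e * norm (x - 0) \<le> e * b" using x \<open>0 < e\<close> by (intro mult_left_mono) auto
    finally show ?thesis by (simp add: h_def)
  qed
  moreover have "\<bar>q x - q y\<bar> \<le> max B1 B2 * \<bar>x - y\<bar>" if "x \<in> {0..b}" "y \<in> {0..b}" for x y
  proof -
    have "norm (q x - q y) \<le> max B1 B2 * norm (x - y)"
      using that B(2) q'(2)
      by (intro field_differentiable_bound[of "{0..b}" q q']) (auto intro: has_field_derivative_at_within simp: le_max_iff_disj)
    then show ?thesis by simp
  qed
  ultimately show ?thesis
    using h q(2) B(1) by (intro that[of h q "max B1 B2"]) (auto intro: less_imp_le simp: le_max_iff_disj)
qed

theorem lipschitz_C1_core:
  fixes T :: "'s::finite \<Rightarrow> 's \<Rightarrow> real"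
  assumes b: "0 < b"
  shows "fluid_core b T c (lipschitz_C1 b)"
  unfolding fluid_core_def
proof (intro conjI ballI allI impI lipschitz_C1_subset_dom[OF b])
  fix g :: "real \<Rightarrow> 's \<Rightarrow> real" and \<eta> :: real
  assume g: "g \<in> fluid_dom b" and \<eta>: "0 < \<eta>"
  define R where "R = 1 + b + (\<Sum>i\<in>UNIV. \<Sum>j\<in>UNIV. \<bar>T i j\<bar>) * b + (\<Sum>i\<in>UNIV. \<bar>c i\<bar>)"
  define e where "e = \<eta> / (2 * R)"
  have sums: "0 \<le> (\<Sum>i\<in>UNIV. \<Sum>j\<in>UNIV. \<bar>T i j\<bar>)" "0 \<le> (\<Sum>i\<in>UNIV. \<bar>c i\<bar>)" by (simp_all add: sum_nonneg)
  then have R: "0 < R" using b by (simp add: R_def add_pos_nonneg)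
  have e: "0 < e" "R * e < \<eta>" using R \<eta> by (simp_all add: e_def)
  have d: "((\<lambda>x. g x i) has_real_derivative dx b g x i) (at x within {0..b})" if "x \<in> {0..b}" for x i
    using g that by (intro dx_works) (auto simp: fluid_dom_def)
  have c: "continuous_on {0..b} (\<lambda>x. dx b g x i)" for i using g by (simp add: fluid_dom_def)
  have "\<exists>h h' B. (\<forall>x\<in>{0..b}. (h has_real_derivative h' x) (at x within {0..b}) \<and> \<bar>g x i - h x\<bar> \<le> e * b
      \<and> \<bar>dx b g x i - h' x\<bar> \<le> e \<and> \<bar>h' x\<bar> \<le> B) \<and> (\<forall>x\<in>{0..b}. \<forall>y\<in>{0..b}. \<bar>h' x - h' y\<bar> \<le> B * \<bar>x - y\<bar>)" for i
    by (rule polynomial_C1_approximation[OF b e(1) d c, of i]) blast+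
  then obtain h h' B where
    h: "\<And>i x. x \<in> {0..b} \<Longrightarrow> (h i has_real_derivative h' i x) (at x within {0..b})"
    and close: "\<And>i x. x \<in> {0..b} \<Longrightarrow> \<bar>g x i - h i x\<bar> \<le> e * b" "\<And>i x. x \<in> {0..b} \<Longrightarrow> \<bar>dx b g x i - h' i x\<bar> \<le> e"
    and B: "\<And>i x. x \<in> {0..b} \<Longrightarrow> \<bar>h' i x\<bar> \<le> B i"
      "\<And>i x y. x \<in> {0..b} \<Longrightarrow> y \<in> {0..b} \<Longrightarrow> \<bar>h' i x - h' i y\<bar> \<le> B i * \<bar>x - y\<bar>"
    by metis
  let ?h = "\<lambda>x i. h i x"
  have dxh: "dx b ?h x i = h' i x" if "x \<in> {0..b}" for x i
    using dx_eqI[OF b that, of ?h i] h[OF that] by simp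
  show "\<exists>h\<in>lipschitz_C1 b. sup_norm b (\<lambda>x i. g x i - h x i) < \<eta> \<and>
      sup_norm b (\<lambda>x i. fluid_gen b T c g x i - fluid_gen b T c h x i) < \<eta>"
  proof (intro bexI conjI)
    have Bi: "B i \<le> (\<Sum>j\<in>UNIV. \<bar>B j\<bar>)" for i
      using member_le_sum[of i UNIV "\<lambda>j. \<bar>B j\<bar>"] by simp
    have "\<bar>dx b ?h x j\<bar> \<le> (\<Sum>j\<in>UNIV. \<bar>B j\<bar>)
        \<and> \<bar>dx b ?h x j - dx b ?h y j\<bar> \<le> (\<Sum>j\<in>UNIV. \<bar>B j\<bar>) * \<bar>x - y\<bar>" if "x \<in> {0..b}" "y \<in> {0..b}" for j x y
    proof -
      have "B j * \<bar>x - y\<bar> \<le> (\<Sum>j\<in>UNIV. \<bar>B j\<bar>) * \<bar>x - y\<bar>" by (intro mult_right_mono Bi) simp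
      then show ?thesis using B(1)[of x j] B(2)[of x y j] Bi[of j] that by (simp add: dxh)
    qed
    moreover have "(\<lambda>x. ?h x j) differentiable_on {0..b}" for j
      using h unfolding differentiable_on_def real_differentiable_def by blast
    ultimately show "?h \<in> lipschitz_C1 b" unfolding lipschitz_C1_def by blast
    have eR: "e * b \<le> R * e"
      using sums e b by (simp add: R_def algebra_simps)
    show "sup_norm b (\<lambda>x i. g x i - ?h x i) < \<eta>"
      using b close(1) eR e(2) by (intro sup_norm_less[of _ _ "R * e"]) (auto intro: order_trans)
    show "sup_norm b (\<lambda>x i. fluid_gen b T c g x i - fluid_gen b T c ?h x i) < \<eta>"
    proof (rule sup_norm_less[OF _ _ e(2)])
      fix x i assume x: "x \<in> {0..b}"
      have "(\<Sum>j\<in>UNIV. T i j * g x j) - (\<Sum>j\<in>UNIV. T i j * h j x) = (\<Sum>j\<in>UNIV. T i j * (g x j - h j x))"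
        by (simp add: sum_subtractf right_diff_distrib)
      also have "\<bar>\<dots>\<bar> \<le> (\<Sum>j\<in>UNIV. \<bar>T i j\<bar> * (e * b))"
        by (rule order_trans[OF sum_abs]) (auto intro!: sum_mono mult_left_mono close x simp: abs_mult)
      also have "\<dots> = (\<Sum>j\<in>UNIV. \<bar>T i j\<bar>) * (e * b)" by (simp add: sum_distrib_right)
      also have "\<dots> \<le> (\<Sum>i\<in>UNIV. \<Sum>j\<in>UNIV. \<bar>T i j\<bar>) * (e * b)"
        using e b member_le_sum[of i UNIV "\<lambda>i. \<Sum>j\<in>UNIV. \<bar>T i j\<bar>"]
        by (intro mult_right_mono) (auto simp: sum_nonneg)
      finally have 1: "\<bar>(\<Sum>j\<in>UNIV. T i j * g x j) - (\<Sum>j\<in>UNIV. T i j * h j x)\<bar>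
          \<le> (\<Sum>i\<in>UNIV. \<Sum>j\<in>UNIV. \<bar>T i j\<bar>) * (e * b)" .
      have "\<bar>c i * dx b g x i - c i * dx b ?h x i\<bar> \<le> \<bar>c i\<bar> * e"
        unfolding right_diff_distrib[symmetric] abs_mult dxh[OF x] by (intro mult_left_mono close x) auto
      also have "\<dots> \<le> (\<Sum>i\<in>UNIV. \<bar>c i\<bar>) * e"
        using e member_le_sum[of i UNIV "\<lambda>i. \<bar>c i\<bar>"] by (intro mult_right_mono) auto
      finally have 2: "\<bar>c i * dx b g x i - c i * dx b ?h x i\<bar> \<le> (\<Sum>i\<in>UNIV. \<bar>c i\<bar>) * e" .
      have "(\<Sum>i\<in>UNIV. \<Sum>j\<in>UNIV. \<bar>T i j\<bar>) * (e * b) + (\<Sum>i\<in>UNIV. \<bar>c i\<bar>) * e \<le> R * e"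
        "0 \<le> (\<Sum>i\<in>UNIV. \<bar>c i\<bar>) * e"
        using e b sums by (simp_all add: R_def algebra_simps)
      then show "\<bar>fluid_gen b T c g x i - fluid_gen b T c ?h x i\<bar> \<le> R * e"
        using 1 2 unfolding fluid_gen_def by (auto simp: abs_le_iff)
    qed (use b in simp)
  qed
qed

section \<open>Choice of the matrix exponential variable\<close>

text \<open>
  The parameters are \<open>w = 1 / \<rho>\<close> and \<open>m = \<rho>\<^sup>3\<close>, and \<open>\<theta>\<close> is determined by the mean \<open>\<Delta>\<close>. The
  main component then has mean \<open>\<Delta> - \<Delta> / (\<rho> + 1)\<close> and a standard deviation of order
  \<open>\<Delta> \<rho>\<^sup>-\<^sup>3\<^sup>/\<^sup>2\<close>, which is smaller than the gap \<open>\<Delta> / (\<rho> + 1)\<close>. The total variance is of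
  order \<open>\<Delta>\<^sup>2 / \<rho>\<close>, so that \<open>\<epsilon>\<close> is of larger order than the gap.
\<close>

lemma mixture_parameters:
  fixes \<rho> \<Delta> :: real
  assumes \<rho>: "2 \<le> \<rho>" and "0 < \<Delta>" and \<theta>: "\<theta> = (\<rho> ^ 3 + \<rho> ^ 2) / \<Delta>"
  shows "0 < \<theta>" "(1 + 1 / \<rho>) * \<rho> ^ 3 / \<theta> = \<Delta>"
    "((1 - 1 / \<rho>) * (\<rho> ^ 3 * (\<rho> ^ 3 + 1)) + 1 / \<rho> * (2 * \<rho> ^ 3 * (2 * \<rho> ^ 3 + 1))) / \<theta>\<^sup>2 - \<Delta>\<^sup>2
      = \<Delta>\<^sup>2 / (\<rho> + 1)\<^sup>2 * (\<rho> - 1 + 1 / \<rho> + 1 / \<rho>\<^sup>2)"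
    "\<rho> ^ 3 / \<theta> < \<Delta>"
    "1 / \<rho> + (\<rho> ^ 3 / \<theta>\<^sup>2) / (\<Delta> - \<rho> ^ 3 / \<theta>)\<^sup>2 = 2 / \<rho>"
    "\<Delta> - \<Delta> / \<rho> \<le> (\<rho> ^ 3 - 1) / \<theta>"
proof -
  have inv: "1 / \<theta> = \<Delta> / (\<rho>\<^sup>2 * (\<rho> + 1))"
    by (simp add: \<theta> power2_eq_square power3_eq_cube algebra_simps)
  have pos: "0 < \<rho>" "0 < \<rho> + 1" "0 < \<rho>\<^sup>2 * (\<rho> + 1)" using \<rho> by auto
  show "0 < \<theta>" unfolding \<theta> using pos \<open>0 < \<Delta>\<close> by (intro divide_pos_pos add_pos_pos) auto
  have th: "x / \<theta> = x * (\<Delta> / (\<rho>\<^sup>2 * (\<rho> + 1)))" for x using inv by (metis divide_inverse inverse_eq_divide)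
  have th2: "x / \<theta>\<^sup>2 = x * (\<Delta> / (\<rho>\<^sup>2 * (\<rho> + 1)))\<^sup>2" for x
    unfolding inv[symmetric] by (simp add: power_divide)
  have mean: "\<rho> ^ 3 / \<theta> = \<Delta> * (\<rho> / (\<rho> + 1))"
    unfolding th using pos by (simp add: field_simps power2_eq_square power3_eq_cube)
  show "(1 + 1 / \<rho>) * \<rho> ^ 3 / \<theta> = \<Delta>"
  proof -
    have "1 + 1 / \<rho> = (\<rho> + 1) / \<rho>" using pos by (simp add: field_simps)
    then show ?thesis unfolding times_divide_eq_right[symmetric] mean using pos by simp
  qed
  have gap: "\<Delta> - \<rho> ^ 3 / \<theta> = \<Delta> / (\<rho> + 1)"
    unfolding mean using pos by (simp add: field_simps)
  show "\<rho> ^ 3 / \<theta> < \<Delta>" using gap divide_pos_pos[OF \<open>0 < \<Delta>\<close> pos(2)] by linarith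
  have "(\<rho> ^ 3 / \<theta>\<^sup>2) / (\<Delta> - \<rho> ^ 3 / \<theta>)\<^sup>2 = 1 / \<rho>"
    unfolding gap th2 using pos \<open>0 < \<Delta>\<close> by (simp add: divide_simps power2_eq_square power3_eq_cube)
  then show "1 / \<rho> + (\<rho> ^ 3 / \<theta>\<^sup>2) / (\<Delta> - \<rho> ^ 3 / \<theta>)\<^sup>2 = 2 / \<rho>" by simp
  have "((1 - 1 / \<rho>) * (\<rho> ^ 3 * (\<rho> ^ 3 + 1)) + 1 / \<rho> * (2 * \<rho> ^ 3 * (2 * \<rho> ^ 3 + 1))) / \<theta>\<^sup>2
      = \<Delta>\<^sup>2 / (\<rho> + 1)\<^sup>2 * (((1 - 1 / \<rho>) * (\<rho> ^ 3 * (\<rho> ^ 3 + 1)) + 1 / \<rho> * (2 * \<rho> ^ 3 * (2 * \<rho> ^ 3 + 1))) / \<rho> ^ 4)"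
    unfolding th2 by (simp add: power_divide power_mult_distrib mult_ac)
  also have "((1 - 1 / \<rho>) * (\<rho> ^ 3 * (\<rho> ^ 3 + 1)) + 1 / \<rho> * (2 * \<rho> ^ 3 * (2 * \<rho> ^ 3 + 1))) / \<rho> ^ 4
      = (\<rho> - 1 + 1 / \<rho> + 1 / \<rho>\<^sup>2) + (\<rho> + 1)\<^sup>2"
    using pos by (simp add: divide_simps) (simp add: algebra_simps eval_nat_numeral)
  also have "\<Delta>\<^sup>2 / (\<rho> + 1)\<^sup>2 * ((\<rho> - 1 + 1 / \<rho> + 1 / \<rho>\<^sup>2) + (\<rho> + 1)\<^sup>2)
      = \<Delta>\<^sup>2 / (\<rho> + 1)\<^sup>2 * (\<rho> - 1 + 1 / \<rho> + 1 / \<rho>\<^sup>2) + \<Delta>\<^sup>2"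
    using pos by (simp add: distrib_left)
  finally show "((1 - 1 / \<rho>) * (\<rho> ^ 3 * (\<rho> ^ 3 + 1)) + 1 / \<rho> * (2 * \<rho> ^ 3 * (2 * \<rho> ^ 3 + 1))) / \<theta>\<^sup>2 - \<Delta>\<^sup>2
      = \<Delta>\<^sup>2 / (\<rho> + 1)\<^sup>2 * (\<rho> - 1 + 1 / \<rho> + 1 / \<rho>\<^sup>2)" by simp
  have "(\<rho> + 1) * (\<rho> - 1) * \<rho> \<le> \<rho> ^ 3 - 1"
    using \<rho> by (simp add: power3_eq_cube algebra_simps)
  then have "\<Delta> / (\<rho>\<^sup>2 * (\<rho> + 1)) * ((\<rho> + 1) * (\<rho> - 1) * \<rho>) \<le> \<Delta> / (\<rho>\<^sup>2 * (\<rho> + 1)) * (\<rho> ^ 3 - 1)"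
    using pos \<open>0 < \<Delta>\<close> by (intro mult_left_mono) auto
  also have "\<dots> = (\<rho> ^ 3 - 1) / \<theta>" by (simp add: th)
  also have "\<Delta> / (\<rho>\<^sup>2 * (\<rho> + 1)) * ((\<rho> + 1) * (\<rho> - 1) * \<rho>) = \<Delta> - \<Delta> / \<rho>"
    using pos by (simp add: divide_simps power2_eq_square) (simp add: algebra_simps)
  finally show "\<Delta> - \<Delta> / \<rho> \<le> (\<rho> ^ 3 - 1) / \<theta>" .
qed

text \<open>
  Equidistant points in \<open>[3 \<epsilon>, \<Delta> - 2 \<epsilon>)\<close> between the end points 0 and \<open>\<Delta>\<close>, so that the first
  gap exceeds \<open>2 \<epsilon>\<close> and the last point lies below \<open>\<Delta> - \<epsilon>\<close>.
\<close>

definition nodes :: "real \<Rightarrow> real \<Rightarrow> nat \<Rightarrow> nat \<Rightarrow> real" where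
  "nodes \<Delta> \<epsilon> p n = (if n = 0 then 0 else if n < p then 3 * \<epsilon> + (real n - 1) * ((\<Delta> - 5 * \<epsilon>) / (real p - 1)) else \<Delta>)"

lemma nodes:
  assumes "0 < \<epsilon>" "5 * \<epsilon> < \<Delta>" "2 \<le> p"
  shows "nodes \<Delta> \<epsilon> p 0 = 0" "nodes \<Delta> \<epsilon> p p = \<Delta>" "nodes \<Delta> \<epsilon> p 1 = 3 * \<epsilon>"
    "n < p \<Longrightarrow> nodes \<Delta> \<epsilon> p n < \<Delta> - \<epsilon>"
    "n < p \<Longrightarrow> nodes \<Delta> \<epsilon> p n < nodes \<Delta> \<epsilon> p (Suc n)"
    "n < p \<Longrightarrow> nodes \<Delta> \<epsilon> p n = 0 \<or> \<epsilon> \<le> nodes \<Delta> \<epsilon> p n"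
    "n < p \<Longrightarrow> nodes \<Delta> \<epsilon> p (Suc n) - nodes \<Delta> \<epsilon> p n \<le> 3 * \<epsilon> + \<Delta> / (real p - 1)"
proof -
  define s where "s = (\<Delta> - 5 * \<epsilon>) / (real p - 1)"
  have s: "0 < s" "s * (real p - 1) = \<Delta> - 5 * \<epsilon>" using assms by (auto simp: s_def)
  have s_le: "s \<le> \<Delta> / (real p - 1)" unfolding s_def using assms by (intro divide_right_mono) auto
  have form: "nodes \<Delta> \<epsilon> p n = 3 * \<epsilon> + (real n - 1) * s" if "0 < n" "n < p" for n
    using that by (simp add: nodes_def s_def)
  have last: "(real n - 1) * s \<le> \<Delta> - 5 * \<epsilon> - s" if "n < p" for n
  proof -
    have "(real n - 1) * s \<le> (real p - 1 - 1) * s" using that s by (intro mult_right_mono) auto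
    then show ?thesis using s(2) by (simp add: algebra_simps)
  qed
  show "nodes \<Delta> \<epsilon> p 0 = 0" "nodes \<Delta> \<epsilon> p p = \<Delta>" "nodes \<Delta> \<epsilon> p 1 = 3 * \<epsilon>"
    using assms by (auto simp: nodes_def)
  show "nodes \<Delta> \<epsilon> p n < \<Delta> - \<epsilon>" if "n < p"
    using last[OF that] form[of n] that assms s by (cases "n = 0") (auto simp: nodes_def)
  show "nodes \<Delta> \<epsilon> p n = 0 \<or> \<epsilon> \<le> nodes \<Delta> \<epsilon> p n" if "n < p"
    using form[of n] that assms s by (cases "n = 0") (auto simp: nodes_def)
  have "nodes \<Delta> \<epsilon> p n < nodes \<Delta> \<epsilon> p (Suc n) \<and> nodes \<Delta> \<epsilon> p (Suc n) - nodes \<Delta> \<epsilon> p n \<le> 3 * \<epsilon> + s" if "n < p"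
  proof (cases "n = 0")
    case True
    then show ?thesis using assms s by (simp add: nodes_def)
  next
    case False
    show ?thesis
    proof (cases "Suc n < p")
      case True
      then show ?thesis using False form[of n] form[of "Suc n"] s assms by (simp add: algebra_simps)
    next
      case last': False
      then have p: "p = Suc n" using that by simp
      have "(real n - 1) * s = \<Delta> - 5 * \<epsilon> - s" using s(2) by (simp add: p algebra_simps)
      then show ?thesis using form[of n] False s assms by (simp add: p nodes_def[of _ _ _ "Suc n"])
    qed
  qed
  then show "n < p \<Longrightarrow> nodes \<Delta> \<epsilon> p n < nodes \<Delta> \<epsilon> p (Suc n)"
    "n < p \<Longrightarrow> nodes \<Delta> \<epsilon> p (Suc n) - nodes \<Delta> \<epsilon> p n \<le> 3 * \<epsilon> + \<Delta> / (real p - 1)"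
    using s_le by auto
qed

text \<open>
  For fixed \<open>f\<close> the bound tends to 0 as \<open>r\<close> grows, because \<open>\<epsilon>\<close>, the probability bound
  \<open>2 / r\<close> of exceeding \<open>\<Delta>\<close>, and the mesh width do.
\<close>

lemma qbd_rap_from_mixture:
  fixes T :: "'s::finite \<Rightarrow> 's \<Rightarrow> real" and c :: "'s \<Rightarrow> real" and b :: real and K r :: nat
    and f :: "real \<Rightarrow> 's \<Rightarrow> real"
  defines "\<rho> \<equiv> real r"
  assumes c: "\<And>i. c i \<noteq> 0" and b: "0 < b" and K: "1 \<le> K" and \<Delta>: "\<Delta> = b / real K"
    and r: "2 \<le> r"
    and \<sigma>: "\<sigma> = \<Delta>\<^sup>2 / (\<rho> + 1)\<^sup>2 * (\<rho> - 1 + 1 / \<rho> + 1 / \<rho>\<^sup>2)" and \<epsilon>: "\<epsilon> = root 3 \<sigma>"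
    and small: "\<epsilon> \<le> 1 / 2" "5 * \<epsilon> < \<Delta>" "\<Delta> / \<rho> \<le> \<epsilon> / 2"
    and f_deriv: "\<And>x j. x \<in> {0..b} \<Longrightarrow> ((\<lambda>x. f x j) has_real_derivative dx b f x j) (at x within {0..b})"
    and dx_bound: "\<And>x j. x \<in> {0..b} \<Longrightarrow> \<bar>dx b f x j\<bar> \<le> L"
    and dx_lip: "\<And>x y j. x \<in> {0..b} \<Longrightarrow> y \<in> {0..b} \<Longrightarrow> \<bar>dx b f x j - dx b f y j\<bar> \<le> L * \<bar>x - y\<bar>"
  shows "\<exists>(M :: real measure) Z p t \<alpha> S. qbd_rap_data M Z \<Delta> p t \<alpha> S \<and> prob_space.variance M Z = \<sigma> \<and>
    (\<forall>x\<in>{0..b}. \<forall>i. \<bar>qbd_apply b K T c p t \<alpha> S (jump_mat \<Delta> (eps M Z) p \<alpha> S) f x i - fluid_gen b T c f x i\<bar>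
      \<le> ((\<Sum>j\<in>UNIV. \<bar>T i j\<bar>) + \<bar>c i\<bar>) * (L * (34 * \<epsilon> + (4 + 2 * \<Delta>) * (2 / \<rho>))
          + L * (3 * \<epsilon> + \<Delta> / (2 * \<rho> ^ 3 - 1))))"
proof -
  define m where "m = r ^ 3"
  define \<theta> where "\<theta> = (\<rho> ^ 3 + \<rho> ^ 2) / \<Delta>"
  define t where "t = nodes \<Delta> \<epsilon> (2 * m)"
  have \<rho>: "2 \<le> \<rho>" and m: "real m = \<rho> ^ 3" using r by (simp_all add: \<rho>_def m_def)
  have \<Delta>_pos: "0 < \<Delta>" using b K by (simp add: \<Delta>)
  note par = mixture_parameters[OF \<rho> \<Delta>_pos \<theta>_def]
  have m1: "1 \<le> m" using r by (simp add: m_def)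
  interpret E: erlang_mixture \<theta> m "1 / \<rho>"
    using par(1) m1 \<rho> by unfold_locales auto
  have \<sigma>_pos: "0 < \<sigma>" unfolding \<sigma> using \<rho> \<Delta>_pos by (intro mult_pos_pos divide_pos_pos add_pos_pos) auto
  have \<epsilon>_pos: "0 < \<epsilon>" and \<epsilon>3: "\<epsilon> ^ 3 = \<sigma>" using \<sigma>_pos by (simp_all add: \<epsilon>)
  note mean = E.mean_eq[unfolded m par(2)] and square = E.square_eq[unfolded m]
  note mom = E.moments[OF mean square, unfolded par(3)[folded \<sigma>]]
  note node = nodes[OF \<epsilon>_pos small(2), of "2 * m", folded t_def]
  have p2: "2 \<le> 2 * m" using m1 by simp
  have t_mono: "strict_mono_on {..<2 * m} t"
  proof (rule strict_mono_onI)
    fix i j assume ij: "i \<in> {..<2 * m}" "j \<in> {..<2 * m}" "i < j"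
    have "t i < t (Suc i)" using node(5)[OF p2] ij by simp
    also have "\<dots> \<le> t j"
    proof (rule steps_mono[of "2 * m" t])
      show "t n \<le> t (Suc n)" if "n < 2 * m" for n using node(5)[OF p2 that] by simp
    qed (use ij in auto)
    finally show "t i < t j" .
  qed
  have t_nonneg: "0 \<le> t n" if "n < 2 * m" for n
    using node(6)[OF p2 that] \<epsilon>_pos by auto
  interpret N: node_representation \<theta> "2 * m" t E.surv_coeff E.Fm
  proof
    show "inj_on t {..<2 * m}" using t_mono by (rule strict_mono_on_imp_inj_on)
    show "0 < E.Fm (t n)" if "n < 2 * m" for n using E.Fm_pos[OF t_nonneg[OF that]] .
  qed (use par(1) m1 in auto)
  have dens: "N.density = E.fm" by (simp add: N.density_coeff_def[abs_def])
  define U where "U = exp_poly \<theta> (2 * m) (N.fold_coeff (2 * \<Delta>))"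
  interpret A: fluid_approximation \<theta> "2 * m" t E.surv_coeff E.Fm \<Delta> \<epsilon> "2 / \<rho>" E.fm U b K T c f L
    "3 * \<epsilon> + \<Delta> / (2 * \<rho> ^ 3 - 1)"
  proof
    show "0 < \<Delta>" "0 < \<epsilon>" "\<epsilon> \<le> 1 / 2" by fact+
    show "2 * \<epsilon> < \<Delta>" using small \<epsilon>_pos by simp
    show "continuous_on UNIV U" unfolding U_def by (rule exp_poly_cont)
    show "U x = E.fm x + U (x + 2 * \<Delta>)" for x
      unfolding U_def dens[symmetric] using \<Delta>_pos by (intro N.fold_period) simp
    show "(U \<longlongrightarrow> 0) at_top" unfolding U_def by (rule exp_poly_lim[OF par(1)])
    show "integral {0..A} (\<lambda>z. E.fm z * (z - \<Delta>)\<^sup>2) \<le> \<epsilon> ^ 3" if "0 \<le> A" for A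
      using mom(4)[OF that] by (simp add: \<epsilon>3)
    show "E.Fm \<Delta> \<le> 2 / \<rho>" using E.tail_bound[of \<Delta>] par(4,5) by (simp add: m)
    show "mono_on {0..\<Delta> - \<epsilon> / 2} E.fm"
      using par(6) small(3) by (intro mono_on_subset[OF E.density_increasing]) (auto simp: m)
    show "t n < t (Suc n)" "t n \<le> \<Delta> - \<epsilon>" "t n = 0 \<or> \<epsilon> \<le> t n"
      "t (Suc n) - t n \<le> 3 * \<epsilon> + \<Delta> / (2 * \<rho> ^ 3 - 1)" if "n < 2 * m" for n
      using node(4-7)[OF p2 that] by (auto simp: m)
    show "t 0 = 0" "t (2 * m) = \<Delta>" using node(1,2)[OF p2] by auto
    show "1 \<le> K" "\<Delta> = b / real K" by fact+
    show "E.fm = N.density" by (simp add: dens)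
    show "U = exp_poly \<theta> (2 * m) (N.fold_coeff (2 * \<Delta>))" by (rule U_def)
  qed (use c f_deriv dx_bound dx_lip E.Fm_deriv E.f_cont E.f_nonneg E.F_lim E.F_0 in auto)
  have eps: "eps E.law E.Z = \<epsilon>" unfolding eps_def \<epsilon> mom(3) ..
  have top: "E.surv_coeff (2 * m - 1) \<noteq> 0" using par(1) \<rho> m1 by (simp add: E.surv_coeff_def)
  have rep: "ME_representation E.law E.Z (2 * m) A.\<alpha> N.gen_mat"
    unfolding ME_representation_def
  proof (intro conjI allI impI)
    show "A.\<alpha> \<in> carrier_mat 1 (2 * m)" by (rule A.alpha_carrier)
    show "distributed E.law lborel E.Z (\<lambda>x. if 0 \<le> x
        then ennreal ((A.\<alpha> * mat_exp (x \<cdot>\<^sub>m N.gen_mat) * exit_rates N.gen_mat) $$ (0, 0)) else 0)"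
      using E.distributed_pos unfolding A.alpha_density E.dens_def[abs_def]
      by (simp add: if_distrib[of ennreal] cong: if_cong)
    show "\<P>(\<omega> in E.law. x < E.Z \<omega>) = (A.\<alpha> * mat_exp (x \<cdot>\<^sub>m N.gen_mat) * ones (2 * m)) $$ (0, 0)" if "0 \<le> x" for x
      using E.prob_pos_gt[OF that] unfolding A.alpha_survival by simp
  qed simp
  have minimal: "2 * m \<le> p'" if rep': "ME_representation E.law E.Z p' \<alpha>' S'" for p' \<alpha>' S'
  proof (rule ccontr)
    assume "\<not> 2 * m \<le> p'"
    with rep' obtain a where a: "\<exists>n<2 * m. a n \<noteq> 0"
      "\<And>x. (\<Sum>n<2 * m. a n * (\<alpha>' * mat_exp ((x + t n) \<cdot>\<^sub>m S') * ones p') $$ (0, 0)) = 0"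
      using short_representation_dependent[of \<alpha>' p' S' "2 * m" t] by (auto simp: ME_representation_def)
    have "a n * E.Fm (t n) = 0" if "n < 2 * m" for n
    proof (rule N.survival_independent[OF top _ that])
      fix x :: real assume x: "0 \<le> x"
      have "(\<alpha>' * mat_exp ((x + t n) \<cdot>\<^sub>m S') * ones p') $$ (0, 0) = E.Fm (x + t n)" if "n < 2 * m" for n
        using rep' E.prob_pos_gt[of "x + t n"] x t_nonneg[OF that] by (simp add: ME_representation_def)
      then show "(\<Sum>n<2 * m. a n * E.Fm (t n) * (E.Fm (x + t n) / E.Fm (t n))) = 0"
        using a(2)[of x] by simp
    qed
    with a(1) show False using N.F_node_pos by fastforce
  qed
  have data: "qbd_rap_data E.law E.Z \<Delta> (2 * m) t A.\<alpha> N.gen_mat"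
    unfolding qbd_rap_data_def eps
  proof (intro conjI ballI allI impI)
    show "prob_space E.law" by (rule E.prob_space_axioms)
    show "E.Z \<in> borel_measurable E.law" by simp
    show "0 \<le> E.Z \<omega>" for \<omega> by (simp add: E.Z_def)
    show "\<P>(\<omega> in E.law. E.Z \<omega> = 0) = 0" by (rule E.prob_pos_0)
    show "integrable E.law (\<lambda>\<omega>. (E.Z \<omega>)\<^sup>2)" "E.expectation E.Z = \<Delta>" by (rule mom)+
    show "\<epsilon> < 1" using small by simp
    show "minimal_ME_representation E.law E.Z (2 * m) A.\<alpha> N.gen_mat"
      using rep minimal by (simp add: minimal_ME_representation_def)
    show "2 \<le> 2 * m" "t 0 = 0" "0 < 2 * \<epsilon>" "2 * \<epsilon> < t 1" "t (2 * m - 1) < \<Delta> - \<epsilon>" "t (2 * m) = \<Delta>"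
      using node(1-4)[OF p2] \<epsilon>_pos m1 p2 by auto
    show "t n < t (Suc n)" if "n \<in> {1..<2 * m - 1}" for n using node(5)[OF p2] that by auto
    show "A.\<alpha> = Matrix.mat 1 (2 * m) (\<lambda>(_, m). if m = 0 then 1 else 0)" by (rule A.\<alpha>_def)
    show "(mat_exp (x \<cdot>\<^sub>m N.gen_mat) * ones (2 * m)) $$ (n, 0)
        = \<P>(\<omega> in E.law. E.Z \<omega> - t n \<ge> x \<bar> E.Z \<omega> > t n)" if "n < 2 * m" "0 \<le> x" for n x
      using E.residual_life[OF that(2) t_nonneg[OF that(1)]] N.survival_entry[OF that(1)] by simp
    show "a n = 0" if "\<forall>x\<ge>0. (\<Sum>n<2 * m. a n * (mat_exp (x \<cdot>\<^sub>m N.gen_mat) * ones (2 * m)) $$ (n, 0)) = 0"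
      "n < 2 * m" for a n
      by (rule N.survival_independent[OF top _ that(2)]) (use that(1) N.survival_entry in auto)
  qed
  show ?thesis
  proof (intro exI conjI ballI allI)
    show "qbd_rap_data E.law E.Z \<Delta> (2 * m) t A.\<alpha> N.gen_mat" by (rule data)
    show "E.variance E.Z = \<sigma>" by (rule mom(3))
    show "\<bar>qbd_apply b K T c (2 * m) t A.\<alpha> N.gen_mat (jump_mat \<Delta> (eps E.law E.Z) (2 * m) A.\<alpha> N.gen_mat) f x i
        - fluid_gen b T c f x i\<bar>
      \<le> ((\<Sum>j\<in>UNIV. \<bar>T i j\<bar>) + \<bar>c i\<bar>) * (L * (34 * \<epsilon> + (4 + 2 * \<Delta>) * (2 / \<rho>))
          + L * (3 * \<epsilon> + \<Delta> / (2 * \<rho> ^ 3 - 1)))" if "x \<in> {0..b}" for x i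
      using A.qbd_apply_error[OF that, of i] unfolding eps A.size_of_rates_def A.error_bound_def .
  qed
qed

theorem theorem5p3:
  fixes T :: "'s::finite \<Rightarrow> 's \<Rightarrow> real" and c :: "'s \<Rightarrow> real" and b :: real and K :: nat
  assumes "generator_matrix T"
    and "\<And>i. c i \<noteq> 0"
    and "0 < b"
    and "1 \<le> K"
  shows "(\<forall>f\<in>lipschitz_C1 b. \<forall>\<delta>>0. \<forall>v>0.
           \<exists>(M :: real measure) (Z :: real \<Rightarrow> real) p t \<alpha> S.
             qbd_rap_data M Z (b / real K) p t \<alpha> S \<and> prob_space.variance M Z < v \<and>
             sup_norm b (\<lambda>x i.
               qbd_apply b K T c p t \<alpha> S (jump_mat (b / real K) (eps M Z) p \<alpha> S) f x i
               - fluid_gen b T c f x i) < \<delta>)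
         \<and> fluid_core b T c (lipschitz_C1 b)"
proof (intro conjI ballI allI impI lipschitz_C1_core assms(3))
  fix f :: "real \<Rightarrow> 's \<Rightarrow> real" and \<delta> v :: real
  assume f: "f \<in> lipschitz_C1 b" and \<delta>: "0 < \<delta>" and v: "0 < v"
  obtain G L' where diff: "\<And>j. (\<lambda>x. f x j) differentiable_on {0..b}"
    and G: "\<And>j x. x \<in> {0..b} \<Longrightarrow> \<bar>dx b f x j\<bar> \<le> G"
    and L': "\<And>j x y. x \<in> {0..b} \<Longrightarrow> y \<in> {0..b} \<Longrightarrow> \<bar>dx b f x j - dx b f y j\<bar> \<le> L' * \<bar>x - y\<bar>"
    using f unfolding lipschitz_C1_def by blast
  define L where "L = max G L'"
  have GL: "\<bar>dx b f x j\<bar> \<le> L" if "x \<in> {0..b}" for j x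
    using G[OF that, of j] by (simp add: L_def)
  have LL: "\<bar>dx b f x j - dx b f y j\<bar> \<le> L * \<bar>x - y\<bar>" if "x \<in> {0..b}" "y \<in> {0..b}" for j x y
    using L'[OF that, of j] by (rule order_trans) (simp add: L_def mult_right_mono)
  define \<Delta> where "\<Delta> = b / real K"
  have \<Delta>_pos: "0 < \<Delta>" using assms(3,4) by (simp add: \<Delta>_def)
  define \<sigma> where "\<sigma> r = \<Delta>\<^sup>2 / (real r + 1)\<^sup>2 * (real r - 1 + 1 / real r + 1 / (real r)\<^sup>2)" for r :: nat
  define \<epsilon> where "\<epsilon> r = root 3 (\<sigma> r)" for r
  define R where "R = (\<Sum>i\<in>UNIV. (\<Sum>j\<in>UNIV. \<bar>T i j\<bar>) + \<bar>c i\<bar>)"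
  define e where "e r = L * (34 * \<epsilon> r + (4 + 2 * \<Delta>) * (2 / real r)) + L * (3 * \<epsilon> r + \<Delta> / (2 * real r ^ 3 - 1))" for r
  have \<sigma>_lim: "\<sigma> \<longlonglongrightarrow> 0" unfolding \<sigma>_def[abs_def] by real_asymp
  have \<epsilon>_lim: "\<epsilon> \<longlonglongrightarrow> 0" unfolding \<epsilon>_def[abs_def] using tendsto_real_root[OF \<sigma>_lim, of 3] by simp
  have "(\<lambda>r. 2 / real r) \<longlonglongrightarrow> 0" "(\<lambda>r. \<Delta> / (2 * real r ^ 3 - 1)) \<longlonglongrightarrow> 0" by real_asymp+
  then have "e \<longlonglongrightarrow> L * (34 * 0 + (4 + 2 * \<Delta>) * 0) + L * (3 * 0 + 0)"
    unfolding e_def[abs_def] by (intro tendsto_intros \<epsilon>_lim)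
  then have "(\<lambda>r. R * e r) \<longlonglongrightarrow> R * 0" by (intro tendsto_intros) simp
  then have ev1: "\<forall>\<^sub>F r in sequentially. R * e r < \<delta>" using order_tendstoD(2)[OF _ \<delta>] by simp
  \<comment> \<open>The density increases up to \<open>\<Delta> - \<Delta> / r\<close>, which has to lie above \<open>\<Delta> - \<epsilon> / 2\<close>.\<close>
  have "\<forall>\<^sub>F r in sequentially. (2 * \<Delta> / real r) ^ 3 \<le> \<sigma> r"
    unfolding \<sigma>_def using \<Delta>_pos by real_asymp
  then have ev2: "\<forall>\<^sub>F r in sequentially. \<Delta> / real r \<le> \<epsilon> r / 2"
  proof eventually_elim
    case (elim r)
    have "root 3 ((2 * \<Delta> / real r) ^ 3) \<le> \<epsilon> r" unfolding \<epsilon>_def using elim by simp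
    then show ?case by (simp add: odd_real_root_power_cancel mult.commute)
  qed
  have "\<forall>\<^sub>F r in sequentially. \<sigma> r < v \<and> \<epsilon> r < 1 / 2 \<and> \<epsilon> r < \<Delta> / 5 \<and> 2 \<le> r"
    using v \<Delta>_pos order_tendstoD(2)[OF \<sigma>_lim] order_tendstoD(2)[OF \<epsilon>_lim, of "1 / 2"]
      order_tendstoD(2)[OF \<epsilon>_lim, of "\<Delta> / 5"] eventually_ge_at_top[of 2]
    by (intro eventually_conj) auto
  with ev1 ev2 have "\<forall>\<^sub>F r in sequentially. R * e r < \<delta> \<and> \<Delta> / real r \<le> \<epsilon> r / 2 \<and> \<sigma> r < v
      \<and> \<epsilon> r < 1 / 2 \<and> \<epsilon> r < \<Delta> / 5 \<and> 2 \<le> r"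
    by eventually_elim auto
  then obtain r where r: "R * e r < \<delta>" "\<Delta> / real r \<le> \<epsilon> r / 2" "\<sigma> r < v" "\<epsilon> r < 1 / 2" "\<epsilon> r < \<Delta> / 5" "2 \<le> r"
    by (auto simp: eventually_sequentially)
  have small: "\<epsilon> r \<le> 1 / 2" "5 * \<epsilon> r < \<Delta>" using r(4,5) by auto
  have "\<exists>(M :: real measure) Z p t \<alpha> S. qbd_rap_data M Z \<Delta> p t \<alpha> S \<and> prob_space.variance M Z = \<sigma> r \<and>
      (\<forall>x\<in>{0..b}. \<forall>i. \<bar>qbd_apply b K T c p t \<alpha> S (jump_mat \<Delta> (eps M Z) p \<alpha> S) f x i - fluid_gen b T c f x i\<bar>
        \<le> ((\<Sum>j\<in>UNIV. \<bar>T i j\<bar>) + \<bar>c i\<bar>) * e r)"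
    unfolding e_def
    by (rule qbd_rap_from_mixture[OF assms(2,3,4) \<Delta>_def r(6) \<sigma>_def \<epsilon>_def small r(2) dx_works[OF diff] GL LL])
  then obtain M :: "real measure" and Z p t \<alpha> S where Z: "qbd_rap_data M Z \<Delta> p t \<alpha> S" "prob_space.variance M Z = \<sigma> r"
    and err: "\<And>x i. x \<in> {0..b} \<Longrightarrow> \<bar>qbd_apply b K T c p t \<alpha> S (jump_mat \<Delta> (eps M Z) p \<alpha> S) f x i - fluid_gen b T c f x i\<bar>
      \<le> ((\<Sum>j\<in>UNIV. \<bar>T i j\<bar>) + \<bar>c i\<bar>) * e r"
    by blast
  have "0 \<le> L" using order_trans[OF abs_ge_zero GL[of 0]] assms(3) by simp
  have "0 \<le> \<Delta> / real r" using \<Delta>_pos by simp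
  then have "0 \<le> \<epsilon> r" using r(2) by linarith
  have "0 < 2 * real r ^ 3 - 1" using r(6) power_mono[of 2 "real r" 3] by simp
  then have "0 \<le> e r" unfolding e_def using \<open>0 \<le> L\<close> \<open>0 \<le> \<epsilon> r\<close> \<Delta>_pos
    by (intro add_nonneg_nonneg mult_nonneg_nonneg) auto
  have "\<bar>qbd_apply b K T c p t \<alpha> S (jump_mat \<Delta> (eps M Z) p \<alpha> S) f x i - fluid_gen b T c f x i\<bar> \<le> R * e r"
    if "x \<in> {0..b}" for x i
  proof (rule order_trans[OF err[OF that]], rule mult_right_mono[OF _ \<open>0 \<le> e r\<close>])
    show "(\<Sum>j\<in>UNIV. \<bar>T i j\<bar>) + \<bar>c i\<bar> \<le> R"
      unfolding R_def by (rule member_le_sum[where f = "\<lambda>i. (\<Sum>j\<in>UNIV. \<bar>T i j\<bar>) + \<bar>c i\<bar>"]) (auto simp: sum_nonneg)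
  qed
  then have sup: "sup_norm b (\<lambda>x i. qbd_apply b K T c p t \<alpha> S (jump_mat \<Delta> (eps M Z) p \<alpha> S) f x i
      - fluid_gen b T c f x i) < \<delta>"
    using assms(3) r(1) by (intro sup_norm_less[of _ _ "R * e r"]) auto
  show "\<exists>(M :: real measure) (Z :: real \<Rightarrow> real) p t \<alpha> S.
      qbd_rap_data M Z (b / real K) p t \<alpha> S \<and> prob_space.variance M Z < v \<and>
      sup_norm b (\<lambda>x i. qbd_apply b K T c p t \<alpha> S (jump_mat (b / real K) (eps M Z) p \<alpha> S) f x i
        - fluid_gen b T c f x i) < \<delta>"
    unfolding \<Delta>_def[symmetric]
  proof (intro exI conjI)
    show "qbd_rap_data M Z \<Delta> p t \<alpha> S" by (rule Z(1))
    show "prob_space.variance M Z < v" using Z(2) r(3) by simp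
    show "sup_norm b (\<lambda>x i. qbd_apply b K T c p t \<alpha> S (jump_mat \<Delta> (eps M Z) p \<alpha> S) f x i
      - fluid_gen b T c f x i) < \<delta>" by (rule sup)
  qed
qed

end
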